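(* Let $n\ge 2$, let $\mathbf z\in\mathbb C^n\setminus\{\mathbf 0\}$ and let $\phi$ be a smooth complex-valued function on $\mathbf S^n$. Then, as $\hbar\searrow 0$, $$\mathbf B^\hbar_{-1}(\phi)(\mathbf z)=\phi\!\left(\frac{\mathbf z}{|\mathbf z|}\right)+\frac{\hbar}{4|\mathbf z|}\Big[\big(4\Delta_{\mathbf x\overline{\mathbf x}}-\mathcal R^2-(2n-2)\mathcal R\big)\phi\Big]\!\left(\frac{\mathbf z}{|\mathbf z|}\right)+\mathrm O(\hbar^2),$$ where $\Delta_{\mathbf x\overline{\mathbf x}}=\sum_{j=1}^n\partial_{x_j}\partial_{\overline x_j}$ and $\mathcal R=\sum_{j=1}^n\big(x_j\partial_{x_j}+\overline x_j\partial_{\overline x_j}\big)$ are the Laplace operator and the radial derivative on $\mathbb C^n\cong\mathbb R^{2n}$.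
   Context: For $\mathbf a,\mathbf b\in\mathbb C^n$, $\mathbf a\cdot\mathbf b=\sum_{j=1}^n a_j\overline{b_j}$ and $|\mathbf a|=\sqrt{\mathbf a\cdot\mathbf a}$. $\mathbf S^n=\{\mathbf x\in\mathbb C^n: |\mathbf x|=1\}$ (real dimension $2n-1$), with normalized surface measure $\mathrm d\mathbf S_n$; $\langle\phi,\psi\rangle_{\mathbf S^n}=\int_{\mathbf S^n}\phi\overline\psi\,\mathrm d\mathbf S_n$ on $L^2(\mathbf S^n)$. $\mathcal O\subset L^2(\mathbf S^n)$ is the Hilbert space of functions whose Poisson extension into the interior of $\mathbf S^n$ is holomorphic, and $\mathbf P:L^2(\mathbf S^n)\to\mathcal O$ is the orthogonal projection. For $\hbar>0$ and $p>-n$ put $\mathbf K^\hbar_{n,p}(\mathbf x,\mathbf z)=\sum_{\ell=0}^\infty\frac{c_{\ell,p}}{\ell!}\left(\frac{\mathbf x\cdot\mathbf z}{\hbar}\right)^\ell$ for $\mathbf x\in\mathbf S^n$, $\mathbf z\in\mathbb C^n$, where $c_{\ell,p}>0$, $(c_{\ell,p})^2=\frac{(n)_\ell}{(n+p)_\ell}$ and $(a)_\ell=a(a+1)\cdots(a+\ell-1)$. For $p=-1$ this gives $c_{\ell,-1}=\sqrt{\frac{\ell}{n-1}+1}$. The covariant symbol of an operator $A$ with domain in $\mathcal O$ is $\mathfrak B_{\hbar,p}(A)(\mathbf z)=\frac{\langle A\mathbf K^\hbar_{n,p}(\cdot,\mathbf z),\mathbf K^\hbar_{n,p}(\cdot,\mathbf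 z)\rangle_{\mathbf S^n}}{\langle\mathbf K^\hbar_{n,p}(\cdot,\mathbf z),\mathbf K^\hbar_{n,p}(\cdot,\mathbf z)\rangle_{\mathbf S^n}}$. For $\phi\in C^\infty(\mathbf S^n)$ the Toeplitz operator is $\mathcal T_\phi\psi=\mathbf P(\phi\psi)$, $\psi\in\mathcal O$, and the Berezin transform is $\mathbf B^\hbar_p(\phi)=\mathfrak B_{\hbar,p}(\mathcal T_\phi)\in C^\infty(\mathbb C^n)$. The differential operators $\Delta_{\mathbf x\overline{\mathbf x}}$ and $\mathcal R$ are applied to any smooth extension of $\phi$ to a neighbourhood of $\mathbf S^n$ in $\mathbb C^n$, and the result is evaluated at $\mathbf z/|\mathbf z|$. *)

theory Defs
  imports "HOL-Probability.Probability"
begin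

definition herm_inner :: "complex ^ 'n::finite \<Rightarrow> complex ^ 'n \<Rightarrow> complex" where
  "herm_inner a b = (\<Sum>j\<in>UNIV. a $ j * cnj (b $ j))"

(* Normalized surface measure in polar coordinates: the image of normalized Lebesgue measure
   on the unit ball under radial projection. The origin, which is sent to 0, is a null set;
   restricting the result to the sphere removes it. *)
definition sphere_measure :: "(complex ^ 'n::finite) measure" where
  "sphere_measure =
     restrict_space
       (distr (uniform_measure lborel (ball 0 1)) borel (\<lambda>x. x /\<^sub>R norm x))
       (sphere 0 1)"

definition sphere_inner ::
    "(complex ^ 'n::finite \<Rightarrow> complex) \<Rightarrow> (complex ^ 'n \<Rightarrow> complex) \<Rightarrow> complex" where
  "sphere_inner f g = (LINT x|sphere_measure. f x * cnj (g x))"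

(* Elements of L2 are represented by functions, not by classes modulo null sets. *)
definition sphere_L2 :: "(complex ^ 'n::finite \<Rightarrow> complex) set" where
  "sphere_L2 = {f \<in> borel_measurable sphere_measure.
                  integrable sphere_measure (\<lambda>x. (cmod (f x))\<^sup>2)}"

(* The Poisson kernel of the unit ball of real dimension 2n. *)
definition poisson_extension ::
    "(complex ^ 'n::finite \<Rightarrow> complex) \<Rightarrow> complex ^ 'n \<Rightarrow> complex" where
  "poisson_extension f w =
     (LINT x|sphere_measure.
        of_real ((1 - (norm w)\<^sup>2) / norm (w - x) ^ (2 * CARD('n))) * f x)"

definition holomorphic_several_on ::
    "(complex ^ 'n::finite \<Rightarrow> complex) \<Rightarrow> (complex ^ 'n) set \<Rightarrow> bool" where
  "holomorphic_several_on f U \<longleftrightarrow>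
     (\<forall>w\<in>U. \<exists>D. (f has_derivative D) (at w) \<and> (\<forall>c v. D (c *s v) = c * D v))"

definition hardy_space :: "(complex ^ 'n::finite \<Rightarrow> complex) set" where
  "hardy_space = {f \<in> sphere_L2. holomorphic_several_on (poisson_extension f) (ball 0 1)}"

(* The orthogonal projection, which is determined up to a null set, as the choice of a
   representative. *)
definition hardy_projection ::
    "(complex ^ 'n::finite \<Rightarrow> complex) \<Rightarrow> complex ^ 'n \<Rightarrow> complex" where
  "hardy_projection f =
     (SOME g. g \<in> hardy_space \<and> (\<forall>h\<in>hardy_space. sphere_inner (\<lambda>x. f x - g x) h = 0))"

definition kernel_coeff :: "nat \<Rightarrow> real \<Rightarrow> nat \<Rightarrow> real" where
  "kernel_coeff n p l = sqrt (pochhammer (real n) l / pochhammer (real n + p) l)"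

definition coherent_kernel ::
    "real \<Rightarrow> real \<Rightarrow> complex ^ 'n::finite \<Rightarrow> complex ^ 'n \<Rightarrow> complex" where
  "coherent_kernel h p x z =
     (\<Sum>l. of_real (kernel_coeff CARD('n) p l / fact l) * (herm_inner x z / of_real h) ^ l)"

definition covariant_symbol ::
    "real \<Rightarrow> real \<Rightarrow> ((complex ^ 'n::finite \<Rightarrow> complex) \<Rightarrow> complex ^ 'n \<Rightarrow> complex)
     \<Rightarrow> complex ^ 'n \<Rightarrow> complex" where
  "covariant_symbol h p A z =
     sphere_inner (A (\<lambda>x. coherent_kernel h p x z)) (\<lambda>x. coherent_kernel h p x z)
     / sphere_inner (\<lambda>x. coherent_kernel h p x z) (\<lambda>x. coherent_kernel h p x z)"

definition toeplitz ::
    "(complex ^ 'n::finite \<Rightarrow> complex) \<Rightarrow> (complex ^ 'n \<Rightarrow> complex) \<Rightarrow> complex ^ 'n \<Rightarrow> complex"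
  where
  "toeplitz \<phi> \<psi> = hardy_projection (\<lambda>x. \<phi> x * \<psi> x)"

definition berezin_transform ::
    "real \<Rightarrow> real \<Rightarrow> (complex ^ 'n::finite \<Rightarrow> complex) \<Rightarrow> complex ^ 'n \<Rightarrow> complex" where
  "berezin_transform h p \<phi> = covariant_symbol h p (toeplitz \<phi>)"

(* Real differentiability of class C^k on an open set. *)
fun Ck_on :: "nat \<Rightarrow> 'a::real_normed_vector set \<Rightarrow> ('a \<Rightarrow> 'b::real_normed_vector) \<Rightarrow> bool" where
  "Ck_on 0 U f \<longleftrightarrow> continuous_on U f"
| "Ck_on (Suc k) U f \<longleftrightarrow>
     (\<forall>x\<in>U. f differentiable (at x)) \<and>
     (\<forall>v. Ck_on k U (\<lambda>x. frechet_derivative f (at x) v))"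

definition smooth_on :: "'a::real_normed_vector set \<Rightarrow> ('a \<Rightarrow> 'b::real_normed_vector) \<Rightarrow> bool"
  where "smooth_on U f \<longleftrightarrow> (\<forall>k. Ck_on k U f)"

definition smooth_on_sphere :: "(complex ^ 'n::finite \<Rightarrow> complex) \<Rightarrow> bool" where
  "smooth_on_sphere f \<longleftrightarrow>
     (\<forall>x\<in>sphere 0 1. \<exists>U F. open U \<and> x \<in> U \<and> smooth_on U F \<and> (\<forall>y\<in>U \<inter> sphere 0 1. F y = f y))"

definition wirtinger ::
    "'n::finite \<Rightarrow> (complex ^ 'n \<Rightarrow> complex) \<Rightarrow> complex ^ 'n \<Rightarrow> complex" where
  "wirtinger j f x =
     (frechet_derivative f (at x) (axis j 1) - \<i> * frechet_derivative f (at x) (axis j \<i>)) / 2"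

definition wirtinger_bar ::
    "'n::finite \<Rightarrow> (complex ^ 'n \<Rightarrow> complex) \<Rightarrow> complex ^ 'n \<Rightarrow> complex" where
  "wirtinger_bar j f x =
     (frechet_derivative f (at x) (axis j 1) + \<i> * frechet_derivative f (at x) (axis j \<i>)) / 2"

definition complex_laplace :: "(complex ^ 'n::finite \<Rightarrow> complex) \<Rightarrow> complex ^ 'n \<Rightarrow> complex" where
  "complex_laplace f x = (\<Sum>j\<in>UNIV. wirtinger j (wirtinger_bar j f) x)"

definition radial_deriv :: "(complex ^ 'n::finite \<Rightarrow> complex) \<Rightarrow> complex ^ 'n \<Rightarrow> complex" where
  "radial_deriv f x =
     (\<Sum>j\<in>UNIV. x $ j * wirtinger j f x + cnj (x $ j) * wirtinger_bar j f x)"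

end

theory Submission
  imports Defs
begin

text \<open>
  The coherent kernel lies in the Hardy space, so the projection in the Toeplitz operator can be
  dropped and the Berezin transform is the mean of \<open>\<phi>\<close> with respect to a probability density on the
  sphere that depends only on \<open>\<zeta> = x \<cdot> u\<close>, where \<open>u = z / |z|\<close> and \<open>\<rho> = |z| / h\<close>. This density is
  invariant under the reflection \<open>x \<mapsto> 2 Re \<zeta> u - x\<close>, which fixes \<open>u\<close>. Averaging a Taylor expansion
  along great circles over it removes the odd terms: up to \<open>O((1 - Re \<zeta>)\<^sup>2)\<close>, the averaged \<open>\<phi>\<close> is
  \<open>\<phi>(u)\<close> plus a quadratic form in the real-orthogonal part \<open>y = x - Re \<zeta> u\<close>, minus a
  multiple of \<open>|y|\<^sup>2\<close>. By symmetry the mean of the quadratic form is a combination of its trace and of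
  its values at \<open>u\<close> and \<open>\<i> u\<close>, so only the means of \<open>\<zeta>\<close>, \<open>\<zeta>\<^sup>2\<close> and \<open>|\<zeta>|\<^sup>2\<close> matter.

  By orthogonality of the powers of \<open>\<zeta>\<close> these are means over a random index \<open>l\<close> with weights
  proportional to \<open>\<rho>\<^bsup>2l\<^esup> / (l! (l+n-2)!)\<close>. Shifting \<open>l\<close> evaluates the mean of
  \<open>\<Prod>\<^sub>i \<rho>\<^sup>2 / ((l+i) (l+n-2+i))\<close> up to a negligible error. This gives the even moments of
  \<open>v = \<rho> / (l+n)\<close> up to \<open>O(1/\<rho>\<^sup>2)\<close>, and then the odd ones through \<open>v = sqrt (1 + (v\<^sup>2 - 1))\<close>.
\<close>

section \<open>Orthogonal projections in spaces of square integrable functions\<close>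

text \<open>Write B for the second derivative of the extension at u, T for its trace and D for the
  radial derivative. The bracket of the theorem is then \<open>T - B u u - (2n-1) D\<close>, the
  Laplace-Beltrami operator of the sphere, so its value does not depend on the extension. The
  density singles out i u among the tangent directions, yet the mean squares of all tangential
  coordinates agree to first order: each is 1/(2 \<rho>). The Taylor remainder is of order (1 - Re
  \<zeta>)^2, with mean 1 - 2 E(Re \<zeta>) + E((Re \<zeta>)^2), in which the constants and the
  1/\<rho> terms cancel. The same three moments thus control main term and remainder, and neither a
  concentration estimate for the density nor an asymptotic formula for Bessel functions enters. The
  value p = -1 makes the index weights rational: the squared coefficient times the mean of
  |\<zeta>|^(2l) cancels every square root. Roots come only from pairs of different indices and,
  with the shifted denominators, lead to odd moments of v. Shifting l acts on v^2, which is why the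
  odd moments need a detour through the even ones.\<close>

lemma norm_LINT_le:
  fixes f :: "'a \<Rightarrow> 'b::{banach,second_countable_topology}"
  assumes "integrable M f" "integrable M g" "\<And>x. x \<in> space M \<Longrightarrow> norm (f x) \<le> g x"
  shows "norm (integral\<^sup>L M f) \<le> integral\<^sup>L M g"
  by (rule order_trans[OF integral_norm_bound integral_mono]) (use assms in auto)

definition sq_integrable :: "'a measure \<Rightarrow> ('a \<Rightarrow> complex) \<Rightarrow> bool" where
  "sq_integrable M f \<longleftrightarrow> f \<in> borel_measurable M \<and> integrable M (\<lambda>x. (cmod (f x))\<^sup>2)"

lemma cmod_add_sq_le: "(cmod (a + b))\<^sup>2 \<le> 2 * (cmod a)\<^sup>2 + 2 * (cmod b)\<^sup>2"
proof -
  have "(cmod (a + b))\<^sup>2 \<le> (cmod a + cmod b)\<^sup>2" by (intro power_mono norm_triangle_ineq) auto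
  also have "\<dots> \<le> 2 * (cmod a)\<^sup>2 + 2 * (cmod b)\<^sup>2"
    using sum_squares_bound[of "cmod a" "cmod b"] by (simp add: power2_sum)
  finally show ?thesis .
qed

lemma sq_integrable_add:
  assumes "sq_integrable M f" "sq_integrable M g"
  shows "sq_integrable M (\<lambda>x. f x + g x)"
  unfolding sq_integrable_def
proof
  have [measurable]: "f \<in> borel_measurable M" "g \<in> borel_measurable M"
    using assms by (auto simp: sq_integrable_def)
  show "(\<lambda>x. f x + g x) \<in> borel_measurable M" by measurable
  show "integrable M (\<lambda>x. (cmod (f x + g x))\<^sup>2)"
    by (rule Bochner_Integration.integrable_bound[where f="\<lambda>x. 2 * (cmod (f x))\<^sup>2 + 2 * (cmod (g x))\<^sup>2"])
      (use assms cmod_add_sq_le in \<open>auto simp: sq_integrable_def\<close>)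
qed

lemma sq_integrable_cmult:
  assumes "sq_integrable M f"
  shows "sq_integrable M (\<lambda>x. c * f x)"
  using assms by (auto simp: sq_integrable_def norm_mult power_mult_distrib)

lemma sq_integrable_diff:
  assumes "sq_integrable M f" "sq_integrable M g"
  shows "sq_integrable M (\<lambda>x. f x - g x)"
  using sq_integrable_add[OF assms(1) sq_integrable_cmult[OF assms(2), of "-1"]] by simp

lemma integrable_mult_sq_integrable:
  assumes "sq_integrable M f" "sq_integrable M g"
  shows "integrable M (\<lambda>x. f x * g x)"
proof (rule Bochner_Integration.integrable_bound[where f="\<lambda>x. (cmod (f x))\<^sup>2 + (cmod (g x))\<^sup>2"])
  have "cmod (f x * g x) \<le> (cmod (f x))\<^sup>2 + (cmod (g x))\<^sup>2" for x
    using sum_squares_bound[of "cmod (f x)" "cmod (g x)"] mult_nonneg_nonneg[OF norm_ge_zero[of "f x"] norm_ge_zero[of "g x"]]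
    unfolding norm_mult mult.assoc by linarith
  then show "AE x in M. norm (f x * g x) \<le> norm ((cmod (f x))\<^sup>2 + (cmod (g x))\<^sup>2)" by auto
qed (use assms in \<open>auto simp: sq_integrable_def\<close>)

lemma sq_integrable_cnj: "sq_integrable M f \<Longrightarrow> sq_integrable M (\<lambda>x. cnj (f x))"
  by (auto simp: sq_integrable_def intro: measurable_compose[OF _ borel_measurable_continuous_onI[OF continuous_on_cnj[OF continuous_on_id]]])

context prob_space
begin

lemma sq_integrable_bounded:
  assumes "f \<in> borel_measurable M" "\<And>x. x \<in> space M \<Longrightarrow> cmod (f x) \<le> B"
  shows "sq_integrable M f"
  unfolding sq_integrable_def
proof
  show "integrable M (\<lambda>x. (cmod (f x))\<^sup>2)"
    by (rule integrable_const_bound[of _ "B\<^sup>2"]) (use assms in \<open>auto intro!: AE_I2 power_mono\<close>)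
qed fact

lemma sq_integrable_integrable:
  assumes "sq_integrable M f"
  shows "integrable M f"
  using integrable_mult_sq_integrable[OF assms sq_integrable_bounded[of "\<lambda>x. 1" 1]] by simp

text \<open>Splitting at |f| = \<delta> bounds the integrand by \<delta> below and by |f|^2 /
  \<delta> above. This replaces Cauchy-Schwarz; the best \<delta> is the L2 norm.\<close>

lemma L1_le_L2:
  assumes f: "sq_integrable M f" and \<delta>: "\<delta> > 0"
  shows "(\<integral>x. cmod (f x) \<partial>M) \<le> \<delta> + (\<integral>x. (cmod (f x))\<^sup>2 \<partial>M) / \<delta>"
proof -
  have "cmod (f x) \<le> \<delta> + (cmod (f x))\<^sup>2 / \<delta>" for x
  proof (cases "cmod (f x) \<le> \<delta>")
    case False
    then have "cmod (f x) * \<delta> \<le> cmod (f x) * cmod (f x)" by (intro mult_left_mono) auto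
    with \<delta> have "cmod (f x) \<le> (cmod (f x))\<^sup>2 / \<delta>" by (simp add: field_simps power2_eq_square)
    with \<delta> show ?thesis by simp
  qed (use \<delta> in \<open>simp add: add_increasing2\<close>)
  then have "(\<integral>x. cmod (f x) \<partial>M) \<le> (\<integral>x. \<delta> + (cmod (f x))\<^sup>2 / \<delta> \<partial>M)"
    using f sq_integrable_integrable[OF f] by (intro integral_mono) (auto simp: sq_integrable_def)
  also have "\<dots> = \<delta> + (\<integral>x. (cmod (f x))\<^sup>2 \<partial>M) / \<delta>"
    using f by (simp add: sq_integrable_def prob_space)
  finally show ?thesis .
qed

text \<open>The annihilator of a set of bounded functions is closed. A minimizing sequence is Cauchy by the
  parallelogram law and converges almost everywhere after a choice of rate.\<close>
lemma L2_annihilator_projection: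
  fixes Q :: "('a \<Rightarrow> complex) set"
  defines "H \<equiv> {g. sq_integrable M g \<and> (\<forall>q\<in>Q. (\<integral>x. q x * g x \<partial>M) = 0)}"
  assumes Q: "\<And>q. q \<in> Q \<Longrightarrow> q \<in> borel_measurable M"
    and Qb: "\<And>q. q \<in> Q \<Longrightarrow> \<exists>B. \<forall>x\<in>space M. cmod (q x) \<le> B"
    and f: "sq_integrable M f"
  shows "\<exists>g\<in>H. \<forall>h\<in>H. (\<integral>x. (f x - g x) * cnj (h x) \<partial>M) = 0"
proof -
  define S where "S g = (\<integral>x. (cmod (g x))\<^sup>2 \<partial>M)" for g
  have S0: "S g \<ge> 0" for g unfolding S_def by (intro integral_nonneg_AE) auto
  have HL: "g \<in> H \<Longrightarrow> sq_integrable M g" for g by (simp add: H_def)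
  have qL: "q \<in> Q \<Longrightarrow> sq_integrable M q" for q using Q Qb sq_integrable_bounded by metis
  have Hlin: "(\<lambda>x. a * g x + b * h x) \<in> H" if "g \<in> H" "h \<in> H" for a b g h
  proof -
    have "(\<integral>x. q x * (a * g x + b * h x) \<partial>M) = 0" if "q \<in> Q" for q
    proof -
      have i: "integrable M (\<lambda>x. q x * g x)" "integrable M (\<lambda>x. q x * h x)"
        using qL[OF that] HL \<open>g \<in> H\<close> \<open>h \<in> H\<close> by (auto intro: integrable_mult_sq_integrable)
      have "(\<integral>x. q x * (a * g x + b * h x) \<partial>M) = (\<integral>x. a * (q x * g x) + b * (q x * h x) \<partial>M)"
        by (simp add: algebra_simps)
      also have "\<dots> = a * (\<integral>x. q x * g x \<partial>M) + b * (\<integral>x. q x * h x \<partial>M)"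
        using i by simp
      also have "\<dots> = 0" using that \<open>g \<in> H\<close> \<open>h \<in> H\<close> by (simp add: H_def)
      finally show ?thesis .
    qed
    then show ?thesis using that by (auto simp: H_def intro!: sq_integrable_add sq_integrable_cmult)
  qed
  have zero: "(\<lambda>x. 0) \<in> H" by (simp add: H_def sq_integrable_def)
  define d where "d = (INF g\<in>H. S (\<lambda>x. f x - g x))"
  have bdd: "bdd_below ((\<lambda>g. S (\<lambda>x. f x - g x)) ` H)" by (rule bdd_belowI[of _ 0]) (auto simp: S0)
  have dle: "d \<le> S (\<lambda>x. f x - g x)" if "g \<in> H" for g
    unfolding d_def by (rule cINF_lower[OF bdd that])
  \<comment> \<open>The rate 4^(-k) for squared distances gives L2 distances, hence L1 distances, of
    order 2^(-k), which are summable.\<close>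
  have "\<exists>g\<in>H. S (\<lambda>x. f x - g x) < d + (1/4)^k" for k
  proof -
    have "(INF g\<in>H. S (\<lambda>x. f x - g x)) < d + (1/4)^k" by (simp add: d_def)
    then show ?thesis using bdd zero by (subst (asm) cINF_less_iff) auto
  qed
  then obtain g where gH: "g k \<in> H" and gS: "S (\<lambda>x. f x - g k x) < d + (1/4)^k" for k :: nat
    by metis
  have gL: "sq_integrable M (g k)" for k using gH HL by auto
  have [measurable]: "f \<in> borel_measurable M" "g k \<in> borel_measurable M" for k
    using f gL by (auto simp: sq_integrable_def)
  have cauchy: "S (\<lambda>x. g j x - g k x) \<le> 4 * (1/4)^k" if "k \<le> j" for j k
  proof -
    define m where "m = (\<lambda>x. (1/2) * g j x + (1/2) * g k x)"
    have m: "m \<in> H" unfolding m_def by (rule Hlin[OF gH gH])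
    \<comment> \<open>Parallelogram law for c - a and c - b. The midpoint of two members of H is
      again in H, so its distance to f is at least d.\<close>
    have par: "(cmod (a - b))\<^sup>2 = 2 * (cmod (c - b))\<^sup>2 + 2 * (cmod (c - a))\<^sup>2 - 4 * (cmod (c - ((1/2) * a + (1/2) * b)))\<^sup>2" for a b c
      unfolding cmod_power2 by (simp add: power2_eq_square field_simps)
    have L: "integrable M (\<lambda>x. (cmod (f x - g j x))\<^sup>2)" "integrable M (\<lambda>x. (cmod (f x - g k x))\<^sup>2)"
      "integrable M (\<lambda>x. (cmod (f x - m x))\<^sup>2)"
      using sq_integrable_diff[OF f gL] sq_integrable_diff[OF f HL[OF m]] by (auto simp: sq_integrable_def)
    have "S (\<lambda>x. g j x - g k x) = (\<integral>x. 2 * (cmod (f x - g k x))\<^sup>2 + 2 * (cmod (f x - g j x))\<^sup>2 - 4 * (cmod (f x - m x))\<^sup>2 \<partial>M)"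
      unfolding S_def m_def by (intro Bochner_Integration.integral_cong refl par)
    also have "\<dots> = 2 * S (\<lambda>x. f x - g k x) + 2 * S (\<lambda>x. f x - g j x) - 4 * S (\<lambda>x. f x - m x)"
      using L by (simp add: S_def)
    also have "\<dots> \<le> 2 * (1/4)^k + 2 * (1/4)^j"
      using gS[of k] gS[of j] dle[OF m] by linarith
    also have "(1/4::real)^j \<le> (1/4)^k" using that by (intro power_decreasing) auto
    finally show ?thesis by simp
  qed
  \<comment> \<open>\<open>L1_le_L2\<close> with \<delta> = 2^(-k), the size of the L2 norm.\<close>
  have L1: "(\<integral>x. cmod (u x) \<partial>M) \<le> 5 * (1/2)^k" if "sq_integrable M u" "S u \<le> 4 * (1/4)^k" for u k
  proof -
    have "(\<integral>x. cmod (u x) \<partial>M) \<le> (1/2)^k + S u / (1/2)^k"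
      using L1_le_L2[OF that(1), of "(1/2)^k"] by (simp add: S_def)
    also have "\<dots> \<le> (1/2)^k + (4 * (1/4)^k) / (1/2)^k" using that(2) by (intro add_left_mono divide_right_mono) auto
    also have "\<dots> = 5 * (1/2)^k" by (simp add: power_divide field_simps flip: power_mult_distrib)
    finally show ?thesis .
  qed
  \<comment> \<open>Where the sequence diverges, \<open>lim\<close> has an arbitrary value; this
    happens only on a null set, and G is measurable everywhere.\<close>
  define G where "G x = lim (\<lambda>k. g k x)" for x
  have [measurable]: "G \<in> borel_measurable M" unfolding G_def[abs_def] by measurable
  have conv: "AE x in M. (\<lambda>k. g k x) \<longlonglongrightarrow> G x"
  proof -
    have i: "integrable M (\<lambda>x. g (Suc k) x - g k x)" for k
      by (intro sq_integrable_integrable sq_integrable_diff gL)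
    have "(\<integral>\<^sup>+ x. (\<Sum>k. ennreal (cmod (g (Suc k) x - g k x))) \<partial>M) = (\<Sum>k. \<integral>\<^sup>+ x. cmod (g (Suc k) x - g k x) \<partial>M)"
      by (rule nn_integral_suminf) measurable
    also have "\<dots> = (\<Sum>k. ennreal (\<integral> x. cmod (g (Suc k) x - g k x) \<partial>M))"
      using i by (intro suminf_cong nn_integral_eq_integral) auto
    also have "\<dots> \<le> (\<Sum>k. ennreal (5 * (1/2)^k))"
      by (intro suminf_le ennreal_leI L1 sq_integrable_diff gL cauchy) auto
    also have "\<dots> < \<infinity>"
    proof -
      have "summable (\<lambda>k. 5 * (1/2::real)^k)" by (intro summable_mult summable_geometric) auto
      then show ?thesis by (subst suminf_ennreal2) auto
    qed
    finally have "AE x in M. (\<Sum>k. ennreal (cmod (g (Suc k) x - g k x))) \<noteq> \<infinity>"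
      by (intro nn_integral_PInf_AE) auto
    then show ?thesis
    proof eventually_elim
      case (elim x)
      then have "summable (\<lambda>k. cmod (g (Suc k) x - g k x))"
        by (intro summable_suminf_not_top) auto
      then have "summable (\<lambda>k. g (Suc k) x - g k x)" by (rule summable_norm_cancel)
      then have "convergent (\<lambda>k. g k x - g 0 x)"
        by (simp add: summable_iff_convergent sum_lessThan_telescope[of "\<lambda>k. g k x"])
      then have "convergent (\<lambda>k. g k x - g 0 x + g 0 x)" by (intro convergent_add convergent_const)
      then have "convergent (\<lambda>k. g k x)" by simp
      then show ?case by (simp add: G_def convergent_LIMSEQ_iff)
    qed
  qed
  \<comment> \<open>Fatou's lemma carries a bound on the distances from u to the g j over to the
    limit G. It serves for u = g k and for u = f.\<close>
  have fatou: "sq_integrable M (\<lambda>x. u x - G x) \<and> S (\<lambda>x. u x - G x) \<le> c"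
    if u: "sq_integrable M u" and c: "c \<ge> 0" "\<And>e. e > 0 \<Longrightarrow> \<forall>\<^sub>F j in sequentially. S (\<lambda>x. u x - g j x) \<le> c + e" for u c
  proof -
    have [measurable]: "u \<in> borel_measurable M" using u by (simp add: sq_integrable_def)
    have "(\<integral>\<^sup>+ x. ennreal ((cmod (u x - G x))\<^sup>2) \<partial>M)
        = (\<integral>\<^sup>+ x. liminf (\<lambda>j. ennreal ((cmod (u x - g j x))\<^sup>2)) \<partial>M)"
    proof (rule nn_integral_cong_AE, use conv in eventually_elim)
      case (elim x)
      then have l: "(\<lambda>j. ennreal ((cmod (u x - g j x))\<^sup>2)) \<longlonglongrightarrow> ennreal ((cmod (u x - G x))\<^sup>2)"
        by (intro tendsto_ennrealI tendsto_intros)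
      show ?case using lim_imp_Liminf[OF sequentially_bot l] by simp
    qed
    also have "\<dots> \<le> liminf (\<lambda>j. \<integral>\<^sup>+ x. ennreal ((cmod (u x - g j x))\<^sup>2) \<partial>M)"
      by (rule nn_integral_liminf) measurable
    also have "\<dots> = liminf (\<lambda>j. ennreal (S (\<lambda>x. u x - g j x)))"
      unfolding S_def using sq_integrable_diff[OF u gL]
      by (subst nn_integral_eq_integral) (auto simp: sq_integrable_def)
    also have "\<dots> \<le> ennreal c"
    proof (rule ennreal_le_epsilon)
      fix e :: real assume "e > 0"
      from c(2)[OF this] have "\<forall>\<^sub>F j in sequentially. ennreal (S (\<lambda>x. u x - g j x)) \<le> ennreal (c + e)"
        by eventually_elim (auto intro: ennreal_leI)
      then have "liminf (\<lambda>j. ennreal (S (\<lambda>x. u x - g j x))) \<le> liminf (\<lambda>j. ennreal (c + e))"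
        by (rule Liminf_mono)
      also have "\<dots> = ennreal (c + e)" by (simp add: Liminf_const)
      finally show "liminf (\<lambda>j. ennreal (S (\<lambda>x. u x - g j x))) \<le> ennreal c + ennreal e"
        using c(1) \<open>e > 0\<close> by simp
    qed
    finally have le: "(\<integral>\<^sup>+ x. ennreal ((cmod (u x - G x))\<^sup>2) \<partial>M) \<le> ennreal c" .
    then have int: "integrable M (\<lambda>x. (cmod (u x - G x))\<^sup>2)"
      by (intro integrableI_bounded) (auto intro: le_less_trans)
    moreover have "S (\<lambda>x. u x - G x) \<le> c"
      using le c(1) int unfolding S_def by (subst (asm) nn_integral_eq_integral) auto
    ultimately show ?thesis by (auto simp: sq_integrable_def)
  qed
  have gG: "sq_integrable M (\<lambda>x. g k x - G x) \<and> S (\<lambda>x. g k x - G x) \<le> 4 * (1/4)^k" for k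
  proof (rule fatou[OF gL])
    fix e :: real assume "e > 0"
    show "\<forall>\<^sub>F j in sequentially. S (\<lambda>x. g k x - g j x) \<le> 4 * (1/4)^k + e"
      using eventually_ge_at_top[of k]
    proof eventually_elim
      case (elim j)
      then show ?case using cauchy[OF elim] \<open>e > 0\<close> by (simp add: S_def norm_minus_commute)
    qed
  qed auto
  have fG: "sq_integrable M (\<lambda>x. f x - G x)" and SfG: "S (\<lambda>x. f x - G x) \<le> d"
  proof -
    have "d \<ge> 0" unfolding d_def using zero S0 by (intro cINF_greatest) auto
    have "sq_integrable M (\<lambda>x. f x - G x) \<and> S (\<lambda>x. f x - G x) \<le> d"
    proof (rule fatou[OF f \<open>d \<ge> 0\<close>])
      fix e :: real assume "e > 0"
      have "(\<lambda>k. (1/4::real)^k) \<longlonglongrightarrow> 0" by (intro LIMSEQ_power_zero) auto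
      then have "\<forall>\<^sub>F j in sequentially. (1/4::real)^j < e" using \<open>e > 0\<close> by (rule order_tendstoD)
      then show "\<forall>\<^sub>F j in sequentially. S (\<lambda>x. f x - g j x) \<le> d + e"
        by eventually_elim (use gS in \<open>smt (verit)\<close>)
    qed
    then show "sq_integrable M (\<lambda>x. f x - G x)" "S (\<lambda>x. f x - G x) \<le> d" by auto
  qed
  have GL: "sq_integrable M G" using sq_integrable_diff[OF gL[of 0] conjunct1[OF gG[of 0]]] by simp
  have "G \<in> H"
    unfolding H_def
  proof (intro CollectI conjI ballI GL)
    fix q assume q: "q \<in> Q"
    obtain B where B: "\<And>x. x \<in> space M \<Longrightarrow> cmod (q x) \<le> B" using Qb[OF q] by auto
    have B0: "B \<ge> 0" using B norm_ge_zero subprob_not_empty by (metis all_not_in_conv order_trans)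
    have "cmod (\<integral>x. q x * G x \<partial>M) \<le> B * (5 * (1/2)^k)" for k
    proof -
      have iL: "sq_integrable M (\<lambda>x. g k x - G x)" using gG by auto
      have i: "integrable M (\<lambda>x. q x * (g k x - G x))"
        by (rule integrable_mult_sq_integrable[OF qL[OF q] iL])
      have "(\<integral>x. q x * G x \<partial>M) = (\<integral>x. q x * g k x - q x * (g k x - G x) \<partial>M)"
        by (simp add: algebra_simps)
      also have "\<dots> = (\<integral>x. q x * g k x \<partial>M) - (\<integral>x. q x * (g k x - G x) \<partial>M)"
        by (intro Bochner_Integration.integral_diff i integrable_mult_sq_integrable[OF qL[OF q] gL])
      also have "(\<integral>x. q x * g k x \<partial>M) = 0" using gH[of k] q by (simp add: H_def)
      finally have "cmod (\<integral>x. q x * G x \<partial>M) = cmod (\<integral>x. q x * (g k x - G x) \<partial>M)" by simp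
      also have "\<dots> \<le> (\<integral>x. B * cmod (g k x - G x) \<partial>M)"
        by (rule norm_LINT_le[OF i])
          (use B sq_integrable_integrable[OF iL] in \<open>auto simp: norm_mult intro!: mult_right_mono\<close>)
      also have "\<dots> \<le> B * (5 * (1/2)^k)"
        using L1[OF iL, of k] gG[of k] B0 by (simp add: mult_left_mono)
      finally show ?thesis .
    qed
    moreover have "(\<lambda>k. B * (5 * (1/2::real)^k)) \<longlonglongrightarrow> B * (5 * 0)"
      by (intro tendsto_intros LIMSEQ_power_zero) auto
    ultimately have "cmod (\<integral>x. q x * G x \<partial>M) \<le> B * (5 * 0)"
      by (intro LIMSEQ_le_const[of "\<lambda>k. B * (5 * (1/2::real)^k)"]) auto
    then show "(\<integral>x. q x * G x \<partial>M) = 0" by simp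
  qed
  moreover have "(\<integral>x. (f x - G x) * cnj (h x) \<partial>M) = 0" if h: "h \<in> H" for h
  proof (rule ccontr)
    define e where "e x = f x - G x" for x
    define I where "I = (\<integral>x. e x * cnj (h x) \<partial>M)"
    assume "(\<integral>x. (f x - G x) * cnj (h x) \<partial>M) \<noteq> 0"
    then have I: "I \<noteq> 0" by (simp add: I_def e_def)
    \<comment> \<open>Moving G by t I h changes the squared distance by -|I|^2 t (2 - t S h). This t
      keeps t S h at most 1, so the change would be negative, against the minimality of d.\<close>
    define t where "t = 1 / (S h + 1)"
    have t: "t > 0" using S0[of h] by (simp add: t_def)
    have eL: "sq_integrable M e" using fG by (simp add: e_def[abs_def])
    have ieh: "integrable M (\<lambda>x. e x * cnj (h x))"
      by (intro integrable_mult_sq_integrable eL sq_integrable_cnj HL h)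
    define R where "R x = Re (cnj I * (e x * cnj (h x)))" for x
    have ii: "integrable M (\<lambda>x. cnj I * (e x * cnj (h x)))" using ieh by simp
    have iR: "integrable M R" unfolding R_def by (rule integrable_Re[OF ii])
    have R: "integral\<^sup>L M R = Re (cnj I * I)"
      unfolding R_def by (subst integral_Re[OF ii]) (simp add: I_def)
    have "d \<le> S (\<lambda>x. f x - (1 * G x + (t * I) * h x))"
      by (intro dle Hlin[OF \<open>G \<in> H\<close> h])
    also have "\<dots> = (\<integral>x. (cmod (e x))\<^sup>2 - 2 * t * R x + t\<^sup>2 * (cmod I)\<^sup>2 * (cmod (h x))\<^sup>2 \<partial>M)"
    proof -
      have "(cmod (a - of_real t * c * b))\<^sup>2 = (cmod a)\<^sup>2 - 2 * t * Re (cnj c * (a * cnj b)) + t\<^sup>2 * (cmod c)\<^sup>2 * (cmod b)\<^sup>2" for a b c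
        unfolding cmod_power2 by (simp add: power2_eq_square algebra_simps)
      note p = this
      have q: "f x - (1 * G x + (t * I) * h x) = e x - of_real t * I * h x" for x by (simp add: e_def)
      show ?thesis unfolding S_def by (intro Bochner_Integration.integral_cong refl) (simp only: p q R_def)
    qed
    also have "\<dots> = S e - 2 * t * Re (cnj I * I) + t\<^sup>2 * (cmod I)\<^sup>2 * S h"
      unfolding R[symmetric] using iR eL HL[OF h] by (simp add: S_def sq_integrable_def)
    also have "Re (cnj I * I) = (cmod I)\<^sup>2" by (simp add: cmod_power2 flip: power2_eq_square)
    also have "S e - 2 * t * (cmod I)\<^sup>2 + t\<^sup>2 * (cmod I)\<^sup>2 * S h = S e - (cmod I)\<^sup>2 * t * (2 - t * S h)"
      by (simp add: power2_eq_square algebra_simps)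
    finally have "(cmod I)\<^sup>2 * t * (2 - t * S h) \<le> 0" using SfG by (simp add: e_def[abs_def])
    moreover have "t * S h \<le> 1" using S0[of h] by (simp add: t_def)
    ultimately show False using I t by (auto simp: mult_le_0_iff)
  qed
  ultimately show ?thesis by blast
qed

end

section \<open>Rotation invariance of the surface measure\<close>

lemma lborel_distr_minus:
  fixes y :: "'a::euclidean_space"
  shows "distr lborel borel (\<lambda>x. y - x) = lborel"
  using lborel_affine[of "-1" y, symmetric] by (simp add: density_1)

lemma emeasure_unit_ball:
  shows emeasure_unit_ball_pos: "emeasure lborel (ball (0::'a::euclidean_space) 1) \<noteq> 0"
    and emeasure_unit_ball_finite: "emeasure lborel (ball (0::'a::euclidean_space) 1) \<noteq> \<infinity>"
  using content_ball_pos[of 1 "0::'a"] emeasure_lborel_ball_finite[of "0::'a" 1]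
  by (auto simp: measure_def)

text \<open>The measure of pairs \<open>(x, y)\<close> with \<open>W x \<in> A\<close> and \<open>y - W x\<close> in the unit ball is computed in both
  orders of integration; the unit ball is \<open>W\<close>-invariant.\<close>
lemma distr_lborel_orthogonal:
  fixes W :: "'a::euclidean_space \<Rightarrow> 'a"
  assumes W: "orthogonal_transformation W"
  shows "distr lborel borel W = lborel"
proof (rule measure_eqI)
  have linW: "linear W" using W by (simp add: orthogonal_transformation_def)
  have mW[measurable]: "W \<in> borel_measurable borel"
    using linW by (intro borel_measurable_continuous_onI linear_continuous_on linear_conv_bounded_linear[THEN iffD1])
  fix A assume "A \<in> sets (distr lborel borel W)"
  then have A[measurable]: "A \<in> sets borel" by simp
  define B where "B = (ball 0 1 :: 'a set)"
  have B[measurable]: "B \<in> sets borel" by (simp add: B_def)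
  have refl: "(\<integral>\<^sup>+ x. f (y - x) \<partial>lborel) = (\<integral>\<^sup>+ x. f x \<partial>lborel)"
    if [measurable]: "f \<in> borel_measurable borel" for f :: "'a \<Rightarrow> ennreal" and y
  proof -
    have "(\<integral>\<^sup>+ x. f x \<partial>lborel) = (\<integral>\<^sup>+ x. f x \<partial>distr lborel borel (\<lambda>x. y - x))"
      by (simp add: lborel_distr_minus)
    also have "\<dots> = (\<integral>\<^sup>+ x. f (y - x) \<partial>lborel)" by (subst nn_integral_distr) auto
    finally show ?thesis ..
  qed
  have shift: "(\<integral>\<^sup>+ x. f (x - y) \<partial>lborel) = (\<integral>\<^sup>+ x. f x \<partial>lborel)"
    if [measurable]: "f \<in> borel_measurable borel" for f :: "'a \<Rightarrow> ennreal" and y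
    using refl[of "\<lambda>x. f (- x)" y] refl[of f 0] by simp
  define F where "F x y = (indicator A (W x) * indicator B (y - W x) :: ennreal)" for x y
  have [measurable]: "(\<lambda>(x, y). F x y) \<in> borel_measurable (lborel \<Otimes>\<^sub>M lborel)"
    unfolding F_def by measurable
  have 1: "(\<integral>\<^sup>+ x. \<integral>\<^sup>+ y. F x y \<partial>lborel \<partial>lborel) = emeasure lborel (W -` A) * emeasure lborel B"
  proof -
    have "(\<integral>\<^sup>+ y. F x y \<partial>lborel) = indicator (W -` A) x * emeasure lborel B" for x
      unfolding F_def
      using shift[of "indicator B" "W x"] by (cases "W x \<in> A") (simp_all add: nn_integral_cmult)
    moreover have "W -` A \<in> sets borel" using measurable_sets_borel[OF mW A] .
    ultimately show ?thesis by (simp add: nn_integral_multc)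
  qed
  have 2: "(\<integral>\<^sup>+ y. \<integral>\<^sup>+ x. F x y \<partial>lborel \<partial>lborel) = emeasure lborel A * emeasure lborel (W -` B)"
  proof -
    have "(\<integral>\<^sup>+ x. F x y \<partial>lborel) = (\<integral>\<^sup>+ t. indicator A (y - W t) * indicator B (W t) \<partial>lborel)" for y
    proof -
      \<comment> \<open>With y = W y', the substitution x = y' - t exchanges W x with y - W x.
        Afterwards y occurs only in the factor of A, and integrating over y first yields the measure
        of A itself.\<close>
      obtain y' where y': "y = W y'" using orthogonal_transformation_surj[OF W] by (metis surj_def)
      have "(\<integral>\<^sup>+ x. F x y \<partial>lborel) = (\<integral>\<^sup>+ t. F (y' - t) y \<partial>lborel)"
        unfolding F_def by (rule refl[symmetric]) measurable
      also have "\<dots> = (\<integral>\<^sup>+ t. indicator A (y - W t) * indicator B (W t) \<partial>lborel)"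
        by (simp add: F_def y' linear_diff[OF linW])
      finally show ?thesis .
    qed
    then have "(\<integral>\<^sup>+ y. \<integral>\<^sup>+ x. F x y \<partial>lborel \<partial>lborel)
        = (\<integral>\<^sup>+ y. \<integral>\<^sup>+ t. indicator A (y - W t) * indicator B (W t) \<partial>lborel \<partial>lborel)" by simp
    also have "\<dots> = (\<integral>\<^sup>+ t. \<integral>\<^sup>+ y. indicator A (y - W t) * indicator B (W t) \<partial>lborel \<partial>lborel)"
      by (rule lborel_pair.Fubini') measurable
    also have "\<dots> = (\<integral>\<^sup>+ t. emeasure lborel A * indicator (W -` B) t \<partial>lborel)"
    proof (rule nn_integral_cong)
      fix t
      show "(\<integral>\<^sup>+ y. indicator A (y - W t) * indicator B (W t) \<partial>lborel) = emeasure lborel A * indicator (W -` B) t"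
        using shift[of "indicator A" "W t"] by (cases "W t \<in> B") (simp_all add: nn_integral_multc)
    qed
    also have "\<dots> = emeasure lborel A * emeasure lborel (W -` B)"
      using measurable_sets_borel[OF mW B] by (simp add: nn_integral_cmult)
    finally show ?thesis .
  qed
  have "W -` B = B"
    using orthogonal_transformation_norm[OF W] by (auto simp: B_def)
  moreover have "(\<integral>\<^sup>+ x. \<integral>\<^sup>+ y. F x y \<partial>lborel \<partial>lborel) = (\<integral>\<^sup>+ y. \<integral>\<^sup>+ x. F x y \<partial>lborel \<partial>lborel)"
    by (rule lborel_pair.Fubini'[symmetric]) measurable
  ultimately have "emeasure lborel (W -` A) * emeasure lborel B = emeasure lborel A * emeasure lborel B"
    using 1 2 by simp
  moreover have "emeasure lborel B \<noteq> 0" "emeasure lborel B \<noteq> \<infinity>"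
    unfolding B_def by (rule emeasure_unit_ball)+
  ultimately have "emeasure lborel (W -` A) = emeasure lborel A"
    by (metis infinity_ennreal_def mult_divide_eq_ennreal)
  then show "emeasure (distr lborel borel W) A = emeasure lborel A"
    by (simp add: emeasure_distr)
qed simp

section \<open>Total mass and invariance of the normalized surface measure\<close>

lemma space_sphere_measure [simp]: "space sphere_measure = sphere 0 1"
  by (simp add: sphere_measure_def space_restrict_space)

lemma sets_sphere_measure: "sets sphere_measure = sets (restrict_space borel (sphere 0 1))"
  by (simp add: sphere_measure_def sets_restrict_space)

lemma borel_measurable_sphere_measureI:
  fixes f :: "complex^'n::finite \<Rightarrow> 'b::topological_space"
  assumes "continuous_on (sphere 0 1) f"
  shows "f \<in> borel_measurable sphere_measure"
  using borel_measurable_continuous_on_restrict[OF assms]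
  by (simp cong: measurable_cong_sets add: sets_sphere_measure)

lemma emeasure_sphere_measure:
  fixes A :: "(complex^'n::finite) set"
  assumes A: "A \<in> sets sphere_measure"
  shows "emeasure sphere_measure A =
    emeasure lborel (ball 0 1 \<inter> (\<lambda>x. x /\<^sub>R norm x) -` A) / emeasure lborel (ball (0::complex^'n) 1)"
proof -
  have Ab: "A \<in> sets borel" "A \<subseteq> sphere 0 1"
    using A by (auto simp: sets_sphere_measure sets_restrict_space)
  have m: "(\<lambda>x::complex^'n. x /\<^sub>R norm x) \<in> borel_measurable borel" by measurable
  have "emeasure sphere_measure A =
    emeasure (uniform_measure lborel (ball 0 1)) ((\<lambda>x::complex^'n. x /\<^sub>R norm x) -` A)"
    unfolding sphere_measure_def using Ab m
    by (subst emeasure_restrict_space) (auto simp: emeasure_distr)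
  also have "\<dots> = emeasure lborel (ball 0 1 \<inter> (\<lambda>x. x /\<^sub>R norm x) -` A) / emeasure lborel (ball (0::complex^'n) 1)"
    using Ab measurable_sets_borel[OF m] by (subst emeasure_uniform_measure) auto
  finally show ?thesis .
qed

interpretation sphere: prob_space "sphere_measure :: (complex^'n::finite) measure"
proof
  let ?b = "ball (0::complex^'n) 1"
  note fin = emeasure_unit_ball[where 'a="complex^'n"]
  have "?b \<inter> (\<lambda>x. x /\<^sub>R norm x) -` sphere 0 1 = ?b - {0}" by auto
  moreover have "emeasure lborel (?b - {0}) = emeasure lborel ?b"
    by (subst emeasure_Diff_null_set) auto
  ultimately show "emeasure (sphere_measure :: (complex^'n) measure) (space sphere_measure) = 1"
    using emeasure_sphere_measure[of "sphere (0::complex^'n) 1"] fin sets.top[of "sphere_measure :: (complex^'n) measure"]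
    by (simp add: ennreal_divide_self less_top)
qed

text \<open>W is linear and preserves norms, so it commutes with the radial projection and maps the
  unit ball to itself; invariance of Lebesgue measure does the rest.\<close>

lemma distr_sphere_measure_orthogonal:
  fixes W :: "complex^'n::finite \<Rightarrow> complex^'n"
  assumes W: "orthogonal_transformation W"
  shows W_measurable_sphere: "W \<in> measurable sphere_measure sphere_measure"
    and "distr sphere_measure sphere_measure W = sphere_measure"
proof -
  have linW: "linear W" using W by (simp add: orthogonal_transformation_def)
  have cW: "continuous_on S W" for S
    using linW by (intro linear_continuous_on linear_conv_bounded_linear[THEN iffD1])
  then have mW[measurable]: "W \<in> borel_measurable borel"
    by (intro borel_measurable_continuous_onI)
  show m: "W \<in> measurable sphere_measure sphere_measure"
    using borel_measurable_sphere_measureI[OF cW] orthogonal_transformation_norm[OF W]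
    by (subst measurable_cong_sets[OF refl sets_sphere_measure], intro measurable_restrict_space2) auto
  show "distr sphere_measure sphere_measure W = sphere_measure"
  proof (rule measure_eqI)
    fix A assume "A \<in> sets (distr sphere_measure sphere_measure W)"
    then have A: "A \<in> sets sphere_measure" by simp
    have A2: "W -` A \<inter> sphere 0 1 \<in> sets sphere_measure"
      using measurable_sets[OF m A] by simp
    have Ab: "A \<in> sets borel" "A \<subseteq> sphere 0 1"
      using A by (auto simp: sets_sphere_measure sets_restrict_space)
    let ?s = "\<lambda>x::complex^'n. x /\<^sub>R norm x"
    have ms: "?s \<in> borel_measurable borel" by measurable
    have "ball 0 1 \<inter> ?s -` (W -` A \<inter> sphere 0 1) = W -` (ball 0 1 \<inter> ?s -` A)"
      using Ab(2) orthogonal_transformation_norm[OF W] linear_scale[OF linW]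
      by (auto simp: linear_0[OF linW])
    moreover have "emeasure lborel (W -` (ball 0 1 \<inter> ?s -` A)) = emeasure lborel (ball 0 1 \<inter> ?s -` A)"
      using Ab(1) measurable_sets_borel[OF ms Ab(1)]
      by (subst (2) distr_lborel_orthogonal[OF W, symmetric]) (simp add: emeasure_distr)
    ultimately have "emeasure sphere_measure (W -` A \<inter> sphere 0 1) = emeasure sphere_measure A"
      using emeasure_sphere_measure[OF A2] emeasure_sphere_measure[OF A] by simp
    then show "emeasure (distr sphere_measure sphere_measure W) A = emeasure sphere_measure A"
      using A m by (simp add: emeasure_distr)
  qed simp
qed

lemma integral_sphere_orthogonal:
  fixes W :: "complex^'n::finite \<Rightarrow> complex^'n" and f :: "complex^'n \<Rightarrow> 'b::{banach,second_countable_topology}"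
  assumes W: "orthogonal_transformation W" and f: "f \<in> borel_measurable sphere_measure"
  shows "(LINT x|sphere_measure. f (W x)) = (LINT x|sphere_measure. f x)"
  using integral_distr[OF W_measurable_sphere[OF W] f] distr_sphere_measure_orthogonal(2)[OF W] by simp

lemma integrable_sphere_continuous:
  fixes f :: "complex^'n::finite \<Rightarrow> 'b::{banach,second_countable_topology}"
  assumes f: "continuous_on (sphere 0 1) f"
  shows "integrable sphere_measure f"
proof -
  have "compact (f ` sphere 0 1)" using f by (intro compact_continuous_image) auto
  then obtain B where B: "\<And>x. x \<in> sphere 0 1 \<Longrightarrow> norm (f x) \<le> B"
    using compact_imp_bounded bounded_iff by (metis imageI)
  show ?thesis
    by (rule sphere.integrable_const_bound[of _ B]) (auto intro!: AE_I2 B borel_measurable_sphere_measureI f simp del: mem_sphere)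
qed

section \<open>The Hardy space as an annihilator\<close>

definition poisson_kernel :: "complex^'n::finite \<Rightarrow> complex^'n \<Rightarrow> real" where
  "poisson_kernel w x = (1 - w \<bullet> w) / ((w - x) \<bullet> (w - x)) ^ CARD('n)"

definition poisson_kernel_deriv :: "complex^'n::finite \<Rightarrow> complex^'n \<Rightarrow> complex^'n \<Rightarrow> real" where
  "poisson_kernel_deriv w x v =
     - (2 * (w \<bullet> v)) / ((w - x) \<bullet> (w - x)) ^ CARD('n)
     - (1 - w \<bullet> w) * (real CARD('n) * (2 * ((w - x) \<bullet> v))) / ((w - x) \<bullet> (w - x)) ^ Suc CARD('n)"

lemma poisson_extension_eq:
  "poisson_extension f w = (LINT x|sphere_measure. of_real (poisson_kernel w x) * f x)"
  unfolding poisson_extension_def poisson_kernel_def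
  by (simp add: power_mult power2_norm_eq_inner)

lemma inner_diff_sphere_ge:
  fixes w x :: "'a::real_inner"
  assumes "norm w \<le> r" "r < 1" "norm x = 1"
  shows "(1 - r)\<^sup>2 \<le> (w - x) \<bullet> (w - x)"
proof -
  have "1 - r \<le> norm (w - x)" using norm_triangle_ineq2[of x w] assms by (simp add: norm_minus_commute)
  then have "(1 - r)\<^sup>2 \<le> (norm (w - x))\<^sup>2" using assms by (intro power_mono) auto
  then show ?thesis by (simp add: power2_norm_eq_inner)
qed

lemma has_derivative_poisson_kernel:
  fixes w x :: "complex^'n::finite"
  assumes "norm w < 1" "norm x = 1"
  shows "((\<lambda>w. poisson_kernel w x) has_derivative poisson_kernel_deriv w x) (at w within S)"
proof -
  define D where "D = (w - x) \<bullet> (w - x)"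
  have D: "D > 0" unfolding D_def using assms by (metis inner_gt_zero_iff eq_iff_diff_eq_0 less_irrefl)
  \<comment> \<open>The power rule produces the exponent n - 1; a successor form lets it be
    evaluated.\<close>
  obtain m where m: "CARD('n) = Suc m" using zero_less_card_finite[where 'a='n] gr0_implies_Suc by blast
  have N: "((\<lambda>w. 1 - w \<bullet> w) has_derivative (\<lambda>v. - (2 * (w \<bullet> v)))) (at w within S)"
    by (rule derivative_eq_intros refl)+ (simp add: inner_commute)
  have E: "((\<lambda>w. (w - x) \<bullet> (w - x)) has_derivative (\<lambda>v. 2 * ((w - x) \<bullet> v))) (at w within S)"
    by (rule derivative_eq_intros refl)+ (simp add: inner_commute)
  have "((\<lambda>w. (1 - w \<bullet> w) / ((w - x) \<bullet> (w - x)) ^ CARD('n)) has_derivative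
     (\<lambda>v. - (2 * (w \<bullet> v)) / D ^ CARD('n)
     - (1 - w \<bullet> w) * (real CARD('n) * (2 * ((w - x) \<bullet> v))) / D ^ Suc CARD('n))) (at w within S)"
    using D
    by (intro has_derivative_eq_rhs[OF has_derivative_divide'[OF N has_derivative_power[OF E]]])
      (simp_all add: D_def[symmetric] m fun_eq_iff divide_simps, simp_all add: algebra_simps)
  then show ?thesis
    by (simp add: poisson_kernel_def[abs_def] poisson_kernel_deriv_def[abs_def] D_def)
qed

lemma poisson_kernel_deriv_bound:
  fixes w x v :: "complex^'n::finite"
  assumes "norm w \<le> r" "r < 1" "norm x = 1"
  shows "\<bar>poisson_kernel_deriv w x v\<bar>
    \<le> (2 / ((1 - r)\<^sup>2) ^ CARD('n) + 4 * real CARD('n) / ((1 - r)\<^sup>2) ^ Suc CARD('n)) * norm v"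
proof -
  define D where "D = (w - x) \<bullet> (w - x)"
  define E where "E = (1 - r)\<^sup>2"
  have E: "0 < E" "E \<le> D" using assms inner_diff_sphere_ge[OF assms] by (auto simp: E_def D_def)
  have w1: "norm w \<le> 1" using assms by simp
  have "\<bar>w \<bullet> v\<bar> \<le> norm w * norm v" by (rule Cauchy_Schwarz_ineq2)
  also have "\<dots> \<le> 1 * norm v" using w1 by (intro mult_right_mono) auto
  finally have 1: "\<bar>2 * (w \<bullet> v)\<bar> \<le> 2 * norm v" by simp
  have "\<bar>(w - x) \<bullet> v\<bar> \<le> norm (w - x) * norm v" by (rule Cauchy_Schwarz_ineq2)
  also have "\<dots> \<le> 2 * norm v" using norm_triangle_ineq4[of w x] w1 assms(3) by (intro mult_right_mono) auto
  finally have 2: "\<bar>(w - x) \<bullet> v\<bar> \<le> 2 * norm v" .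
  have "w \<bullet> w \<le> 1" "0 \<le> w \<bullet> w" using w1 by (auto simp: power2_norm_eq_inner[symmetric] power_le_one)
  then have "\<bar>1 - w \<bullet> w\<bar> \<le> 1" by auto
  then have "\<bar>1 - w \<bullet> w\<bar> * (real CARD('n) * (2 * \<bar>(w - x) \<bullet> v\<bar>)) \<le> 1 * (real CARD('n) * (2 * (2 * norm v)))"
    using 2 by (intro mult_mono) auto
  then have 3: "\<bar>(1 - w \<bullet> w) * (real CARD('n) * (2 * ((w - x) \<bullet> v)))\<bar> \<le> 4 * real CARD('n) * norm v"
    by (simp add: abs_mult)
  have "\<bar>poisson_kernel_deriv w x v\<bar>
     \<le> \<bar>2 * (w \<bullet> v)\<bar> / D ^ CARD('n) + \<bar>(1 - w \<bullet> w) * (real CARD('n) * (2 * ((w - x) \<bullet> v)))\<bar> / D ^ Suc CARD('n)"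
    unfolding poisson_kernel_deriv_def D_def[symmetric] using E
    by (intro order.trans[OF abs_triangle_ineq4]) (simp add: abs_divide)
  also have "\<dots> \<le> (2 * norm v) / E ^ CARD('n) + (4 * real CARD('n) * norm v) / E ^ Suc CARD('n)"
    using E 1 3 by (intro add_mono frac_le power_mono) auto
  finally show ?thesis unfolding E_def by (simp add: field_simps)
qed

text \<open>The constant depends on r but not on x. This uniformity makes the difference quotients
  dominated when the Poisson integral is differentiated.\<close>

lemma poisson_kernel_lipschitz:
  fixes w x :: "complex^'n::finite"
  assumes "norm w \<le> r" "norm w' \<le> r" "r < 1" "norm x = 1"
  shows "\<bar>poisson_kernel w' x - poisson_kernel w x\<bar>
    \<le> (2 / ((1 - r)\<^sup>2) ^ CARD('n) + 4 * real CARD('n) / ((1 - r)\<^sup>2) ^ Suc CARD('n)) * norm (w' - w)"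
proof -
  have "norm (poisson_kernel w' x - poisson_kernel w x)
    \<le> (2 / ((1 - r)\<^sup>2) ^ CARD('n) + 4 * real CARD('n) / ((1 - r)\<^sup>2) ^ Suc CARD('n)) * norm (w' - w)"
  proof (rule differentiable_bound[OF convex_cball[of 0 r]])
    fix y :: "complex^'n" assume "y \<in> cball 0 r"
    then have y: "norm y \<le> r" by simp
    show "((\<lambda>w. poisson_kernel w x) has_derivative poisson_kernel_deriv y x) (at y within cball 0 r)"
      using y assms by (intro has_derivative_poisson_kernel) auto
    show "onorm (poisson_kernel_deriv y x) \<le> 2 / ((1 - r)\<^sup>2) ^ CARD('n) + 4 * real CARD('n) / ((1 - r)\<^sup>2) ^ Suc CARD('n)"
      using poisson_kernel_deriv_bound[OF y assms(3,4)] by (intro onorm_le) simp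
  qed (use assms in auto)
  then show ?thesis by simp
qed

lemma continuous_on_poisson_kernel:
  fixes w :: "complex^'n::finite"
  assumes "norm w < 1"
  shows "continuous_on (sphere 0 1) (poisson_kernel w)"
    and "continuous_on (sphere 0 1) (\<lambda>x. poisson_kernel_deriv w x v)"
proof -
  have "(w - x) \<bullet> (w - x) \<noteq> 0" if "x \<in> sphere 0 1" for x
    using that assms by auto
  then show "continuous_on (sphere 0 1) (poisson_kernel w)"
    and "continuous_on (sphere 0 1) (\<lambda>x. poisson_kernel_deriv w x v)"
    unfolding poisson_kernel_def[abs_def] poisson_kernel_deriv_def[abs_def]
    by (auto intro!: continuous_intros simp del: inner_eq_zero_iff)
qed

lemma integrable_continuous_mult:
  fixes f g :: "complex^'n::finite \<Rightarrow> complex"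
  assumes g: "continuous_on (sphere 0 1) g" and f: "integrable sphere_measure f"
  shows "integrable sphere_measure (\<lambda>x. g x * f x)"
proof -
  have "compact (g ` sphere 0 1)" using g by (intro compact_continuous_image) auto
  then obtain B where B: "\<And>x. x \<in> sphere 0 1 \<Longrightarrow> norm (g x) \<le> B"
    using compact_imp_bounded bounded_iff by (metis imageI)
  have [measurable]: "g \<in> borel_measurable sphere_measure" "f \<in> borel_measurable sphere_measure"
    using borel_measurable_sphere_measureI[OF g] f by auto
  show ?thesis
  proof (rule Bochner_Integration.integrable_bound[of _ "\<lambda>x. B * cmod (f x)"])
    show "AE x in sphere_measure. norm (g x * f x) \<le> norm (B * cmod (f x))"
    proof (rule AE_I2)
      fix x :: "complex^'n" assume "x \<in> space sphere_measure"
      then have "cmod (g x) \<le> \<bar>B\<bar>" using B[of x] by (simp del: mem_sphere)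
      then show "norm (g x * f x) \<le> norm (B * cmod (f x))"
        by (auto simp: norm_mult abs_mult intro: mult_right_mono)
    qed
  qed (use f in auto)
qed

text \<open>Dominated convergence for the error of the linear approximation. It works along
  sequences, so the limit at w is first put in sequential form; the candidate derivative T is
  bounded by the same kernel estimate.\<close>

lemma has_derivative_poisson_extension:
  fixes f :: "complex^'n::finite \<Rightarrow> complex"
  assumes f: "integrable sphere_measure f" and w: "norm w < 1"
  shows "(poisson_extension f has_derivative
    (\<lambda>v. LINT x|sphere_measure. of_real (poisson_kernel_deriv w x v) * f x)) (at w)"
proof -
  \<comment> \<open>The radius is strictly between |w| and 1, so the kernel bounds hold uniformly on
    a neighbourhood of w.\<close>
  define r where "r = (1 + norm w) / 2"
  define L where "L = 2 / ((1 - r)\<^sup>2) ^ CARD('n) + 4 * real CARD('n) / ((1 - r)\<^sup>2) ^ Suc CARD('n)"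
  have r: "norm w < r" "r < 1" "norm w \<le> r" using w by (auto simp: r_def)
  have L0: "L \<ge> 0" by (simp add: L_def)
  define T where "T v = (LINT x|sphere_measure. of_real (poisson_kernel_deriv w x v) * f x)" for v
  have ik: "integrable sphere_measure (\<lambda>x. of_real (poisson_kernel y x) * f x)" if "norm y < 1" for y
    using continuous_on_poisson_kernel(1)[OF that] by (intro integrable_continuous_mult f continuous_intros)
  have id: "integrable sphere_measure (\<lambda>x. of_real (poisson_kernel_deriv w x v) * f x)" for v
    using continuous_on_poisson_kernel(2)[OF w] by (intro integrable_continuous_mult f continuous_intros)
  have lin: "poisson_kernel_deriv w x (a + b) = poisson_kernel_deriv w x a + poisson_kernel_deriv w x b"
     "poisson_kernel_deriv w x (c *\<^sub>R a) = c * poisson_kernel_deriv w x a" for x a b c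
    unfolding poisson_kernel_deriv_def
    by (simp_all add: inner_add_right algebra_simps add_divide_distrib diff_divide_distrib)
  have dle: "\<bar>poisson_kernel_deriv w x v\<bar> \<le> L * norm v" if "norm x = 1" for x v
    unfolding L_def by (rule poisson_kernel_deriv_bound[OF r(3,2) that])
  have "bounded_linear T"
  proof (rule bounded_linear_intro[where K="L * (LINT x|sphere_measure. cmod (f x))"])
    fix a b :: "complex^'n"
    show "T (a + b) = T a + T b"
      unfolding T_def lin using id[of a] id[of b] by (simp add: distrib_right)
  next
    fix c :: real and a :: "complex^'n"
    show "T (c *\<^sub>R a) = c *\<^sub>R T a"
      unfolding T_def lin by (simp add: mult.assoc scaleR_conv_of_real)
  next
    fix v :: "complex^'n"
    have "norm (T v) \<le> (LINT x|sphere_measure. (L * norm v) * cmod (f x))"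
      unfolding T_def
    proof (rule norm_LINT_le[OF id])
      fix x :: "complex^'n" assume "x \<in> space sphere_measure"
      then show "norm (of_real (poisson_kernel_deriv w x v) * f x) \<le> L * norm v * cmod (f x)"
        using dle[of x v] by (auto simp: norm_mult intro: mult_right_mono)
    qed (use f in simp)
    then show "norm (T v) \<le> norm v * (L * (LINT x|sphere_measure. cmod (f x)))"
      by (simp add: mult_ac)
  qed
  moreover have "((\<lambda>y. (1 / norm (y - w)) *\<^sub>R (poisson_extension f y - (poisson_extension f w + T (y - w)))) \<longlongrightarrow> 0) (at w)"
  proof (subst tendsto_at_iff_sequentially, intro allI impI)
    fix X :: "nat \<Rightarrow> complex^'n" assume X: "\<forall>i. X i \<in> UNIV - {w}" "X \<longlonglongrightarrow> w"
    define F where "F y x = (poisson_kernel y x - (poisson_kernel w x + poisson_kernel_deriv w x (y - w))) / norm (y - w)" for y x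
    have eq: "(1 / norm (y - w)) *\<^sub>R (poisson_extension f y - (poisson_extension f w + T (y - w)))
        = (LINT x|sphere_measure. of_real (F y x) * f x)" if "norm y < 1" for y
    proof -
      have "(LINT x|sphere_measure. of_real (F y x) * f x)
        = (LINT x|sphere_measure. (1 / norm (y - w)) *\<^sub>R (of_real (poisson_kernel y x) * f x - (of_real (poisson_kernel w x) * f x + of_real (poisson_kernel_deriv w x (y - w)) * f x)))"
        by (intro Bochner_Integration.integral_cong refl)
          (simp add: F_def scaleR_conv_of_real algebra_simps diff_divide_distrib add_divide_distrib)
      also have "\<dots> = (1 / norm (y - w)) *\<^sub>R (poisson_extension f y - (poisson_extension f w + T (y - w)))"
        using ik[OF that] ik[OF w] id by (simp add: poisson_extension_eq T_def)
      finally show ?thesis ..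
    qed
    have "\<forall>\<^sub>F i in sequentially. dist (X i) w < r - norm w"
      using X(2) r by (intro tendstoD) auto
    then obtain N where N: "\<And>i. i \<ge> N \<Longrightarrow> dist (X i) w < r - norm w"
      by (auto simp: eventually_sequentially)
    \<comment> \<open>Dropping finitely many terms puts the whole sequence into the ball of radius
      r, where the domination holds.\<close>
    define Y where "Y i = X (i + N)" for i
    have Yr: "norm (Y i) \<le> r" for i
      using N[of "i + N"] norm_triangle_ineq2[of "Y i" w] by (simp add: Y_def dist_norm)
    then have Y1: "norm (Y i) < 1" for i using r(2) le_less_trans by blast
    have Yw: "Y \<longlonglongrightarrow> w" unfolding Y_def using X(2) by (rule LIMSEQ_ignore_initial_segment)
    have Yne: "Y i \<noteq> w" for i using X(1) by (auto simp: Y_def)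
    have fl: "filterlim Y (at w) sequentially"
      using Yw Yne by (auto simp: filterlim_at)
    have "(\<lambda>i. LINT x|sphere_measure. of_real (F (Y i) x) * f x) \<longlonglongrightarrow> (LINT x|(sphere_measure :: (complex^'n) measure). 0)"
    proof (rule integral_dominated_convergence[where w="\<lambda>x. 2 * L * cmod (f x)"])
      show "(\<lambda>x. of_real (F (Y i) x) * f x) \<in> borel_measurable sphere_measure" for i
      proof (intro borel_measurable_times)
        show "(\<lambda>x. complex_of_real (F (Y i) x)) \<in> borel_measurable sphere_measure"
          unfolding F_def using continuous_on_poisson_kernel[OF w] continuous_on_poisson_kernel[OF Y1[of i]] Yne[of i]
          by (intro borel_measurable_sphere_measureI continuous_intros) auto
      qed (use f in auto)
      show "AE x in sphere_measure. (\<lambda>i. of_real (F (Y i) x) * f x) \<longlonglongrightarrow> 0"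
      proof (rule AE_I2)
        fix x :: "complex^'n" assume "x \<in> space sphere_measure"
        then have "((\<lambda>w. poisson_kernel w x) has_derivative poisson_kernel_deriv w x) (at w)"
          using w by (intro has_derivative_poisson_kernel) auto
        then have "((\<lambda>y. F y x) \<longlongrightarrow> 0) (at w)"
          by (simp add: has_derivative_within F_def divide_inverse mult.commute)
        then have "(\<lambda>i. F (Y i) x) \<longlonglongrightarrow> 0" using fl by (rule filterlim_compose)
        then have "(\<lambda>i. of_real (F (Y i) x) * f x) \<longlonglongrightarrow> of_real 0 * f x" by (intro tendsto_intros)
        then show "(\<lambda>i. of_real (F (Y i) x) * f x) \<longlonglongrightarrow> 0" by simp
      qed
      show "AE x in sphere_measure. norm (of_real (F (Y i) x) * f x) \<le> 2 * L * cmod (f x)" for i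
      proof (rule AE_I2)
        fix x :: "complex^'n" assume "x \<in> space sphere_measure"
        then have x: "norm x = 1" by simp
        have "\<bar>poisson_kernel (Y i) x - (poisson_kernel w x + poisson_kernel_deriv w x (Y i - w))\<bar>
          \<le> L * norm (Y i - w) + L * norm (Y i - w)"
          using poisson_kernel_lipschitz[OF r(3) Yr r(2) x, of i, folded L_def] dle[OF x, of "Y i - w"]
          by linarith
        then have "\<bar>F (Y i) x\<bar> \<le> 2 * L" using Yne[of i] by (simp add: F_def abs_divide divide_le_eq)
        then show "norm (of_real (F (Y i) x) * f x) \<le> 2 * L * cmod (f x)"
          by (auto simp: norm_mult intro: mult_right_mono)
      qed
    qed (use f in auto)
    then have "(\<lambda>i. (1 / norm (Y i - w)) *\<^sub>R (poisson_extension f (Y i) - (poisson_extension f w + T (Y i - w)))) \<longlonglongrightarrow> 0"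
      by (simp add: eq[OF Y1])
    then show "((\<lambda>y. (1 / norm (y - w)) *\<^sub>R (poisson_extension f y - (poisson_extension f w + T (y - w)))) \<circ> X) \<longlonglongrightarrow> 0"
      unfolding Y_def o_def
      by (rule LIMSEQ_offset[of "\<lambda>i. (1 / norm (X i - w)) *\<^sub>R (poisson_extension f (X i) - (poisson_extension f w + T (X i - w)))"])
  qed
  ultimately show ?thesis
    unfolding has_derivative_within T_def[symmetric, abs_def] by simp
qed

lemma sphere_L2_eq: "sphere_L2 = {f. sq_integrable sphere_measure f}"
  by (simp add: sphere_L2_def sq_integrable_def)

text \<open>Integrating f against such a function gives T(i v) - i T(v), where T is the real
  derivative at w of the Poisson extension. The Cauchy-Riemann equations become orthogonality
  relations with bounded test functions.\<close>

definition cauchy_riemann_kernels :: "(complex^'n::finite \<Rightarrow> complex) set" where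
  "cauchy_riemann_kernels =
     {\<lambda>x. of_real (poisson_kernel_deriv w x (\<i> *s v)) - \<i> * of_real (poisson_kernel_deriv w x v) |w v. norm w < 1}"

text \<open>A derivative is unique, so holomorphy says that T is complex homogeneous at each
  interior point; since T is real linear, c = i suffices. The Hardy space thereby has the form for
  which \<open>L2_annihilator_projection\<close> provides projections.\<close>

lemma hardy_space_eq:
  "hardy_space = {f :: complex^'n::finite \<Rightarrow> complex. sq_integrable sphere_measure f \<and>
     (\<forall>q\<in>cauchy_riemann_kernels. (LINT x|sphere_measure. q x * f x) = 0)}"
proof (rule set_eqI)
  fix f :: "complex^'n \<Rightarrow> complex"
  define T where "T w v = (LINT x|sphere_measure. of_real (poisson_kernel_deriv w x v) * f x)" for w v
  have "holomorphic_several_on (poisson_extension f) (ball 0 1) \<longleftrightarrow>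
     (\<forall>q\<in>cauchy_riemann_kernels. (LINT x|sphere_measure. q x * f x) = 0)" if L: "sq_integrable sphere_measure f"
  proof -
    have f: "integrable sphere_measure f" using L by (rule sphere.sq_integrable_integrable)
    have der: "(poisson_extension f has_derivative T w) (at w)" if "norm w < 1" for w
      unfolding T_def[abs_def] by (rule has_derivative_poisson_extension[OF f that])
    have int: "(LINT x|sphere_measure. (of_real (poisson_kernel_deriv w x (\<i> *s v)) - \<i> * of_real (poisson_kernel_deriv w x v)) * f x)
        = T w (\<i> *s v) - \<i> * T w v" if "norm w < 1" for w v
    proof -
      have i: "integrable sphere_measure (\<lambda>x. of_real (poisson_kernel_deriv w x v) * f x)" for v
        using continuous_on_poisson_kernel(2)[OF that] by (intro integrable_continuous_mult f continuous_intros)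
      show ?thesis
        unfolding T_def using i[of v] i[of "\<i> *s v"] by (simp add: left_diff_distrib mult.assoc)
    qed
    have "holomorphic_several_on (poisson_extension f) (ball 0 1) \<longleftrightarrow>
      (\<forall>w. norm w < 1 \<longrightarrow> (\<forall>c v. T w (c *s v) = c * T w v))"
    proof -
      have "(\<exists>D. (poisson_extension f has_derivative D) (at w) \<and> (\<forall>c v. D (c *s v) = c * D v))
          \<longleftrightarrow> (\<forall>c v. T w (c *s v) = c * T w v)" if "norm w < 1" for w
        using der[OF that] has_derivative_unique[OF der[OF that]] by metis
      then show ?thesis by (simp add: holomorphic_several_on_def Ball_def)
    qed
    also have "\<dots> \<longleftrightarrow> (\<forall>w. norm w < 1 \<longrightarrow> (\<forall>v. T w (\<i> *s v) = \<i> * T w v))"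
    proof (intro all_cong, safe)
      fix w v :: "complex^'n" and c assume w: "norm w < 1" and i: "\<forall>v. T w (\<i> *s v) = \<i> * T w v"
      have lin: "linear (T w)" using has_derivative_linear[OF der[OF w]] .
      have "c *s v = Re c *\<^sub>R v + Im c *\<^sub>R (\<i> *s v)"
        by (simp add: vec_eq_iff complex_eq_iff)
      then have "T w (c *s v) = Re c *\<^sub>R T w v + Im c *\<^sub>R (\<i> * T w v)"
        using i by (simp add: linear_add[OF lin] linear_scale[OF lin])
      also have "\<dots> = c * T w v" by (simp add: complex_eq_iff)
      finally show "T w (c *s v) = c * T w v" .
    qed auto
    also have "\<dots> \<longleftrightarrow> (\<forall>q\<in>cauchy_riemann_kernels. (LINT x|sphere_measure. q x * f x) = 0)"
    proof -
      have "(\<forall>q\<in>cauchy_riemann_kernels. (LINT x|sphere_measure. q x * f x) = 0) \<longleftrightarrow>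
        (\<forall>w v. norm w < 1 \<longrightarrow> (LINT x|sphere_measure. (of_real (poisson_kernel_deriv w x (\<i> *s v)) - \<i> * of_real (poisson_kernel_deriv w x v)) * f x) = 0)"
        (is "?L \<longleftrightarrow> (\<forall>w v. norm w < 1 \<longrightarrow> (LINT x|sphere_measure. ?q w v x * f x) = 0)")
      proof (intro iffI allI impI ballI)
        fix w v :: "complex^'n" assume L: ?L and "norm w < 1"
        then have "?q w v \<in> cauchy_riemann_kernels" unfolding cauchy_riemann_kernels_def by blast
        from bspec[OF L this] show "(LINT x|sphere_measure. ?q w v x * f x) = 0" .
      next
        fix q :: "complex^'n \<Rightarrow> complex" assume "\<forall>w v. norm w < 1 \<longrightarrow> (LINT x|sphere_measure. ?q w v x * f x) = 0" "q \<in> cauchy_riemann_kernels"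
        then show "(LINT x|sphere_measure. q x * f x) = 0" by (auto simp: cauchy_riemann_kernels_def)
      qed
      then show ?thesis using int by auto
    qed
    finally show ?thesis .
  qed
  then show "f \<in> hardy_space \<longleftrightarrow> f \<in> {f. sq_integrable sphere_measure f \<and>
     (\<forall>q\<in>cauchy_riemann_kernels. (LINT x|sphere_measure. q x * f x) = 0)}"
    by (auto simp: hardy_space_def sphere_L2_eq)
qed

text \<open>Existence of a projection is what gives the choice operator in the definition its
  meaning. The chosen representative is unspecified, and only its inner products with Hardy
  functions are evaluated.\<close>

lemma hardy_projection:
  fixes f :: "complex^'n::finite \<Rightarrow> complex"
  assumes f: "sq_integrable sphere_measure f"
  shows "hardy_projection f \<in> hardy_space"
    and "h \<in> hardy_space \<Longrightarrow> sphere_inner (hardy_projection f) h = sphere_inner f h"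
proof -
  have cont: "continuous_on (sphere 0 1) q" if "q \<in> cauchy_riemann_kernels" for q :: "complex^'n \<Rightarrow> complex"
    using that continuous_on_poisson_kernel(2)
    by (auto simp: cauchy_riemann_kernels_def intro!: continuous_intros)
  have "\<exists>g\<in>hardy_space. \<forall>h\<in>hardy_space. (LINT x|sphere_measure. (f x - g x) * cnj (h x)) = 0"
    unfolding hardy_space_eq
  proof (rule sphere.L2_annihilator_projection[OF _ _ f])
    fix q :: "complex^'n \<Rightarrow> complex" assume "q \<in> cauchy_riemann_kernels"
    from cont[OF this] show "q \<in> borel_measurable sphere_measure"
      by (rule borel_measurable_sphere_measureI)
    from cont[OF \<open>q \<in> cauchy_riemann_kernels\<close>] have "compact (q ` sphere 0 1)" by (intro compact_continuous_image) auto
    then show "\<exists>B. \<forall>x\<in>space sphere_measure. cmod (q x) \<le> B"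
      using compact_imp_bounded bounded_iff by (metis imageI space_sphere_measure)
  qed
  then have P: "hardy_projection f \<in> hardy_space \<and> (\<forall>h\<in>hardy_space. sphere_inner (\<lambda>x. f x - hardy_projection f x) h = 0)"
    unfolding hardy_projection_def sphere_inner_def Bex_def by (rule someI_ex)
  then show g: "hardy_projection f \<in> hardy_space" by simp
  show "sphere_inner (hardy_projection f) h = sphere_inner f h" if h: "h \<in> hardy_space"
  proof -
    have L: "sq_integrable sphere_measure (hardy_projection f)" "sq_integrable sphere_measure h"
      using g h by (auto simp: hardy_space_eq)
    have "sphere_inner (\<lambda>x. f x - hardy_projection f x) h = sphere_inner f h - sphere_inner (hardy_projection f) h"
      unfolding sphere_inner_def using integrable_mult_sq_integrable[OF f sq_integrable_cnj[OF L(2)]]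
        integrable_mult_sq_integrable[OF L(1) sq_integrable_cnj[OF L(2)]]
      by (simp add: left_diff_distrib)
    with P h show ?thesis by auto
  qed
qed

section \<open>Unitary symmetries and moments of the coordinates\<close>

lemma mult_cnj_unit: "cmod c = 1 \<Longrightarrow> c * cnj c = 1"
  by (metis complex_norm_square of_real_1 power_one)

lemma herm_inner_linear [simp]:
  "herm_inner (a + b) c = herm_inner a c + herm_inner b c"
  "herm_inner (a - b) c = herm_inner a c - herm_inner b c"
  "herm_inner c (a + b) = herm_inner c a + herm_inner c b"
  "herm_inner c (a - b) = herm_inner c a - herm_inner c b"
  "herm_inner (t *s a) c = t * herm_inner a c"
  "herm_inner a (t *s c) = cnj t * herm_inner a c"
  by (simp_all add: herm_inner_def algebra_simps sum.distrib sum_subtractf sum_distrib_left)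

lemma herm_inner_cnj: "cnj (herm_inner a b) = herm_inner b a"
  by (simp add: herm_inner_def mult.commute)

lemma Re_herm_inner: "Re (herm_inner a b) = a \<bullet> b"
  by (simp add: herm_inner_def inner_vec_def inner_complex_def)

lemma Im_herm_inner: "Im (herm_inner a b) = a \<bullet> (\<i> *s b)"
  by (simp flip: Re_herm_inner)

lemma herm_inner_self: "herm_inner a a = of_real ((norm a)\<^sup>2)"
  by (simp add: complex_eq_iff Re_herm_inner Im_herm_inner power2_norm_eq_inner inner_vec_def inner_complex_def)

lemma herm_inner_axis [simp]: "herm_inner a (axis k 1) = a $ k"
  "herm_inner (axis k 1) a = cnj (a $ k)"
  by (simp_all add: herm_inner_def axis_def if_distrib if_distribR cong: if_cong)

lemma norm_eq_1_herm_inner: "norm a = 1 \<Longrightarrow> herm_inner a a = 1"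
  by (simp add: herm_inner_self)

lemma continuous_on_herm_inner [continuous_intros]:
  fixes f g :: "'a::topological_space \<Rightarrow> complex^'n::finite"
  shows "continuous_on S f \<Longrightarrow> continuous_on S g \<Longrightarrow> continuous_on S (\<lambda>x. herm_inner (f x) (g x))"
  unfolding herm_inner_def by (intro continuous_intros)

lemma cmod_herm_inner_le: "cmod (herm_inner a b) \<le> norm a * norm b"
proof -
  have "cmod (herm_inner a b) \<le> (\<Sum>j\<in>UNIV. \<bar>norm (a $ j)\<bar> * \<bar>norm (b $ j)\<bar>)"
    unfolding herm_inner_def by (rule order.trans[OF norm_sum]) (simp add: norm_mult)
  also have "\<dots> \<le> norm a * norm b" unfolding norm_vec_def by (rule L2_set_mult_ineq)
  finally show ?thesis .
qed

text \<open>Encoded as real orthogonal plus complex homogeneous, so that the rotation invariance of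
  the surface measure applies directly.\<close>

definition unitary :: "(complex^'n::finite \<Rightarrow> complex^'n) \<Rightarrow> bool" where
  "unitary W \<longleftrightarrow> orthogonal_transformation W \<and> (\<forall>c x. W (c *s x) = c *s W x)"

lemma herm_inner_unitary: "unitary W \<Longrightarrow> herm_inner (W a) (W b) = herm_inner a b"
  unfolding unitary_def
  by (simp add: complex_eq_iff Re_herm_inner Im_herm_inner orthogonal_transformation_def)
    (metis orthogonal_transformation_def)

lemma unitaryI:
  assumes "\<And>a b. W (a + b) = W a + W b" "\<And>c x. W (c *s x) = c *s W x"
    "\<And>x. herm_inner (W x) (W x) = herm_inner x x"
  shows "unitary W"
proof -
  have "r *\<^sub>R x = of_real r *s x" for r and x :: "complex^'a" by (simp add: vec_eq_iff scaleR_conv_of_real[where 'a=complex])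
  then have "linear W" using assms by (intro linearI) auto
  moreover have "norm (W x) = norm x" for x
    using assms(3)[of x] by (simp add: herm_inner_self flip: of_real_power)
  ultimately show ?thesis using assms by (simp add: unitary_def orthogonal_transformation)
qed

text \<open>A complex Householder reflection: after a phase \<gamma> makes the inner product of u
  with a = \<gamma> e_k real, the reflection along u - a takes a to u. Without the phase, reflecting
  along u - e_k need not reach u.\<close>

lemma unitary_exists:
  fixes u :: "complex^'n::finite" and k :: 'n
  assumes u: "norm u = 1"
  obtains W where "unitary W" "W (axis k 1) = u"
proof -
  \<comment> \<open>If the coordinate vanishes, any phase gives a real inner product, and 1 is
    taken.\<close>
  define \<gamma> where "\<gamma> = (if u $ k = 0 then 1 else u $ k / of_real (cmod (u $ k)))"
  have \<gamma>: "cmod \<gamma> = 1" by (simp add: \<gamma>_def norm_divide)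
  have \<gamma>2: "\<gamma> * cnj \<gamma> = 1" using \<gamma> by (rule mult_cnj_unit)
  define a where "a = \<gamma> *s axis k (1::complex)"
  have re: "herm_inner u a = of_real (cmod (u $ k))"
    by (simp add: a_def \<gamma>_def complex_norm_square[symmetric] power2_eq_square mult.commute)
  then have re2: "herm_inner a u = of_real (cmod (u $ k))" by (metis herm_inner_cnj complex_cnj_complex_of_real)
  have aa: "herm_inner a a = 1" using \<gamma>2 by (simp add: a_def mult.commute)
  have uu: "herm_inner u u = 1" using u by (rule norm_eq_1_herm_inner)
  define v where "v = u - a"
  \<comment> \<open>For v = 0 the quotient is 0, so R is then the identity, which is correct because
    u = a in that case.\<close>
  define c where "c x = 2 * herm_inner x v / herm_inner v v" for x
  define R where "R x = x - c x *s v" for x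
  have vv: "herm_inner v v = of_real (2 - 2 * cmod (u $ k))"
    by (simp add: v_def aa uu re re2)
  have "unitary (\<lambda>x. R (\<gamma> *s x))"
  proof (rule unitaryI)
    show "R (\<gamma> *s (a + b)) = R (\<gamma> *s a) + R (\<gamma> *s b)" for a b
      by (simp add: R_def c_def vec_eq_iff algebra_simps add_divide_distrib)
    show "R (\<gamma> *s (d *s x)) = d *s R (\<gamma> *s x)" for d x
      by (simp add: R_def c_def vec_eq_iff algebra_simps)
    have RR: "herm_inner (R y) (R y) = herm_inner y y" for y
    proof (cases "herm_inner v v = 0")
      case False
      have "cnj (c y) * herm_inner v v = 2 * herm_inner v y"
        using False vv by (simp add: c_def herm_inner_cnj)
      then have "herm_inner (R y) (R y) = herm_inner y y - cnj (c y) * herm_inner y v - c y * herm_inner v y + c y * (cnj (c y) * herm_inner v v)"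
        by (simp add: R_def algebra_simps del: mult_cancel_left)
      also have "cnj (c y) * herm_inner v v = 2 * herm_inner v y" by fact
      finally have "herm_inner (R y) (R y) = herm_inner y y - cnj (c y) * herm_inner y v - c y * herm_inner v y + c y * (2 * herm_inner v y)" .
      moreover have "cnj (c y) = 2 * herm_inner v y / herm_inner v v" by (simp add: c_def herm_inner_cnj)
      then have "cnj (c y) * herm_inner y v = c y * herm_inner v y" by (simp add: c_def)
      ultimately show ?thesis by simp
    qed (simp add: R_def c_def)
    show "herm_inner (R (\<gamma> *s x)) (R (\<gamma> *s x)) = herm_inner x x" for x
      using \<gamma>2 by (simp add: RR mult.assoc[symmetric] mult.commute[of "cnj \<gamma>"])
  qed
  moreover have "R (\<gamma> *s axis k 1) = u"
  proof (cases "v = 0")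
    case True
    then show ?thesis by (simp add: R_def c_def v_def flip: a_def)
  next
    case False
    then have "herm_inner v v \<noteq> 0" by (simp add: herm_inner_self)
    moreover have "2 * herm_inner a v = - herm_inner v v"
      by (simp add: vv v_def aa uu re re2)
    ultimately have "c a = -1" by (simp add: c_def divide_eq_eq)
    then show ?thesis by (simp add: R_def v_def flip: a_def)
  qed
  ultimately show thesis by (rule that)
qed

lemma integral_sphere_unitary:
  fixes f :: "complex^'n::finite \<Rightarrow> 'b::{banach,second_countable_topology}"
  assumes "unitary W" "continuous_on (sphere 0 1) f"
  shows "(LINT x|sphere_measure. f (W x)) = (LINT x|sphere_measure. f x)"
  using assms unfolding unitary_def
  by (intro integral_sphere_orthogonal borel_measurable_sphere_measureI) auto

lemma measure_sphere_measure [simp]: "measure (sphere_measure :: (complex^'n::finite) measure) (sphere 0 1) = 1"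
  using sphere.prob_space by simp

lemma LINT_sphere_cong:
  assumes "\<And>x. norm x = 1 \<Longrightarrow> f x = g x"
  shows "(LINT x|sphere_measure. f x) = (LINT x|sphere_measure. g x)"
  by (rule Bochner_Integration.integral_cong) (auto intro: assms)

lemma integral_sphere_herm_inner:
  fixes f :: "complex \<Rightarrow> 'b::{banach,second_countable_topology}" and u :: "complex^'n::finite" and k :: 'n
  assumes u: "norm u = 1" and f: "continuous_on (cball 0 1) f"
  shows "(LINT x|sphere_measure. f (herm_inner x u)) = (LINT x|sphere_measure. f (x $ k))"
proof -
  obtain W where W: "unitary W" "W (axis k 1) = u" using unitary_exists[OF u] .
  have "continuous_on (sphere 0 1) (\<lambda>x. f (herm_inner x u))"
  proof (rule continuous_on_compose2[OF f])
    show "(\<lambda>x. herm_inner x u) ` sphere 0 1 \<subseteq> cball 0 1"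
      using cmod_herm_inner_le[of _ u] u by (auto; metis mult_cancel_right1)
  qed (intro continuous_intros)
  from integral_sphere_unitary[OF W(1) this]
  have "(LINT x|sphere_measure. f (herm_inner x u)) = (LINT x|sphere_measure. f (herm_inner (W x) (W (axis k 1))))"
    by (simp add: W)
  then show ?thesis by (simp add: herm_inner_unitary[OF W(1)])
qed

section \<open>Moments of the coordinates on the sphere\<close>

definition phase_at :: "'n \<Rightarrow> complex \<Rightarrow> complex^'n::finite \<Rightarrow> complex^'n" where
  "phase_at k c x = (\<chi> i. if i = k then c * x $ i else x $ i)"

lemma phase_at_nth [simp]: "phase_at k c x $ i = (if i = k then c * x $ i else x $ i)"
  by (simp add: phase_at_def)

lemma unitary_phase_at: "cmod c = 1 \<Longrightarrow> unitary (phase_at k c)"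
proof (rule unitaryI)
  assume c: "cmod c = 1"
  then have "c * cnj c = 1" by (rule mult_cnj_unit)
  then have "c * (cnj c * d) = d" for d by (metis mult.assoc mult_1)
  then show "herm_inner (phase_at k c x) (phase_at k c x) = herm_inner x x" for x
    unfolding herm_inner_def phase_at_def by (intro sum.cong) (auto simp: mult_ac)
qed (auto simp: phase_at_def vec_eq_iff algebra_simps)

text \<open>Multiplying the k-th coordinate by a phase c preserves the measure and multiplies the
  integrand by \<open>c ^ a * cnj c ^ b\<close>, which can be made -1 when a and b differ.\<close>

lemma integral_sphere_monomial_eq_0:
  fixes g :: "complex^'n::finite \<Rightarrow> complex"
  assumes ab: "a \<noteq> b" and g: "continuous_on (sphere 0 1) g"
    and inv: "\<And>c x. cmod c = 1 \<Longrightarrow> norm x = 1 \<Longrightarrow> g (phase_at k c x) = g x"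
  shows "(LINT x|sphere_measure. (x $ k) ^ a * cnj (x $ k) ^ b * g x) = 0"
proof -
  \<comment> \<open>The total angle is (a - b) times pi / (a - b). The difference is taken in the
    reals and may be negative.\<close>
  define c where "c = cis (pi / (real a - real b))"
  have c: "cmod c = 1" by (simp add: c_def)
  have "c ^ a = cis (real a * (pi / (real a - real b)))" "cnj c ^ b = cis (real b * - (pi / (real a - real b)))"
    by (simp_all only: c_def Complex.DeMoivre cis_cnj)
  then have "c ^ a * cnj c ^ b = cis (real a * (pi / (real a - real b)) - real b * (pi / (real a - real b)))"
    by (simp only: cis_mult) simp
  also have "real a * (pi / (real a - real b)) - real b * (pi / (real a - real b)) = pi"
    using ab by (simp add: diff_divide_distrib[symmetric] left_diff_distrib[symmetric])
  finally have m: "c ^ a * cnj c ^ b = -1" by simp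
  have "(LINT x|sphere_measure. (x $ k) ^ a * cnj (x $ k) ^ b * g x)
     = (LINT x|sphere_measure. (phase_at k c x $ k) ^ a * cnj (phase_at k c x $ k) ^ b * g (phase_at k c x))"
    using g by (intro integral_sphere_unitary[OF unitary_phase_at[OF c], symmetric] continuous_intros)
  also have "\<dots> = (LINT x|sphere_measure. (c ^ a * cnj c ^ b) * ((x $ k) ^ a * cnj (x $ k) ^ b * g x))"
    by (rule LINT_sphere_cong) (simp add: inv[OF c] power_mult_distrib mult_ac)
  also have "\<dots> = - (LINT x|sphere_measure. (x $ k) ^ a * cnj (x $ k) ^ b * g x)" by (simp add: m)
  finally show ?thesis by simp
qed

text \<open>Nonnegative arguments suffice, since they already are infinitely many roots of the
  difference. The restriction matches the use with y = t^2.\<close>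

lemma poly_coeffs_unique:
  fixes a b :: "nat \<Rightarrow> complex"
  assumes "\<And>y::real. y \<ge> 0 \<Longrightarrow> (\<Sum>i\<le>n. a i * of_real y ^ i) = (\<Sum>i\<le>n. b i * of_real y ^ i)" "i \<le> n"
  shows "a i = b i"
proof -
  define p where "p = (\<Sum>i\<le>n. monom (a i - b i) i)"
  have "of_real y \<in> {x. poly p x = 0}" if "y \<ge> 0" for y :: real
    using assms(1)[OF that] by (simp add: p_def poly_sum poly_monom left_diff_distrib sum_subtractf)
  then have "complex_of_real ` {0..} \<subseteq> {x. poly p x = 0}" by auto
  moreover have "infinite (complex_of_real ` {0..})"
    by (subst finite_image_iff) (auto simp: inj_on_def infinite_Ici)
  ultimately have "p = 0" using poly_roots_finite finite_subset by metis
  then have "coeff p i = 0" by simp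
  then show ?thesis using assms(2) by (simp add: p_def coeff_sum coeff_monom if_distrib cong: if_cong)
qed

text \<open>The integral of \<open>|x \<cdot> u|\<^bsup>2N\<^esup>\<close> is the same for all unit vectors \<open>u\<close>; compare coefficients of \<open>y = t\<^sup>2\<close>
  for \<open>u\<close> proportional to \<open>e\<^sub>k + t e\<^sub>j\<close>.\<close>
lemma integral_sphere_two_coords:
  fixes k j :: "'n::finite"
  assumes kj: "k \<noteq> j"
  shows "of_nat (Suc l) * (LINT x|sphere_measure. (x $ k) ^ l * cnj (x $ k) ^ l * (x $ j * cnj (x $ j)))
    = (LINT x|(sphere_measure :: (complex^'n) measure). (x $ k) ^ Suc l * cnj (x $ k) ^ Suc l)"
proof -
  define N where "N = Suc l"
  define Mo where "Mo = (LINT x|(sphere_measure :: (complex^'n) measure). (x $ k) ^ N * cnj (x $ k) ^ N)"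
  define I where "I a = (LINT x|(sphere_measure :: (complex^'n) measure). (x $ k) ^ (N - a) * cnj (x $ k) ^ (N - a) * (x $ j ^ a * cnj (x $ j) ^ a))" for a
  \<comment> \<open>Of all coefficients only the linear one is wanted: N^2 I 1 = N Mo, and I 1 is
    the moment with a single |x_j|^2.\<close>
  have "of_nat (N choose 1) ^ 2 * I 1 = of_nat (N choose 1) * Mo"
  proof (rule poly_coeffs_unique[where n=N and a="\<lambda>a. of_nat (N choose a) ^ 2 * I a" and b="\<lambda>a. of_nat (N choose a) * Mo"])
    fix y :: real assume y: "y \<ge> 0"
    define t where "t = sqrt y"
    define s where "s = sqrt (1 + y)"
    have t2: "t * t = y" and s2: "s * s = 1 + y" and s0: "s \<noteq> 0" using y by (auto simp: t_def s_def)
    \<comment> \<open>Normalizing by s, where s^2 = 1 + y, contributes (1 + y)^(-N) to the integral.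
      Moved to the other side it gives (1 + y)^N Mo, whose binomial coefficients are the right-hand
      coefficients.\<close>
    define u :: "complex^'n" where "u = of_real (1 / s) *s (axis k 1 + of_real t *s axis j 1)"
    have h0: "herm_inner (axis k 1) (axis j 1 :: complex^'n) = 0" "herm_inner (axis j 1) (axis k 1 :: complex^'n) = 0"
    proof -
      have "axis i (1::complex) $ i' = 0" if "i \<noteq> i'" for i i' :: 'n using that by (simp add: axis_def)
      then show "herm_inner (axis k 1) (axis j 1 :: complex^'n) = 0" "herm_inner (axis j 1) (axis k 1 :: complex^'n) = 0"
        using kj by auto
    qed
    have h1: "herm_inner (axis i 1) (axis i 1 :: complex^'n) = 1" for i by simp
    have "herm_inner u u = of_real ((1 / s) * (1 / s) * (1 + t * t))"
      by (simp add: u_def h0 h1 add_divide_distrib del: herm_inner_axis)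
    then have "herm_inner u u = 1" using s0 by (simp add: t2 s2[symmetric])
    then have "(norm u)\<^sup>2 = 1" by (simp add: herm_inner_self flip: of_real_power)
    then have u: "norm u = 1" by (metis norm_ge_zero power2_eq_1_iff neg_0_le_iff_le not_one_le_zero)
    have xu: "herm_inner x u = of_real (1 / s) * (x $ k + of_real t * x $ j)" for x
      by (simp add: u_def add_divide_distrib)
    \<comment> \<open>Phase invariance in the k-th coordinate leaves only the diagonal a = b of the
      double binomial sum, so t enters through t^2 = y alone.\<close>
    have term0: "(LINT x|(sphere_measure :: (complex^'n) measure). (x $ k) ^ a * cnj (x $ k) ^ b * ((x $ j) ^ (N - a) * cnj (x $ j) ^ (N - b))) = 0" if "a \<noteq> b" for a b
      using kj by (intro integral_sphere_monomial_eq_0 that continuous_intros) auto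
    have "Mo = (LINT x|(sphere_measure :: (complex^'n) measure). (herm_inner x u) ^ N * cnj (herm_inner x u) ^ N)"
      unfolding Mo_def by (rule integral_sphere_herm_inner[OF u, symmetric]) (intro continuous_intros)
    also have "\<dots> = (LINT x|(sphere_measure :: (complex^'n) measure). (\<Sum>a\<le>N. \<Sum>b\<le>N.
        of_real (1 / (1 + y)) ^ N * (of_nat (N choose a) * of_nat (N choose b) * of_real t ^ (N - a) * of_real t ^ (N - b)
        * ((x $ k) ^ a * cnj (x $ k) ^ b * ((x $ j) ^ (N - a) * cnj (x $ j) ^ (N - b))))))"
    proof (rule LINT_sphere_cong)
      fix x :: "complex^'n"
      have "(herm_inner x u) ^ N * cnj (herm_inner x u) ^ N
        = (of_real (1 / s) * of_real (1 / s)) ^ N * ((x $ k + of_real t * x $ j) ^ N * (cnj (x $ k) + of_real t * cnj (x $ j)) ^ N)"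
        by (simp add: xu power_mult_distrib power_divide mult_ac)
      also have "of_real (1 / s) * of_real (1 / s) = (of_real (1 / (1 + y)) :: complex)"
        by (simp flip: s2)
      also have "(x $ k + of_real t * x $ j) ^ N * (cnj (x $ k) + of_real t * cnj (x $ j)) ^ N
        = (\<Sum>a\<le>N. \<Sum>b\<le>N. (of_nat (N choose a) * (x $ k) ^ a * (of_real t * x $ j) ^ (N - a)) * (of_nat (N choose b) * cnj (x $ k) ^ b * (of_real t * cnj (x $ j)) ^ (N - b)))"
        by (simp add: binomial_ring sum_product)
      also have "of_real (1 / (1 + y)) ^ N * \<dots> = (\<Sum>a\<le>N. \<Sum>b\<le>N.
        of_real (1 / (1 + y)) ^ N * (of_nat (N choose a) * of_nat (N choose b) * of_real t ^ (N - a) * of_real t ^ (N - b)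
        * ((x $ k) ^ a * cnj (x $ k) ^ b * ((x $ j) ^ (N - a) * cnj (x $ j) ^ (N - b)))))"
        unfolding sum_distrib_left by (intro sum.cong refl) (simp add: power_mult_distrib mult_ac)
      finally show "(herm_inner x u) ^ N * cnj (herm_inner x u) ^ N = \<dots>" .
    qed
    also have "\<dots> = (\<Sum>a\<le>N. \<Sum>b\<le>N. of_real (1 / (1 + y)) ^ N * (of_nat (N choose a) * of_nat (N choose b) * of_real t ^ (N - a) * of_real t ^ (N - b)
        * (LINT x|(sphere_measure :: (complex^'n) measure). (x $ k) ^ a * cnj (x $ k) ^ b * ((x $ j) ^ (N - a) * cnj (x $ j) ^ (N - b)))))"
    proof -
      have i: "integrable (sphere_measure :: (complex^'n) measure) (\<lambda>x. (x $ k) ^ a * cnj (x $ k) ^ b * ((x $ j) ^ (N - a) * cnj (x $ j) ^ (N - b)))" for a b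
        by (intro integrable_sphere_continuous continuous_intros)
      show ?thesis using i by (simp add: Bochner_Integration.integral_sum)
    qed
    also have "\<dots> = (\<Sum>a\<le>N. of_real (1 / (1 + y)) ^ N * (of_nat (N choose a) ^ 2 * of_real y ^ (N - a) * I (N - a)))"
    proof (intro sum.cong refl)
      fix a assume a: "a \<in> {..N}"
      have "(\<Sum>b\<le>N. of_real (1 / (1 + y)) ^ N * (of_nat (N choose a) * of_nat (N choose b) * of_real t ^ (N - a) * of_real t ^ (N - b)
        * (LINT x|(sphere_measure :: (complex^'n) measure). (x $ k) ^ a * cnj (x $ k) ^ b * ((x $ j) ^ (N - a) * cnj (x $ j) ^ (N - b)))))
        = (\<Sum>b\<in>{a}. of_real (1 / (1 + y)) ^ N * (of_nat (N choose a) * of_nat (N choose b) * of_real t ^ (N - a) * of_real t ^ (N - b)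
        * (LINT x|(sphere_measure :: (complex^'n) measure). (x $ k) ^ a * cnj (x $ k) ^ b * ((x $ j) ^ (N - a) * cnj (x $ j) ^ (N - b)))))"
        using a term0 by (intro sum.mono_neutral_right) auto
      also have "\<dots> = of_real (1 / (1 + y)) ^ N * (of_nat (N choose a) ^ 2 * of_real y ^ (N - a) * I (N - a))"
        using a by (simp add: I_def power2_eq_square mult_ac flip: t2 power_mult_distrib)
      finally show "(\<Sum>b\<le>N. of_real (1 / (1 + y)) ^ N * (of_nat (N choose a) * of_nat (N choose b) * of_real t ^ (N - a) * of_real t ^ (N - b)
        * (LINT x|(sphere_measure :: (complex^'n) measure). (x $ k) ^ a * cnj (x $ k) ^ b * ((x $ j) ^ (N - a) * cnj (x $ j) ^ (N - b))))) = \<dots>" .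
    qed
    \<comment> \<open>The binomial theorem counted powers of x_k, whereas \<open>I\<close> counts
      powers of x_j; hence the reversal a to N - a.\<close>
    also have "\<dots> = (\<Sum>a\<le>N. of_real (1 / (1 + y)) ^ N * (of_nat (N choose a) ^ 2 * of_real y ^ a * I a))"
      by (rule sum.reindex_bij_witness[of _ "\<lambda>a. N - a" "\<lambda>a. N - a"]) (auto simp: binomial_symmetric[symmetric])
    finally have "Mo = of_real (1 / (1 + y)) ^ N * (\<Sum>a\<le>N. of_nat (N choose a) ^ 2 * I a * of_real y ^ a)"
      by (simp add: sum_distrib_left mult_ac)
    then have "(\<Sum>a\<le>N. of_nat (N choose a) ^ 2 * I a * of_real y ^ a) = (of_real y + 1) ^ N * Mo"
    proof -
      assume *: "Mo = of_real (1 / (1 + y)) ^ N * (\<Sum>a\<le>N. of_nat (N choose a) ^ 2 * I a * of_real y ^ a)"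
      have "(of_real y + 1) * of_real (1 / (1 + y)) = (of_real ((y + 1) * (1 / (1 + y))) :: complex)" by simp
      also have "(y + 1) * (1 / (1 + y)) = 1" using y by simp
      finally have X: "(of_real y + 1) * of_real (1 / (1 + y)) = (1::complex)" by simp
      have "(of_real y + 1) ^ N * of_real (1 / (1 + y)) ^ N = (1::complex)"
        by (simp only: X power_one power_mult_distrib[symmetric])
      then show ?thesis by (subst *) (simp add: mult.assoc[symmetric])
    qed
    also have "\<dots> = (\<Sum>a\<le>N. of_nat (N choose a) * Mo * of_real y ^ a)"
      by (simp add: binomial_ring sum_distrib_left sum_distrib_right mult_ac)
    finally show "(\<Sum>a\<le>N. of_nat (N choose a) ^ 2 * I a * of_real y ^ a) = (\<Sum>a\<le>N. of_nat (N choose a) * Mo * of_real y ^ a)" .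
  qed (simp add: N_def)
  then have "of_nat N * I 1 = Mo" by (simp add: power2_eq_square N_def del: of_nat_Suc)
  then show ?thesis by (simp add: I_def Mo_def N_def)
qed

text \<open>The reciprocal of the binomial coefficient (n-1+l choose l).\<close>

definition sphere_moment :: "nat \<Rightarrow> nat \<Rightarrow> real" where
  "sphere_moment n l = fact l * fact (n - 1) / fact (n - 1 + l)"

text \<open>Insert 1 = \<Sum> |x_j|^2 into the l-th moment. The term j = k is the next moment and
  each of the n - 1 others is that moment divided by l + 1, so (l + 1) Mo(l) = (l + n) Mo(l +
  1).\<close>

lemma integral_sphere_moment_diag:
  fixes k :: "'n::finite"
  shows "(LINT x|(sphere_measure :: (complex^'n) measure). (x $ k) ^ l * cnj (x $ k) ^ l) = of_real (sphere_moment CARD('n) l)"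
proof (induction l)
  case 0
  then show ?case by (simp add: sphere_moment_def)
next
  case (Suc l)
  define Mo where "Mo l = (LINT x|(sphere_measure :: (complex^'n) measure). (x $ k) ^ l * cnj (x $ k) ^ l)" for l
  define J where "J j = (LINT x|(sphere_measure :: (complex^'n) measure). (x $ k) ^ l * cnj (x $ k) ^ l * (x $ j * cnj (x $ j)))" for j
  define m where "m = CARD('n) - 1"
  have "Mo l = (LINT x|(sphere_measure :: (complex^'n) measure). (\<Sum>j\<in>UNIV. (x $ k) ^ l * cnj (x $ k) ^ l * (x $ j * cnj (x $ j))))"
    unfolding Mo_def
  proof (rule LINT_sphere_cong)
    fix x :: "complex^'n" assume "norm x = 1"
    then have "(\<Sum>j\<in>UNIV. x $ j * cnj (x $ j)) = 1"
      using norm_eq_1_herm_inner[of x] by (simp add: herm_inner_def)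
    then show "(x $ k) ^ l * cnj (x $ k) ^ l = (\<Sum>j\<in>UNIV. (x $ k) ^ l * cnj (x $ k) ^ l * (x $ j * cnj (x $ j)))"
      by (simp add: sum_distrib_left[symmetric])
  qed
  also have "\<dots> = (\<Sum>j\<in>UNIV. J j)"
    unfolding J_def by (intro Bochner_Integration.integral_sum integrable_sphere_continuous continuous_intros)
  also have "\<dots> = J k + (\<Sum>j\<in>UNIV - {k}. J j)" by (subst sum.remove[of _ k]) auto
  also have "J k = Mo (Suc l)" by (simp add: J_def Mo_def mult_ac)
  also have "(\<Sum>j\<in>UNIV - {k}. J j) = (\<Sum>j\<in>UNIV - {k}. Mo (Suc l) / of_nat (Suc l))"
  proof (intro sum.cong refl)
    fix j assume "j \<in> UNIV - {k}"
    then have "of_nat (Suc l) * J j = Mo (Suc l)"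
      unfolding J_def Mo_def by (intro integral_sphere_two_coords) auto
    then show "J j = Mo (Suc l) / of_nat (Suc l)" by (simp add: field_simps del: of_nat_Suc)
  qed
  also have "\<dots> = of_nat m * Mo (Suc l) / of_nat (Suc l)" by (simp add: card_Diff_singleton m_def)
  finally have "of_nat (Suc l) * Mo l = (of_nat (Suc l) + of_nat m) * Mo (Suc l)"
    by (simp add: field_simps del: of_nat_Suc)
  then have "of_nat (Suc l) * Mo l = of_nat (Suc l + m) * Mo (Suc l)" by (simp only: of_nat_add)
  then have "Mo (Suc l) = of_nat (Suc l) * Mo l / of_nat (Suc l + m)"
    by (simp add: field_simps del: of_nat_Suc)
  also have "Mo l = of_real (sphere_moment CARD('n) l)" using Suc by (simp add: Mo_def)
  also have "of_nat (Suc l) * of_real (sphere_moment CARD('n) l) / of_nat (Suc l + m)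
     = complex_of_real (real (Suc l) * sphere_moment CARD('n) l / real (Suc l + m))"
    by simp
  also have "real (Suc l) * sphere_moment CARD('n) l / real (Suc l + m) = sphere_moment CARD('n) (Suc l)"
    unfolding sphere_moment_def m_def[symmetric] by (simp add: field_simps)
  finally show ?case by (simp add: Mo_def)
qed

lemma integral_sphere_moment:
  fixes k :: "'n::finite"
  shows "(LINT x|(sphere_measure :: (complex^'n) measure). (x $ k) ^ a * cnj (x $ k) ^ b)
    = (if a = b then of_real (sphere_moment CARD('n) a) else 0)"
  using integral_sphere_moment_diag[of k a] integral_sphere_monomial_eq_0[of a b "\<lambda>x. 1" k] by auto

section \<open>Poisson extensions of holomorphic functions\<close>

lemma central_binomial_gbinomial: "((-1/2::real) gchoose b) * (-4) ^ b = real ((2 * b) choose b)"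
proof (induction b)
  case (Suc b)
  have h: "((-1/2::real) gchoose Suc b) = (-1/2 gchoose b) * (-1/2 - real b) / real (Suc b)"
    by (simp add: gbinomial_prod_rev atLeast0_lessThan_Suc field_simps)
  have "((-1/2::real) gchoose Suc b) * (-4) ^ Suc b = ((-1/2 gchoose b) * (-4) ^ b) * (2 * (2 * real b + 1)) / real (Suc b)"
    unfolding h by (simp add: divide_simps) (simp add: algebra_simps)
  also have "\<dots> = real ((2 * b) choose b) * (2 * (2 * real b + 1)) / real (Suc b)" by (simp only: Suc)
  also have "\<dots> = real ((2 * Suc b) choose Suc b)"
  proof -
    have c1: "real ((2 * b) choose b) = fact (2 * b) / (fact b * fact b)"
      using binomial_fact[of b "2 * b"] by simp
    have c2: "real ((2 * Suc b) choose Suc b) = fact (2 * Suc b) / (fact (Suc b) * fact (Suc b))"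
      using binomial_fact[of "Suc b" "2 * Suc b", where 'a=real] by (simp del: binomial_Suc_Suc fact_Suc)
    show ?thesis unfolding c1 c2 by (simp add: divide_simps) (simp add: algebra_simps)
  qed
  finally show ?case .
qed simp

text \<open>The generating function of the central binomial coefficients is (1 - 4t)^(-1/2). The
  parametrization t = s / (1+s)^2 makes 1 - 4t a square; s will be the squared radius |w|^2.\<close>

lemma central_binomial_sums:
  assumes "0 \<le> s" "s < 1"
  shows "(\<lambda>b. real ((2 * b) choose b) * (s / (1 + s)\<^sup>2) ^ b) sums ((1 + s) / (1 - s))"
proof -
  define t where "t = s / (1 + s)\<^sup>2"
  have t: "1 - 4 * t = ((1 - s) / (1 + s))\<^sup>2" "t \<ge> 0"
    using assms by (simp_all add: t_def power_divide divide_simps) (simp add: power2_eq_square algebra_simps)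
  moreover have "((1 - s) / (1 + s))\<^sup>2 > 0" using assms by (intro zero_less_power divide_pos_pos) auto
  ultimately have "\<bar>- (4 * t)\<bar> < 1" by linarith
  from gen_binomial_real[OF this, of "-1/2"]
  have "(\<lambda>b. ((-1/2) gchoose b) * (- (4 * t)) ^ b) sums (1 - 4 * t) powr (-1/2)" by simp
  moreover have "((-1/2) gchoose b) * (- (4 * t)) ^ b = real ((2 * b) choose b) * t ^ b" for b
  proof -
    have "(- (4 * t)) ^ b = (-4) ^ b * t ^ b" by (simp flip: power_mult_distrib)
    then show ?thesis using central_binomial_gbinomial[of b] by (metis mult.assoc)
  qed
  moreover have "(1 - 4 * t) powr (-1/2) = (1 + s) / (1 - s)"
  proof -
    have "(1 - 4 * t) powr (1/2) = (1 - s) / (1 + s)"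
      using assms by (simp add: t powr_half_sqrt real_sqrt_divide)
    then show ?thesis by (simp add: powr_minus_divide flip: minus_divide_left)
  qed
  ultimately show ?thesis by (simp add: t_def)
qed

lemma sums_Suc_minus:
  fixes f :: "nat \<Rightarrow> real"
  shows "f sums S \<Longrightarrow> (\<lambda>n. f (Suc n)) sums (S - f 0)"
  by (simp add: sums_Suc_iff)

text \<open>With \<open>S\<^sub>N\<close> the sum, Pascal's rule gives \<open>S\<^sub>0 = 1 + 2 t S\<^sub>1\<close> and \<open>S\<^bsub>N+1\<^esub> = S\<^sub>N + t S\<^bsub>N+2\<^esub>\<close> for
  \<open>t = s / (1 + s)\<^sup>2\<close>.\<close>
lemma catalan_power_sums:
  assumes "0 \<le> s" "s < 1"
  shows "(\<lambda>b. real ((N + 2 * b) choose b) * (s / (1 + s)\<^sup>2) ^ b) sums ((1 + s) ^ Suc N / (1 - s))"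
proof (cases "s = 0")
  case True
  then show ?thesis using sums_If_finite[of "\<lambda>b. b = 0" "\<lambda>b. real ((N + 2 * b) choose b)"]
    by (simp add: power_0_left if_distrib cong: if_cong)
next
  case False
  define t where "t = s / (1 + s)\<^sup>2"
  \<comment> \<open>Both recursions are solved for the next sum by dividing by t, which is why s = 0
    is treated apart.\<close>
  have t0: "t \<noteq> 0" using False assms by (simp add: t_def)
  define S where "S N = (1 + s) ^ Suc N / (1 - s)" for N
  \<comment> \<open>The second recursion reaches two steps ahead, so the induction has the two base
    cases N = 0 and N = 1.\<close>
  have "(\<lambda>b. real ((N + 2 * b) choose b) * t ^ b) sums S N" for N
  proof (induction N rule: induct_nat_012)
    case 0
    show ?case using central_binomial_sums[OF assms] by (simp add: S_def t_def)
  next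
    case 1
    have "(\<lambda>b. real ((2 * b) choose b) * t ^ b) sums S 0"
      using central_binomial_sums[OF assms] by (simp add: S_def t_def)
    then have "(\<lambda>b. real ((2 * Suc b) choose Suc b) * t ^ Suc b) sums (S 0 - 1)"
      using sums_Suc_minus by fastforce
    moreover have "real ((2 * Suc b) choose Suc b) * t ^ Suc b = (2 * t) * (real ((1 + 2 * b) choose b) * t ^ b)" for b
    proof -
      have "(2 * Suc b) choose Suc b = (Suc (2 * b) choose b) + (Suc (2 * b) choose Suc b)" by simp
      also have "Suc (2 * b) choose Suc b = Suc (2 * b) choose b" by (subst binomial_symmetric) auto
      finally show ?thesis by simp
    qed
    ultimately have "(\<lambda>b. (2 * t) * (real ((1 + 2 * b) choose b) * t ^ b)) sums (S 0 - 1)" by (simp only:)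
    then have "(\<lambda>b. (1 / (2 * t)) * ((2 * t) * (real ((1 + 2 * b) choose b) * t ^ b))) sums ((1 / (2 * t)) * (S 0 - 1))"
      by (rule sums_mult)
    moreover have "(1 / (2 * t)) * (S 0 - 1) = S 1"
      using assms False by (simp add: S_def t_def field_simps power2_eq_square)
    ultimately show ?case using t0 by simp
  next
    case (ge2 N)
    have "(\<lambda>b. real ((Suc N + 2 * Suc b) choose Suc b) * t ^ Suc b - real ((N + 2 * Suc b) choose Suc b) * t ^ Suc b) sums ((S (Suc N) - 1) - (S N - 1))"
      using sums_diff[OF sums_Suc_minus[OF ge2(2)] sums_Suc_minus[OF ge2(1)]] by simp
    moreover have "real ((Suc N + 2 * Suc b) choose Suc b) * t ^ Suc b - real ((N + 2 * Suc b) choose Suc b) * t ^ Suc b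
       = t * (real ((Suc (Suc N) + 2 * b) choose b) * t ^ b)" for b
      by (simp add: algebra_simps)
    ultimately have "(\<lambda>b. t * (real ((Suc (Suc N) + 2 * b) choose b) * t ^ b)) sums (S (Suc N) - 1 - (S N - 1))" by (simp only:)
    then have "(\<lambda>b. t * (real ((Suc (Suc N) + 2 * b) choose b) * t ^ b)) sums (S (Suc N) - S N)" by simp
    then have "(\<lambda>b. (1 / t) * (t * (real ((Suc (Suc N) + 2 * b) choose b) * t ^ b))) sums ((1 / t) * (S (Suc N) - S N))"
      by (rule sums_mult)
    moreover have "(1 / t) * (S (Suc N) - S N) = S (Suc (Suc N))"
      using assms False by (simp add: S_def t_def divide_simps power2_eq_square) (simp add: algebra_simps)
    ultimately show ?case using t0 by simp
  qed
  then show ?thesis by (simp add: t_def S_def)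
qed

lemma negative_binomial_sums:
  fixes v :: real
  assumes "\<bar>v\<bar> < 1" "n \<ge> 1"
  shows "(\<lambda>m. real ((n - 1 + m) choose m) * v ^ m) sums (1 / (1 - v) ^ n)"
proof -
  have "(\<lambda>m. ((- real n) gchoose m) * (- v) ^ m) sums (1 + - v) powr (- real n)"
    using assms by (intro gen_binomial_real) auto
  moreover have "((- real n) gchoose m) * (- v) ^ m = real ((n - 1 + m) choose m) * v ^ m" for m
  proof -
    have "(- real n) gchoose m = (-1) ^ m * ((real n + real m - 1) gchoose m)" by (rule gbinomial_minus)
    also have "real n + real m - 1 = real (n - 1 + m)" using assms by simp
    finally have "(- real n) gchoose m = (-1) ^ m * real ((n - 1 + m) choose m)" by (simp only: binomial_gbinomial)
    moreover have "(- v) ^ m = (-1) ^ m * v ^ m" by (simp flip: power_mult_distrib)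
    ultimately show ?thesis by (simp flip: power_mult_distrib mult.assoc)
  qed
  moreover have "(1 + - v) powr (- real n) = 1 / (1 - v) ^ n"
    using assms by (simp add: powr_minus powr_realpow divide_inverse)
  ultimately show ?thesis by simp
qed

text \<open>Termwise integration under a Weierstrass majorant; total mass 1 lets B m bound the
  integral of the m-th term as well.\<close>

lemma sphere_sums_integral:
  fixes f :: "nat \<Rightarrow> complex^'n::finite \<Rightarrow> complex"
  assumes c: "\<And>m. continuous_on (sphere 0 1) (f m)"
    and b: "\<And>m x. norm x = 1 \<Longrightarrow> cmod (f m x) \<le> B m" and B: "summable B"
  shows "(\<lambda>m. LINT x|sphere_measure. f m x) sums (LINT x|sphere_measure. (\<Sum>m. f m x))"
proof (rule sums_integral)
  show "integrable sphere_measure (f m)" for m by (rule integrable_sphere_continuous[OF c])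
  show "AE x in sphere_measure. summable (\<lambda>m. norm (f m x))"
    using b B by (intro AE_I2 summable_comparison_test'[OF B]) auto
  show "summable (\<lambda>m. LINT x|sphere_measure. norm (f m x))"
  proof (rule summable_comparison_test'[OF B])
    fix m
    have "norm (LINT x|sphere_measure. norm (f m x)) \<le> (LINT x|(sphere_measure :: (complex^'n) measure). B m)"
      using b by (intro norm_LINT_le integrable_norm integrable_sphere_continuous[OF c]) auto
    then show "norm (LINT x|sphere_measure. norm (f m x)) \<le> B m" by simp
  qed
qed

section \<open>Poisson integrals of powers of \<open>herm_inner x z\<close>\<close>

lemma unitary_phase: "cmod c = 1 \<Longrightarrow> unitary (\<lambda>x::complex^'n::finite. c *s x)"
proof (rule unitaryI)
  assume "cmod c = 1"
  then have "c * cnj c = 1" by (rule mult_cnj_unit)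
  then show "herm_inner (c *s x) (c *s x) = herm_inner x x" for x :: "complex^'n"
    by (simp add: mult.assoc[symmetric] mult.commute[of "cnj c"])
qed (auto simp: vec_eq_iff algebra_simps)

lemma phase_cis_exists:
  fixes a b :: nat
  assumes "a \<noteq> b"
  obtains c where "cmod c = 1" "c ^ a * cnj c ^ b = -1"
proof -
  define c where "c = cis (pi / (real a - real b))"
  have "c ^ a = cis (real a * (pi / (real a - real b)))" "cnj c ^ b = cis (real b * - (pi / (real a - real b)))"
    by (simp_all only: c_def Complex.DeMoivre cis_cnj)
  then have "c ^ a * cnj c ^ b = cis (real a * (pi / (real a - real b)) - real b * (pi / (real a - real b)))"
    by (simp only: cis_mult) simp
  also have "real a * (pi / (real a - real b)) - real b * (pi / (real a - real b)) = pi"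
    using assms by (simp add: diff_divide_distrib[symmetric] left_diff_distrib[symmetric])
  finally show thesis using that[of c] by (simp add: c_def)
qed

text \<open>A common phase on all coordinates forces a = p + l. In the balanced case a phase on the
  k-th coordinate alone kills every term of the expanded inner product except the pure power of
  x_k.\<close>

lemma integral_sphere_mixed:
  fixes z :: "complex^'n::finite"
  shows "(LINT x|sphere_measure. (x $ k) ^ p * cnj (x $ k) ^ a * herm_inner x z ^ l)
    = (if a = p + l then cnj (z $ k) ^ l * of_real (sphere_moment CARD('n) a) else 0)"
proof (cases "a = p + l")
  case False
  then obtain c where c: "cmod c = 1" "c ^ (p + l) * cnj c ^ a = -1"
    using phase_cis_exists[of "p + l" a] by auto
  have "(LINT x|sphere_measure. (x $ k) ^ p * cnj (x $ k) ^ a * herm_inner x z ^ l)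
      = (LINT x|sphere_measure. ((c *s x) $ k) ^ p * cnj ((c *s x) $ k) ^ a * herm_inner (c *s x) z ^ l)"
    by (intro integral_sphere_unitary[OF unitary_phase[OF c(1)], symmetric] continuous_intros)
  also have "\<dots> = (LINT x|sphere_measure. (c ^ (p + l) * cnj c ^ a) * ((x $ k) ^ p * cnj (x $ k) ^ a * herm_inner x z ^ l))"
    by (rule LINT_sphere_cong) (simp add: power_mult_distrib power_add mult_ac)
  also have "\<dots> = - (LINT x|sphere_measure. (x $ k) ^ p * cnj (x $ k) ^ a * herm_inner x z ^ l)" by (simp add: c)
  finally show ?thesis using False by simp
next
  case True
  \<comment> \<open>The part of the inner product that does not involve x_k, hence is fixed by
    \<open>phase_at k c\<close>.\<close>
  define g where "g x = herm_inner x z - x $ k * cnj (z $ k)" for x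
  have cg: "continuous_on S g" for S unfolding g_def by (intro continuous_intros)
  have g_eq: "g x = (\<Sum>j\<in>UNIV - {k}. x $ j * cnj (z $ j))" for x
    unfolding g_def herm_inner_def by (subst sum.remove[of _ k]) auto
  have gph: "g (phase_at k c x) = g x" for c x unfolding g_eq by (intro sum.cong) auto
  have z0: "(LINT x|sphere_measure. (x $ k) ^ (p + i) * cnj (x $ k) ^ a * g x ^ (l - i)) = 0" if "i < l" for i
    using that True gph by (intro integral_sphere_monomial_eq_0 continuous_intros cg) auto
  have "(LINT x|sphere_measure. (x $ k) ^ p * cnj (x $ k) ^ a * herm_inner x z ^ l)
    = (LINT x|sphere_measure. (\<Sum>i\<le>l. (of_nat (l choose i) * cnj (z $ k) ^ i) * ((x $ k) ^ (p + i) * cnj (x $ k) ^ a * g x ^ (l - i))))"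
  proof (rule LINT_sphere_cong)
    fix x
    have "herm_inner x z ^ l = (x $ k * cnj (z $ k) + g x) ^ l" by (simp add: g_def)
    then show "(x $ k) ^ p * cnj (x $ k) ^ a * herm_inner x z ^ l
      = (\<Sum>i\<le>l. (of_nat (l choose i) * cnj (z $ k) ^ i) * ((x $ k) ^ (p + i) * cnj (x $ k) ^ a * g x ^ (l - i)))"
      by (simp add: binomial_ring sum_distrib_left power_add power_mult_distrib mult_ac)
  qed
  also have "\<dots> = (\<Sum>i\<le>l. (of_nat (l choose i) * cnj (z $ k) ^ i) * (LINT x|sphere_measure. (x $ k) ^ (p + i) * cnj (x $ k) ^ a * g x ^ (l - i)))"
  proof -
    have i: "integrable sphere_measure (\<lambda>x. (x $ k) ^ (p + i) * cnj (x $ k) ^ a * g x ^ (l - i))" for i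
      by (intro integrable_sphere_continuous continuous_intros cg)
    show ?thesis using i by (simp add: Bochner_Integration.integral_sum)
  qed
  also have "\<dots> = (\<Sum>i\<in>{l}. (of_nat (l choose i) * cnj (z $ k) ^ i) * (LINT x|sphere_measure. (x $ k) ^ (p + i) * cnj (x $ k) ^ a * g x ^ (l - i)))"
    using z0 by (intro sum.mono_neutral_right) auto
  also have "\<dots> = cnj (z $ k) ^ l * of_real (sphere_moment CARD('n) a)"
    using integral_sphere_moment[of k "p + l" a] True by simp
  finally show ?thesis using True by simp
qed

text \<open>The coefficient from the kernel, the one from expanding a power of 2 Re x_k and the
  sphere moment cancel down to a coefficient of the series in
  \<open>catalan_power_sums\<close>.\<close>

lemma binomial_moment_eq:
  assumes "n \<ge> 1"
  shows "real ((n - 1 + (2 * b + l)) choose (2 * b + l)) * real ((2 * b + l) choose (b + l)) * sphere_moment n (b + l)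
    = real ((n - 1 + l + 2 * b) choose b)"
proof -
  obtain m where m: "n = Suc m" using assms by (cases n) auto
  have e: "m + (2 * b + l) = m + l + 2 * b" "m + (b + l) = m + l + b" by auto
  show ?thesis
    unfolding sphere_moment_def m
    by (simp add: binomial_fact e ac_simps)
qed

text \<open>For w on a coordinate axis the kernel depends on x through Re x_k alone and is a
  negative binomial series in 2 Re x_k = x_k + cnj x_k. The mixed moments select the exponents m =
  2b + l with b + l conjugate factors, and the sum over b has a closed form that cancels all
  normalizations.\<close>

lemma poisson_integral_axis:
  fixes z :: "complex^'n::finite"
  assumes r: "0 \<le> r" "r < 1"
  shows "(LINT x|sphere_measure. of_real (poisson_kernel (of_real r *s axis k 1) x) * herm_inner x z ^ l)
    = (of_real r * cnj (z $ k)) ^ l"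
proof -
  define n where "n = CARD('n)"
  have n: "n \<ge> 1" using zero_less_card_finite[where 'a='n] unfolding n_def by linarith
  define s where "s = r\<^sup>2"
  have s: "0 \<le> s" "s < 1" using r by (auto simp: s_def power_less_one_iff abs_square_less_1)
  \<comment> \<open>Chosen so that |w - x|^2 = (1 + s)(1 - \<tau> 2 Re x_k). The bound 2 \<tau> < 1,
    equivalent to (1 - r)^2 > 0, makes the series converge uniformly on the sphere.\<close>
  define \<tau> where "\<tau> = r / (1 + s)"
  have \<tau>: "0 \<le> \<tau>" "2 * \<tau> < 1"
  proof -
    have "0 < (1 - r)\<^sup>2" using r by (intro zero_less_power) auto
    then have "2 * r < 1 + s" by (simp add: s_def power2_eq_square algebra_simps)
    then show "0 \<le> \<tau>" "2 * \<tau> < 1" using r s by (auto simp: \<tau>_def field_simps)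
  qed
  define c where "c m = (1 - s) / (1 + s) ^ n * (real ((n - 1 + m) choose m) * \<tau> ^ m)" for m
  have ker: "(\<lambda>m. c m * (2 * Re (x $ k)) ^ m) sums poisson_kernel (of_real r *s axis k 1) x" if x: "norm x = 1" for x :: "complex^'n"
  proof -
    define w :: "complex^'n" where "w = of_real r *s axis k 1"
    have xx: "x \<bullet> x = 1" using x by (simp add: norm_eq_1)
    have wx: "w \<bullet> x = r * Re (x $ k)" "x \<bullet> w = r * Re (x $ k)" "w \<bullet> w = s"
      by (simp_all add: w_def s_def power2_eq_square flip: Re_herm_inner)
    have D: "(w - x) \<bullet> (w - x) = (1 + s) * (1 - \<tau> * (2 * Re (x $ k)))"
      using s by (simp add: inner_diff_left inner_diff_right wx xx \<tau>_def field_simps)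
    have "\<bar>Re (x $ k)\<bar> \<le> 1"
      using abs_Re_le_cmod[of "x $ k"] x Finite_Cartesian_Product.norm_nth_le[of x k] by linarith
    then have "\<bar>\<tau> * (2 * Re (x $ k))\<bar> \<le> \<tau> * 2" using \<tau> by (simp add: abs_mult mult_left_le)
    then have "\<bar>\<tau> * (2 * Re (x $ k))\<bar> < 1" using \<tau> by linarith
    from sums_mult[OF negative_binomial_sums[OF this n], of "(1 - s) / (1 + s) ^ n"]
    have "(\<lambda>m. c m * (2 * Re (x $ k)) ^ m) sums ((1 - s) / (1 + s) ^ n * (1 / (1 - \<tau> * (2 * Re (x $ k))) ^ n))"
      by (simp add: c_def power_mult_distrib mult_ac)
    also have "(1 - s) / (1 + s) ^ n * (1 / (1 - \<tau> * (2 * Re (x $ k))) ^ n) = poisson_kernel w x"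
      unfolding poisson_kernel_def D wx n_def[symmetric] power_mult_distrib by simp
    finally show ?thesis by (simp add: w_def)
  qed
  define f where "f m x = of_real (c m * (2 * Re (x $ k)) ^ m) * herm_inner x z ^ l" for m and x :: "complex^'n"
  have fsum: "(\<Sum>m. f m x) = of_real (poisson_kernel (of_real r *s axis k 1) x) * herm_inner x z ^ l" if "norm x = 1" for x
    using sums_mult2[OF sums_of_real[OF ker[OF that]], of "herm_inner x z ^ l"]
    unfolding f_def by (rule sums_unique[symmetric])
  have c0: "c m \<ge> 0" for m using s \<tau> by (simp add: c_def)
  have "summable (\<lambda>m. real ((n - 1 + m) choose m) * (2 * \<tau>) ^ m)"
    using negative_binomial_sums[of "2 * \<tau>" n] \<tau> n by (auto simp: sums_iff)
  then have "summable (\<lambda>m. (1 - s) / (1 + s) ^ n * (real ((n - 1 + m) choose m) * (2 * \<tau>) ^ m) * norm z ^ l)"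
    by (intro summable_mult summable_mult2)
  then have "summable (\<lambda>m. c m * 2 ^ m * norm z ^ l)" by (simp add: c_def power_mult_distrib mult_ac)
  then have 1: "(\<lambda>m. LINT x|sphere_measure. f m x) sums (LINT x|sphere_measure. (\<Sum>m. f m x))"
  proof (rule sphere_sums_integral[rotated 2])
    show "continuous_on (sphere 0 1) (f m)" for m unfolding f_def by (intro continuous_intros)
    show "cmod (f m x) \<le> c m * 2 ^ m * norm z ^ l" if x: "norm x = 1" for m x
    proof -
      have "\<bar>Re (x $ k)\<bar> \<le> 1"
        using abs_Re_le_cmod[of "x $ k"] x Finite_Cartesian_Product.norm_nth_le[of x k] by linarith
      then have "\<bar>2 * Re (x $ k)\<bar> ^ m \<le> 2 ^ m" by (intro power_mono) auto
      moreover have "cmod (herm_inner x z) ^ l \<le> norm z ^ l"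
        using cmod_herm_inner_le[of x z] x by (intro power_mono) auto
      ultimately show ?thesis
        using c0[of m] by (auto simp: f_def norm_mult norm_power abs_mult intro!: mult_mono)
    qed
  qed
  have fint: "(LINT x|sphere_measure. f m x) = (\<Sum>a\<le>m. if 2 * a = m + l then of_real (c m * real (m choose a) * sphere_moment n a) * cnj (z $ k) ^ l else 0)" for m
  proof -
    have "(LINT x|sphere_measure. f m x) = (LINT x|sphere_measure. (\<Sum>a\<le>m. (of_real (c m) * of_nat (m choose a)) * ((x $ k) ^ (m - a) * cnj (x $ k) ^ a * herm_inner x z ^ l)))"
    proof (rule LINT_sphere_cong)
      fix x :: "complex^'n"
      have "complex_of_real (2 * Re (x $ k)) = cnj (x $ k) + x $ k" by (simp add: complex_add_cnj add.commute)
      then have "of_real (c m * (2 * Re (x $ k)) ^ m) = of_real (c m) * (cnj (x $ k) + x $ k) ^ m"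
        by (metis of_real_mult of_real_power)
      then show "f m x = (\<Sum>a\<le>m. (of_real (c m) * of_nat (m choose a)) * ((x $ k) ^ (m - a) * cnj (x $ k) ^ a * herm_inner x z ^ l))"
        unfolding f_def by (simp add: binomial_ring sum_distrib_left sum_distrib_right mult_ac)
    qed
    also have "\<dots> = (\<Sum>a\<le>m. (of_real (c m) * of_nat (m choose a)) * (LINT x|sphere_measure. (x $ k) ^ (m - a) * cnj (x $ k) ^ a * herm_inner x z ^ l))"
    proof -
      have i: "integrable sphere_measure (\<lambda>x. (x $ k) ^ (m - a) * cnj (x $ k) ^ a * herm_inner x z ^ l)" for a
        by (intro integrable_sphere_continuous continuous_intros)
      show ?thesis using i by (simp add: Bochner_Integration.integral_sum)
    qed
    also have "\<dots> = (\<Sum>a\<le>m. if 2 * a = m + l then of_real (c m * real (m choose a) * sphere_moment n a) * cnj (z $ k) ^ l else 0)"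
      unfolding integral_sphere_mixed n_def[symmetric] by (intro sum.cong refl) (auto simp: mult_ac)
    finally show ?thesis .
  qed
  \<comment> \<open>From 2a = m + l and m = 2b + l only a = b + l remains; \<tau>^2 = s / (1+s)^2 is
    the argument of the generating function.\<close>
  have even: "(LINT x|sphere_measure. f (2 * b + l) x) = of_real ((1 - s) / (1 + s) ^ n * \<tau> ^ l * (real ((n - 1 + l + 2 * b) choose b) * (s / (1 + s)\<^sup>2) ^ b)) * cnj (z $ k) ^ l" for b
  proof -
    have "(LINT x|sphere_measure. f (2 * b + l) x) = (\<Sum>a\<in>{b + l}. of_real (c (2 * b + l) * real ((2 * b + l) choose a) * sphere_moment n a) * cnj (z $ k) ^ l)"
      unfolding fint by (intro sum.mono_neutral_cong_right) auto
    also have "\<dots> = of_real (c (2 * b + l) * real ((2 * b + l) choose (b + l)) * sphere_moment n (b + l)) * cnj (z $ k) ^ l" by simp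
    also have "c (2 * b + l) * real ((2 * b + l) choose (b + l)) * sphere_moment n (b + l)
      = (1 - s) / (1 + s) ^ n * \<tau> ^ (2 * b + l) * real ((n - 1 + l + 2 * b) choose b)"
      unfolding binomial_moment_eq[OF n, symmetric] c_def by simp
    also have "\<tau> ^ (2 * b + l) = (s / (1 + s)\<^sup>2) ^ b * \<tau> ^ l"
      by (simp add: power_add power_mult \<tau>_def s_def power_divide)
    finally show ?thesis by (simp add: mult_ac)
  qed
  have "(\<lambda>b. LINT x|sphere_measure. f (2 * b + l) x) sums (of_real ((1 - s) / (1 + s) ^ n * \<tau> ^ l * ((1 + s) ^ Suc (n - 1 + l) / (1 - s))) * cnj (z $ k) ^ l)"
    unfolding even by (intro sums_mult2 sums_of_real sums_mult catalan_power_sums s)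
  \<comment> \<open>All exponents outside the range of b to 2b + l contribute 0: since a is at most
    m, the equation 2a = m + l gives a at least l and m = 2(a - l) + l.\<close>
  moreover have "(\<lambda>b. LINT x|sphere_measure. f (2 * b + l) x) sums (LINT x|sphere_measure. (\<Sum>m. f m x))"
  proof (subst sums_mono_reindex[of "\<lambda>b. 2 * b + l"])
    show "strict_mono (\<lambda>b. 2 * b + l)" by (auto simp: strict_mono_def)
    show "(LINT x|sphere_measure. f m x) = 0" if "m \<notin> range (\<lambda>b. 2 * b + l)" for m
      unfolding fint
    proof (intro sum.neutral ballI)
      fix a assume a: "a \<in> {..m}"
      have "2 * a \<noteq> m + l"
      proof
        assume "2 * a = m + l"
        with a have "m = 2 * (a - l) + l" by auto
        with that show False by blast
      qed
      then show "(if 2 * a = m + l then of_real (c m * real (m choose a) * sphere_moment n a) * cnj (z $ k) ^ l else 0) = 0" by simp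
    qed
  qed (rule 1)
  ultimately have "(LINT x|sphere_measure. (\<Sum>m. f m x)) = of_real ((1 - s) / (1 + s) ^ n * \<tau> ^ l * ((1 + s) ^ Suc (n - 1 + l) / (1 - s))) * cnj (z $ k) ^ l"
    using sums_unique2 by blast
  also have "(1 - s) / (1 + s) ^ n * \<tau> ^ l * ((1 + s) ^ Suc (n - 1 + l) / (1 - s)) = r ^ l"
  proof -
    have "Suc (n - 1 + l) = n + l" using n by simp
    then show ?thesis using s by (simp add: \<tau>_def power_divide power_add)
  qed
  finally show ?thesis
    using LINT_sphere_cong[of "\<lambda>x. \<Sum>m. f m x", OF fsum] by (simp add: power_mult_distrib)
qed

text \<open>A unitary map moves w to a coordinate axis; the kernel and the inner product are both
  invariant when w, x and z move together.\<close>

lemma poisson_extension_monomial: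
  fixes z w :: "complex^'n::finite"
  assumes w: "norm w < 1"
  shows "poisson_extension (\<lambda>x. herm_inner x z ^ l) w = herm_inner w z ^ l"
proof -
  obtain k :: 'n where True by simp
  \<comment> \<open>At w = 0 the direction is arbitrary, but it must still be a unit vector.\<close>
  define u where "u = (if w = 0 then axis k 1 else w /\<^sub>R norm w)"
  have u: "norm u = 1" by (simp add: u_def)
  have wu: "w = of_real (norm w) *s u"
    by (simp add: u_def vec_eq_iff scaleR_conv_of_real[where 'a=complex])
  obtain W where W: "unitary W" "W (axis k 1) = u" using unitary_exists[OF u] .
  have "surj W" using orthogonal_transformation_surj[OF conjunct1[OF W(1)[unfolded unitary_def]]] .
  then obtain z' where z': "z = W z'" by (metis surjD)
  define w' :: "complex^'n" where "w' = of_real (norm w) *s axis k 1"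
  have Ww: "w = W w'" using W wu by (simp add: w'_def unitary_def)
  have lin: "W (a - b) = W a - W b" for a b
    using W(1) by (auto simp: unitary_def intro!: linear_diff dest: orthogonal_transformation_linear)
  have inn: "W a \<bullet> W b = a \<bullet> b" for a b using W(1) by (simp add: unitary_def orthogonal_transformation_def)
  have "poisson_kernel w (W x) = poisson_kernel w' x" for x
    unfolding poisson_kernel_def Ww lin[symmetric] inn ..
  moreover have "(LINT x|sphere_measure. of_real (poisson_kernel w x) * herm_inner x z ^ l)
     = (LINT x|sphere_measure. of_real (poisson_kernel w (W x)) * herm_inner (W x) z ^ l)"
    using continuous_on_poisson_kernel(1)[OF w]
    by (intro integral_sphere_unitary[OF W(1), symmetric] continuous_intros)
  ultimately have "poisson_extension (\<lambda>x. herm_inner x z ^ l) w = (LINT x|sphere_measure. of_real (poisson_kernel w' x) * herm_inner x z' ^ l)"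
    by (simp add: poisson_extension_eq z' herm_inner_unitary[OF W(1)])
  also have "\<dots> = (of_real (norm w) * cnj (z' $ k)) ^ l"
    unfolding w'_def using w by (intro poisson_integral_axis) auto
  also have "of_real (norm w) * cnj (z' $ k) = herm_inner w' z'" by (simp add: w'_def)
  also have "\<dots> = herm_inner w z" by (simp add: Ww z' herm_inner_unitary[OF W(1)])
  finally show ?thesis .
qed

section \<open>Entire series in \<open>herm_inner x z\<close> belong to the Hardy space\<close>

definition entire_coeffs :: "(nat \<Rightarrow> complex) \<Rightarrow> bool" where
  "entire_coeffs a \<longleftrightarrow> (\<forall>R\<ge>0. summable (\<lambda>l. cmod (a l) * R ^ l))"

lemma entire_coeffs_summable: "entire_coeffs a \<Longrightarrow> summable (\<lambda>l. a l * c ^ l)"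
  by (rule summable_norm_cancel) (auto simp: entire_coeffs_def norm_mult norm_power)

lemma continuous_on_entire_series:
  assumes "entire_coeffs a"
  shows "continuous_on S (\<lambda>c. \<Sum>l. a l * c ^ l)"
proof -
  have "isCont (\<lambda>c. \<Sum>l. a l * c ^ l) c" for c
    using isCont_powser_converges_everywhere[of a c] entire_coeffs_summable[OF assms] by simp
  then show ?thesis by (simp add: continuous_at_imp_continuous_on)
qed

text \<open>Summing the monomial case shows that the Poisson extension is the series itself inside
  the ball. It is an entire function of one variable composed with a complex linear form, so its
  derivative is complex linear.\<close>

lemma hardy_space_power_series:
  fixes z :: "complex^'n::finite"
  assumes a: "entire_coeffs a"
  shows "(\<lambda>x. \<Sum>l. a l * herm_inner x z ^ l) \<in> hardy_space"
proof -
  define F where "F c = (\<Sum>l. a l * c ^ l)" for c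
  have F: "continuous_on S F" for S unfolding F_def[abs_def] by (rule continuous_on_entire_series[OF a])
  have cont: "continuous_on (sphere 0 1) (\<lambda>x. F (herm_inner x z))"
    by (intro continuous_on_compose2[OF F[of UNIV]] continuous_intros) auto
  have "compact ((\<lambda>x. F (herm_inner x z)) ` sphere 0 1)" using cont by (intro compact_continuous_image) auto
  then obtain B where B: "\<And>x. x \<in> sphere 0 1 \<Longrightarrow> norm (F (herm_inner x z)) \<le> B"
    using compact_imp_bounded bounded_iff by (metis (mono_tags, lifting) imageI)
  have L2: "sq_integrable sphere_measure (\<lambda>x. F (herm_inner x z))"
    by (rule sphere.sq_integrable_bounded[of _ B]) (auto intro!: borel_measurable_sphere_measureI cont B simp del: mem_sphere)
  have ext: "poisson_extension (\<lambda>x. F (herm_inner x z)) w = F (herm_inner w z)" if w: "norm w < 1" for w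
  proof -
    have cp: "continuous_on (sphere 0 1) (poisson_kernel w)" by (rule continuous_on_poisson_kernel(1)[OF w])
    then have "compact (poisson_kernel w ` sphere 0 1)" by (intro compact_continuous_image) auto
    then obtain P where P: "\<And>x. x \<in> sphere 0 1 \<Longrightarrow> norm (poisson_kernel w x) \<le> P"
      using compact_imp_bounded bounded_iff by (metis imageI)
    have sm: "summable (\<lambda>l. P * (cmod (a l) * norm z ^ l))"
      using a by (intro summable_mult) (auto simp: entire_coeffs_def)
    have s: "(\<lambda>l. LINT x|sphere_measure. a l * (of_real (poisson_kernel w x) * herm_inner x z ^ l)) sums
      (LINT x|sphere_measure. (\<Sum>l. a l * (of_real (poisson_kernel w x) * herm_inner x z ^ l)))"
    proof (rule sphere_sums_integral[OF _ _ sm])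
      show "continuous_on (sphere 0 1) (\<lambda>x. a l * (of_real (poisson_kernel w x) * herm_inner x z ^ l))" for l
        using cp by (intro continuous_intros)
      show "cmod (a l * (of_real (poisson_kernel w x) * herm_inner x z ^ l)) \<le> P * (cmod (a l) * norm z ^ l)" if x: "norm x = 1" for l x
      proof -
        have "cmod (herm_inner x z) ^ l \<le> norm z ^ l"
          using cmod_herm_inner_le[of x z] x by (intro power_mono) auto
        then have "\<bar>poisson_kernel w x\<bar> * (cmod (a l) * cmod (herm_inner x z) ^ l) \<le> P * (cmod (a l) * norm z ^ l)"
          using P[of x] x by (intro mult_mono) auto
        then show ?thesis by (simp add: norm_mult norm_power mult_ac)
      qed
    qed
    have e1: "(LINT x|sphere_measure. a l * (of_real (poisson_kernel w x) * herm_inner x z ^ l)) = a l * herm_inner w z ^ l" for l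
      using poisson_extension_monomial[OF w, of z l] by (simp add: poisson_extension_eq)
    have e2: "(\<Sum>l. a l * (of_real (poisson_kernel w x) * herm_inner x z ^ l)) = of_real (poisson_kernel w x) * F (herm_inner x z)" for x
      unfolding F_def using entire_coeffs_summable[OF a, of "herm_inner x z"]
      by (subst suminf_mult[symmetric]) (auto simp: mult_ac)
    have "(\<lambda>l. a l * herm_inner w z ^ l) sums (LINT x|sphere_measure. of_real (poisson_kernel w x) * F (herm_inner x z))"
      using s by (simp only: e1 e2)
    then show ?thesis by (simp add: poisson_extension_eq sums_iff F_def)
  qed
  have "holomorphic_several_on (poisson_extension (\<lambda>x. F (herm_inner x z))) (ball 0 1)"
    unfolding holomorphic_several_on_def
  proof
    fix w :: "complex^'n" assume w: "w \<in> ball 0 1"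
    have "DERIV F c :> (\<Sum>l. diffs a l * c ^ l)" for c
      unfolding F_def[abs_def] by (rule termdiffs_strong_converges_everywhere) (rule entire_coeffs_summable[OF a])
    then have d: "(F has_derivative (\<lambda>v. (\<Sum>l. diffs a l * (herm_inner w z) ^ l) * v)) (at (herm_inner w z))"
      by (simp add: has_field_derivative_def)
    have "bounded_linear (\<lambda>w. herm_inner w z)"
      unfolding herm_inner_def by (intro bounded_linear_intros bounded_linear_vec_nth)
    then have "((\<lambda>w. herm_inner w z) has_derivative (\<lambda>v. herm_inner v z)) (at w)"
      by (rule bounded_linear_imp_has_derivative)
    from has_derivative_compose[OF this d]
    have "((\<lambda>w. F (herm_inner w z)) has_derivative (\<lambda>v. (\<Sum>l. diffs a l * (herm_inner w z) ^ l) * herm_inner v z)) (at w)" .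
    then have "(poisson_extension (\<lambda>x. F (herm_inner x z)) has_derivative (\<lambda>v. (\<Sum>l. diffs a l * (herm_inner w z) ^ l) * herm_inner v z)) (at w)"
      by (rule has_derivative_transform_within_open[OF _ open_ball w]) (auto simp: ext)
    then show "\<exists>D. (poisson_extension (\<lambda>x. F (herm_inner x z)) has_derivative D) (at w) \<and> (\<forall>c v. D (c *s v) = c * D v)"
      by (intro exI conjI) (auto simp: mult_ac)
  qed
  then show ?thesis using L2 by (simp add: hardy_space_def sphere_L2_eq F_def)
qed

section \<open>Asymptotics of the index distribution\<close>

text \<open>The total weight is \<rho>^(2-n) I_{n-2}(2 \<rho>), with I the modified Bessel function.
  The subtraction is in the natural numbers and exact for n at least 2.\<close>

definition bessel_weight :: "nat \<Rightarrow> real \<Rightarrow> nat \<Rightarrow> real" where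
  "bessel_weight n \<rho> l = \<rho> ^ (2 * l) / (fact l * fact (l + n - 2))"

definition bessel_mean :: "nat \<Rightarrow> real \<Rightarrow> (nat \<Rightarrow> real) \<Rightarrow> real" where
  "bessel_mean n \<rho> f = (\<Sum>l. bessel_weight n \<rho> l * f l) / (\<Sum>l. bessel_weight n \<rho> l)"

lemma bessel_weight_pos: "\<rho> > 0 \<Longrightarrow> bessel_weight n \<rho> l > 0"
  by (simp add: bessel_weight_def)

lemma summable_bessel_weight: "\<rho> > 0 \<Longrightarrow> summable (bessel_weight n \<rho>)"
proof (rule summable_comparison_test'[OF summable_exp[of "\<rho>\<^sup>2"]])
  fix l assume "\<rho> > 0"
  have "\<rho> ^ (2 * l) * 1 \<le> \<rho> ^ (2 * l) * fact (l + n - 2)" by (intro mult_left_mono) auto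
  then show "norm (bessel_weight n \<rho> l) \<le> inverse (fact l) * (\<rho>\<^sup>2) ^ l"
    by (simp add: bessel_weight_def abs_mult divide_simps power_mult)
qed

lemma suminf_bessel_weight_pos: "\<rho> > 0 \<Longrightarrow> (\<Sum>l. bessel_weight n \<rho> l) > 0"
  by (intro suminf_pos summable_bessel_weight bessel_weight_pos)

lemma bessel_weight_le_suminf: "\<rho> > 0 \<Longrightarrow> bessel_weight n \<rho> l \<le> (\<Sum>l. bessel_weight n \<rho> l)"
  using sum_le_suminf[OF summable_bessel_weight, of \<rho> "{l}" n] bessel_weight_pos[of \<rho> n]
  by (auto intro: less_imp_le)

lemma summable_bessel_mult:
  assumes "\<rho> > 0" "\<And>l. \<bar>f l\<bar> \<le> B"
  shows "summable (\<lambda>l. bessel_weight n \<rho> l * f l)"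
proof (rule summable_comparison_test'[OF summable_mult2[OF summable_bessel_weight[OF assms(1), of n], of B]])
  show "norm (bessel_weight n \<rho> l * f l) \<le> bessel_weight n \<rho> l * B" for l
    using bessel_weight_pos[OF assms(1), of n l] assms(2)[of l] by (simp add: abs_mult mult_left_mono)
qed

lemma bessel_mean_const: "\<rho> > 0 \<Longrightarrow> bessel_mean n \<rho> (\<lambda>l. c) = c"
  using suminf_bessel_weight_pos[of \<rho> n] summable_bessel_weight[of \<rho> n]
  by (simp add: bessel_mean_def suminf_mult2[symmetric])

lemma bessel_mean_add:
  assumes "\<rho> > 0" "\<And>l. \<bar>f l\<bar> \<le> B" "\<And>l. \<bar>g l\<bar> \<le> C"
  shows "bessel_mean n \<rho> (\<lambda>l. f l + g l) = bessel_mean n \<rho> f + bessel_mean n \<rho> g"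
proof -
  have "(\<Sum>l. bessel_weight n \<rho> l * (f l + g l)) = (\<Sum>l. bessel_weight n \<rho> l * f l) + (\<Sum>l. bessel_weight n \<rho> l * g l)"
    unfolding distrib_left
    by (rule suminf_add[OF summable_bessel_mult[OF assms(1,2)] summable_bessel_mult[OF assms(1,3)], symmetric])
  then show ?thesis by (simp add: bessel_mean_def add_divide_distrib)
qed

lemma bessel_mean_cmult:
  assumes "\<rho> > 0" "\<And>l. \<bar>f l\<bar> \<le> B"
  shows "bessel_mean n \<rho> (\<lambda>l. c * f l) = c * bessel_mean n \<rho> f"
  using suminf_mult[OF summable_bessel_mult[where f=f and n=n, OF assms], of c]
  by (simp add: bessel_mean_def mult_ac)

lemma bessel_mean_mono:
  assumes "\<rho> > 0" "\<And>l. \<bar>f l\<bar> \<le> B" "\<And>l. \<bar>g l\<bar> \<le> C" "\<And>l. f l \<le> g l"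
  shows "bessel_mean n \<rho> f \<le> bessel_mean n \<rho> g"
  unfolding bessel_mean_def
  using suminf_bessel_weight_pos[OF assms(1), of n] bessel_weight_pos[OF assms(1), of n]
  by (intro divide_right_mono suminf_le summable_bessel_mult[OF assms(1,2)] summable_bessel_mult[OF assms(1,3)] mult_left_mono assms(4))
    (auto intro: less_imp_le)

lemma bessel_mean_abs_le:
  assumes "\<rho> > 0" "\<And>l. \<bar>f l\<bar> \<le> B" "\<And>l. \<bar>g l\<bar> \<le> C" "\<And>l. \<bar>f l\<bar> \<le> g l"
  shows "\<bar>bessel_mean n \<rho> f\<bar> \<le> bessel_mean n \<rho> g"
proof -
  have "f l \<le> g l" "- f l \<le> g l" for l using assms(4)[of l] by auto
  then have "bessel_mean n \<rho> f \<le> bessel_mean n \<rho> g" "bessel_mean n \<rho> (\<lambda>l. -1 * f l) \<le> bessel_mean n \<rho> g"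
    using assms by (auto intro!: bessel_mean_mono[OF assms(1) _ assms(3)] simp: abs_mult)
  then show ?thesis using bessel_mean_cmult[OF assms(1,2), of n "-1"] by simp
qed

text \<open>The expansion 1 + \<alpha>/(l+n) holds with an error bound uniform in every l, small
  ones included, so that it can be averaged. The variable l + n is the denominator of v.\<close>

definition expands1 :: "nat \<Rightarrow> (nat \<Rightarrow> real) \<Rightarrow> real \<Rightarrow> bool" where
  "expands1 n g \<alpha> \<longleftrightarrow> (\<exists>C\<ge>0. \<forall>l. \<bar>g l - 1 - \<alpha> / real (l + n)\<bar> \<le> C / real (l + n) ^ 2)"

lemma expands1_bounded:
  assumes "expands1 n g \<alpha>" "n \<ge> 1"
  obtains B where "\<And>l. \<bar>g l\<bar> \<le> B"
proof -
  obtain C where C: "C \<ge> 0" "\<And>l. \<bar>g l - 1 - \<alpha> / real (l + n)\<bar> \<le> C / real (l + n) ^ 2"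
    using assms(1) by (auto simp: expands1_def)
  have "\<bar>g l\<bar> \<le> 1 + \<bar>\<alpha>\<bar> + C" for l
  proof -
    have A: "real (l + n) \<ge> 1" using assms(2) by linarith
    have "\<bar>\<alpha> / real (l + n)\<bar> \<le> \<bar>\<alpha>\<bar>" using A by (simp add: abs_divide divide_le_eq mult_le_cancel_left1 mult_left_mono)
    moreover have "C / real (l + n) ^ 2 \<le> C"
      using A C(1) by (simp add: divide_le_eq mult_le_cancel_left1 one_le_power)
    ultimately show ?thesis using C(2)[of l] by linarith
  qed
  then show thesis by (rule that)
qed

lemma expands1_mult:
  assumes "expands1 n f \<alpha>" "expands1 n g \<beta>" "n \<ge> 1"
  shows "expands1 n (\<lambda>l. f l * g l) (\<alpha> + \<beta>)"
proof -
  obtain C where C: "C \<ge> 0" "\<And>l. \<bar>f l - 1 - \<alpha> / real (l + n)\<bar> \<le> C / real (l + n) ^ 2"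
    using assms(1) by (auto simp: expands1_def)
  obtain D where D: "D \<ge> 0" "\<And>l. \<bar>g l - 1 - \<beta> / real (l + n)\<bar> \<le> D / real (l + n) ^ 2"
    using assms(2) by (auto simp: expands1_def)
  obtain B where B: "\<And>l. \<bar>g l\<bar> \<le> B" using expands1_bounded[OF assms(2,3)] by blast
  then have B0: "B \<ge> 0" using abs_ge_zero order_trans by blast
  have "\<bar>f l * g l - 1 - (\<alpha> + \<beta>) / real (l + n)\<bar> \<le> (C * B + (1 + \<bar>\<alpha>\<bar>) * D + \<bar>\<alpha> * \<beta>\<bar>) / real (l + n) ^ 2" for l
  proof -
    define A where "A = real (l + n)"
    have A: "A \<ge> 1" using assms(3) unfolding A_def by linarith
    have eq: "f l * g l - 1 - (\<alpha> + \<beta>) / A = (f l - 1 - \<alpha> / A) * g l + (1 + \<alpha> / A) * (g l - 1 - \<beta> / A) + \<alpha> * \<beta> / A\<^sup>2"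
      using A by (simp add: field_simps power2_eq_square)
    have "\<bar>(f l - 1 - \<alpha> / A) * g l\<bar> \<le> (C / A\<^sup>2) * B"
      unfolding abs_mult using C(2)[of l] B[of l] C(1) by (intro mult_mono) (auto simp: A_def)
    moreover have "\<bar>(1 + \<alpha> / A) * (g l - 1 - \<beta> / A)\<bar> \<le> (1 + \<bar>\<alpha>\<bar>) * (D / A\<^sup>2)"
    proof -
      have "\<bar>\<alpha> / A\<bar> \<le> \<bar>\<alpha>\<bar>" using A by (simp add: abs_divide divide_le_eq mult_le_cancel_left1 mult_left_mono)
      then have "\<bar>1 + \<alpha> / A\<bar> \<le> 1 + \<bar>\<alpha>\<bar>" by linarith
      then show ?thesis unfolding abs_mult using D(2)[of l] by (intro mult_mono) (auto simp: A_def)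
    qed
    moreover have "\<bar>\<alpha> * \<beta> / A\<^sup>2\<bar> = \<bar>\<alpha> * \<beta>\<bar> / A\<^sup>2" by (simp add: abs_divide)
    ultimately have "\<bar>f l * g l - 1 - (\<alpha> + \<beta>) / A\<bar> \<le> (C / A\<^sup>2) * B + (1 + \<bar>\<alpha>\<bar>) * (D / A\<^sup>2) + \<bar>\<alpha> * \<beta>\<bar> / A\<^sup>2"
      unfolding eq by linarith
    also have "\<dots> = (C * B + (1 + \<bar>\<alpha>\<bar>) * D + \<bar>\<alpha> * \<beta>\<bar>) / A\<^sup>2" by (simp add: add_divide_distrib)
    finally show ?thesis by (simp add: A_def)
  qed
  moreover have "C * B + (1 + \<bar>\<alpha>\<bar>) * D + \<bar>\<alpha> * \<beta>\<bar> \<ge> 0" using C(1) D(1) B0 by simp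
  ultimately show ?thesis unfolding expands1_def by blast
qed

lemma expands1_one: "expands1 n (\<lambda>l. 1) 0"
  unfolding expands1_def by (rule exI[of _ 0]) simp

text \<open>With A = l + n the error is exactly c^2 (A / (A - c)) / A^2, and the remaining quotient
  is bounded. Positivity of n - c keeps the pole off every A.\<close>

lemma expands1_shift:
  assumes "real n - c > 0" "n \<ge> 1"
  shows "expands1 n (\<lambda>l. real (l + n) / (real (l + n) - c)) c"
proof -
  define d where "d = real n - c"
  \<comment> \<open>The quotient A / (A - c) is at most 1 for c \<le> 0, and largest at l = 0, with
    value n / d, for c > 0.\<close>
  define K where "K = max 1 (real n / d)"
  have "\<bar>real (l + n) / (real (l + n) - c) - 1 - c / real (l + n)\<bar> \<le> (c\<^sup>2 * K) / real (l + n) ^ 2" for l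
  proof -
    define A where "A = real (l + n)"
    have A: "A > 0" "A - c > 0" using assms by (auto simp: A_def)
    have d: "d > 0" using assms by (simp add: d_def)
    have AK: "A / (A - c) \<le> K"
    proof -
      have "real n \<le> K * d" using d by (simp add: K_def max_def field_simps)
      moreover have "real l \<le> K * real l" by (simp add: K_def mult_le_cancel_right1)
      ultimately have "A \<le> K * (A - c)" by (simp add: A_def d_def algebra_simps)
      then show ?thesis using A by (simp add: divide_le_eq)
    qed
    have eq: "A / (A - c) - 1 - c / A = c\<^sup>2 * (A / (A - c)) / A\<^sup>2"
      using A by (simp add: divide_simps power2_eq_square) (simp add: algebra_simps)
    have "\<bar>A / (A - c) - 1 - c / A\<bar> = c\<^sup>2 * (A / (A - c)) / A\<^sup>2"
      unfolding eq using A by (intro abs_of_nonneg) auto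
    also have "\<dots> \<le> c\<^sup>2 * K / A\<^sup>2" by (intro divide_right_mono mult_left_mono AK) auto
    finally show ?thesis unfolding A_def .
  qed
  moreover have "c\<^sup>2 * K \<ge> 0" by (simp add: K_def)
  ultimately show ?thesis unfolding expands1_def by blast
qed

text \<open>Multiply the error sqrt g - s, where s = 1 + (\<alpha>/2)/A, by sqrt g + s. The product
  g - s^2 is small by hypothesis, and \<alpha> \<ge> 0 keeps the factor sqrt g + s at least
  1.\<close>

lemma expands1_sqrt:
  assumes g: "expands1 n g \<alpha>" "\<And>l. g l \<ge> 0" and \<alpha>: "\<alpha> \<ge> 0" and n: "n \<ge> 1"
  shows "expands1 n (\<lambda>l. sqrt (g l)) (\<alpha> / 2)"
proof -
  obtain C where C: "C \<ge> 0" "\<And>l. \<bar>g l - 1 - \<alpha> / real (l + n)\<bar> \<le> C / real (l + n) ^ 2"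
    using g(1) by (auto simp: expands1_def)
  have "\<bar>sqrt (g l) - 1 - (\<alpha> / 2) / real (l + n)\<bar> \<le> (C + \<alpha>\<^sup>2) / real (l + n) ^ 2" for l
  proof -
    define A where "A = real (l + n)"
    have A: "A \<ge> 1" using n unfolding A_def by linarith
    define s where "s = 1 + (\<alpha> / 2) / A"
    have s: "s \<ge> 1" using A \<alpha> by (simp add: s_def)
    have "(sqrt (g l) - s) * (sqrt (g l) + s) = g l - s\<^sup>2"
      using g(2)[of l] by (simp add: algebra_simps power2_eq_square)
    also have "\<dots> = (g l - 1 - \<alpha> / A) - \<alpha>\<^sup>2 / 4 / A\<^sup>2"
      using A by (simp add: s_def field_simps power2_eq_square)
    finally have "\<bar>sqrt (g l) - s\<bar> * \<bar>sqrt (g l) + s\<bar> = \<bar>(g l - 1 - \<alpha> / A) - \<alpha>\<^sup>2 / 4 / A\<^sup>2\<bar>"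
      by (simp flip: abs_mult)
    also have "\<dots> \<le> C / A\<^sup>2 + \<alpha>\<^sup>2 / A\<^sup>2"
    proof -
      have "\<bar>\<alpha>\<^sup>2 / 4 / A\<^sup>2\<bar> = \<alpha>\<^sup>2 / 4 / A\<^sup>2" by simp
      also have "\<dots> \<le> \<alpha>\<^sup>2 / A\<^sup>2" by (intro divide_right_mono) auto
      finally have "\<bar>\<alpha>\<^sup>2 / 4 / A\<^sup>2\<bar> \<le> \<alpha>\<^sup>2 / A\<^sup>2" .
      then show ?thesis using C(2)[of l] unfolding A_def by linarith
    qed
    finally have "\<bar>sqrt (g l) - s\<bar> * \<bar>sqrt (g l) + s\<bar> \<le> (C + \<alpha>\<^sup>2) / A\<^sup>2" by (simp add: add_divide_distrib)
    moreover have "\<bar>sqrt (g l) - s\<bar> * 1 \<le> \<bar>sqrt (g l) - s\<bar> * \<bar>sqrt (g l) + s\<bar>"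
    proof (intro mult_left_mono)
      have "sqrt (g l) \<ge> 0" using g(2) by simp
      with s show "1 \<le> \<bar>sqrt (g l) + s\<bar>" by linarith
    qed simp
    ultimately show ?thesis by (simp add: s_def A_def algebra_simps)
  qed
  then show ?thesis unfolding expands1_def using C(1) by (intro exI[of _ "C + \<alpha>\<^sup>2"]) auto
qed

section \<open>Moments of v = \<rho> / (l + n) under the index distribution\<close>

definition bessel_moment :: "nat \<Rightarrow> nat \<Rightarrow> real \<Rightarrow> real" where
  "bessel_moment n k \<rho> = bessel_mean n \<rho> (\<lambda>l. (\<rho> / real (l + n)) ^ k)"

text \<open>The correction that turns \<open>v\<^bsup>2j\<^esup>\<close>, \<open>v = \<rho> / (l+n)\<close>, into the quotient of the weights at \<open>l + j\<close>
  and \<open>l\<close>; the denominators are \<open>l + i\<close> and \<open>l + n - 2 + i\<close>.\<close>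
definition stein_factor :: "nat \<Rightarrow> nat \<Rightarrow> nat \<Rightarrow> real" where
  "stein_factor n j l = (\<Prod>i=1..j. (real (l + n) / (real (l + n) - (real n - real i))) * (real (l + n) / (real (l + n) - (2 - real i))))"

context
  fixes n :: nat
  assumes n2: "n \<ge> 2"
begin

lemma ratio_power_bounded:
  assumes "\<rho> > 0"
  shows "\<bar>(\<rho> / real (l + n)) ^ k\<bar> \<le> \<rho> ^ k"
proof -
  have "\<rho> / real (l + n) \<le> \<rho>" using assms n2 by (simp add: divide_le_eq mult_le_cancel_left1)
  moreover have "\<rho> / real (l + n) \<ge> 0" using assms by simp
  ultimately show ?thesis by (simp add: power_abs power_mono)
qed

lemma bessel_moment_0: "\<rho> > 0 \<Longrightarrow> bessel_moment n 0 \<rho> = 1"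
  by (simp add: bessel_moment_def bessel_mean_const)

lemma bessel_moment_nonneg:
  assumes "\<rho> > 0"
  shows "bessel_moment n k \<rho> \<ge> 0"
proof -
  have "bessel_mean n \<rho> (\<lambda>l. 0) \<le> bessel_moment n k \<rho>"
    unfolding bessel_moment_def
    by (rule bessel_mean_mono[OF assms _ ratio_power_bounded[OF assms], of _ 0]) (use assms in auto)
  then show ?thesis by (simp add: bessel_mean_const[OF assms])
qed

text \<open>First-order coefficients add under multiplication: the sum of (n - i) + (2 - i) over i =
  1, ..., j is j (n + 1 - j).\<close>

lemma expands1_stein_factor: "expands1 n (stein_factor n j) (real j * (real n + 1 - real j))"
proof (induction j)
  case 0
  show ?case using expands1_one by (simp add: stein_factor_def[abs_def])
next
  case (Suc j)
  have "expands1 n (\<lambda>l. stein_factor n j l * ((real (l + n) / (real (l + n) - (real n - real (Suc j)))) * (real (l + n) / (real (l + n) - (2 - real (Suc j))))))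
     (real j * (real n + 1 - real j) + ((real n - real (Suc j)) + (2 - real (Suc j))))"
    using n2 by (intro expands1_mult Suc expands1_shift) auto
  then show ?case by (simp add: stein_factor_def algebra_simps)
qed

lemma bessel_weight_shift:
  assumes "\<rho> > 0"
  shows "bessel_weight n \<rho> l * ((\<rho> / real (l + n)) ^ (2 * j) * stein_factor n j l) = bessel_weight n \<rho> (l + j)"
proof (induction j)
  case 0
  show ?case by (simp add: stein_factor_def)
next
  case (Suc j)
  define A where "A = real (l + n)"
  have A: "A > 0" using n2 by (simp add: A_def)
  have nz: "A - (real n - real (Suc j)) = real (l + Suc j)" "A - (2 - real (Suc j)) = real (l + j + n - 2 + 1)"
    using n2 by (auto simp: A_def)
  have sf: "stein_factor n (Suc j) l = stein_factor n j l * ((A / real (l + Suc j)) * (A / real (l + j + n - 2 + 1)))"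
    unfolding stein_factor_def A_def[symmetric] nz[symmetric] by simp
  have p: "(\<rho> / A) ^ (2 * Suc j) = (\<rho> / A) ^ (2 * j) * (\<rho> / A)\<^sup>2"
    by (simp add: power2_eq_square)
  have "bessel_weight n \<rho> l * ((\<rho> / A) ^ (2 * Suc j) * stein_factor n (Suc j) l)
    = (bessel_weight n \<rho> l * ((\<rho> / A) ^ (2 * j) * stein_factor n j l)) * ((\<rho> / A)\<^sup>2 * ((A / real (l + Suc j)) * (A / real (l + j + n - 2 + 1))))"
    unfolding sf p by (simp only: mult_ac)
  also have "(\<rho> / A)\<^sup>2 * ((A / real (l + Suc j)) * (A / real (l + j + n - 2 + 1))) = \<rho>\<^sup>2 / (real (l + Suc j) * real (l + j + n - 2 + 1))"
    using A by (simp add: power2_eq_square)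
  also have "bessel_weight n \<rho> l * ((\<rho> / A) ^ (2 * j) * stein_factor n j l) = bessel_weight n \<rho> (l + j)"
    using Suc by (simp add: A_def)
  also have "bessel_weight n \<rho> (l + j) * (\<rho>\<^sup>2 / (real (l + Suc j) * real (l + j + n - 2 + 1))) = bessel_weight n \<rho> (l + Suc j)"
  proof -
    have "l + Suc j + n - 2 = Suc (l + j + n - 2)" "l + Suc j = Suc (l + j)" using n2 by auto
    then show ?thesis by (simp add: bessel_weight_def power2_eq_square mult_ac)
  qed
  finally show ?case by (simp add: A_def)
qed

text \<open>After the shift the numerator is the total weight without its first j terms. The total
  is at least the j-th weight, whose power of \<rho> exceeds those of the missing terms by at least
  2.\<close>

lemma bessel_mean_stein:
  "(\<lambda>\<rho>. bessel_mean n \<rho> (\<lambda>l. (\<rho> / real (l + n)) ^ (2 * j) * stein_factor n j l) - 1) \<in> O[at_top](\<lambda>\<rho>. 1 / \<rho>\<^sup>2)"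
proof -
  define K where "K = (\<Sum>l<j. fact j * fact (j + n - 2) / (fact l * fact (l + n - 2)) :: real)"
  have "\<bar>bessel_mean n \<rho> (\<lambda>l. (\<rho> / real (l + n)) ^ (2 * j) * stein_factor n j l) - 1\<bar> \<le> K * (1 / \<rho>\<^sup>2)" if \<rho>: "\<rho> \<ge> 1" for \<rho>
  proof -
    have \<rho>0: "\<rho> > 0" using \<rho> by simp
    define W where "W = (\<Sum>l. bessel_weight n \<rho> l)"
    have W: "W > 0" unfolding W_def by (rule suminf_bessel_weight_pos[OF \<rho>0])
    have "bessel_mean n \<rho> (\<lambda>l. (\<rho> / real (l + n)) ^ (2 * j) * stein_factor n j l) = (\<Sum>l. bessel_weight n \<rho> (l + j)) / W"
      unfolding bessel_mean_def W_def by (simp only: bessel_weight_shift[OF \<rho>0])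
    also have "(\<Sum>l. bessel_weight n \<rho> (l + j)) = W - (\<Sum>l<j. bessel_weight n \<rho> l)"
      unfolding W_def by (rule suminf_minus_initial_segment[OF summable_bessel_weight[OF \<rho>0]])
    finally have "\<bar>bessel_mean n \<rho> (\<lambda>l. (\<rho> / real (l + n)) ^ (2 * j) * stein_factor n j l) - 1\<bar> = \<bar>(\<Sum>l<j. bessel_weight n \<rho> l) / W\<bar>"
      using W by (simp add: diff_divide_distrib)
    also have "\<dots> = (\<Sum>l<j. bessel_weight n \<rho> l) / W"
      using W bessel_weight_pos[OF \<rho>0] by (intro abs_of_nonneg divide_nonneg_pos sum_nonneg) (auto intro: less_imp_le)
    also have "\<dots> \<le> (\<Sum>l<j. bessel_weight n \<rho> l) / bessel_weight n \<rho> j"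
      using W bessel_weight_pos[OF \<rho>0] bessel_weight_le_suminf[OF \<rho>0, of n j]
      by (intro divide_left_mono sum_nonneg) (auto intro: less_imp_le simp: W_def)
    also have "\<dots> = (\<Sum>l<j. bessel_weight n \<rho> l / bessel_weight n \<rho> j)" by (rule sum_divide_distrib)
    also have "\<dots> \<le> (\<Sum>l<j. fact j * fact (j + n - 2) / (fact l * fact (l + n - 2)) * (1 / \<rho>\<^sup>2))"
    proof (rule sum_mono)
      fix l assume "l \<in> {..<j}"
      then have "\<rho> ^ (2 * l) * \<rho>\<^sup>2 \<le> \<rho> ^ (2 * j)"
        unfolding power_add[symmetric] using \<rho> by (intro power_increasing) auto
      then have "\<rho> ^ (2 * l) / \<rho> ^ (2 * j) \<le> 1 / \<rho>\<^sup>2" using \<rho>0 by (simp add: field_simps)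
      then have "fact j * fact (j + n - 2) / (fact l * fact (l + n - 2)) * (\<rho> ^ (2 * l) / \<rho> ^ (2 * j)) \<le> fact j * fact (j + n - 2) / (fact l * fact (l + n - 2)) * (1 / \<rho>\<^sup>2)"
        by (intro mult_left_mono) auto
      then show "bessel_weight n \<rho> l / bessel_weight n \<rho> j \<le> fact j * fact (j + n - 2) / (fact l * fact (l + n - 2)) * (1 / \<rho>\<^sup>2)"
        by (simp add: bessel_weight_def mult_ac)
    qed
    also have "\<dots> = K * (1 / \<rho>\<^sup>2)" unfolding K_def by (rule sum_distrib_right[symmetric])
    finally show ?thesis .
  qed
  then show ?thesis
    by (intro bigoI[of _ K] eventually_mono[OF eventually_ge_at_top[of 1]]) auto
qed

text \<open>The correcting factor is bounded below by a positive constant, so the moment is at most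
  a constant times a shifted mean that tends to 1.\<close>

lemma bessel_moment_even_bounded: "bessel_moment n (2 * j) \<in> O[at_top](\<lambda>_. 1)"
proof -
  obtain B where B: "\<And>l. \<bar>stein_factor n j l\<bar> \<le> B" using expands1_bounded[OF expands1_stein_factor] n2 by (metis One_nat_def Suc_leD numeral_2_eq_2)
  \<comment> \<open>Both denominators at step i are at most (1 + i)(l + n), so each pair of
    quotients is at least (1 + i)^(-2).\<close>
  define c where "c = (\<Prod>i=1..j. (1 + real i)\<^sup>2)"
  have c: "1 \<le> c * stein_factor n j l" for l
  proof -
    have "c * stein_factor n j l = (\<Prod>i=1..j. (1 + real i)\<^sup>2 * ((real (l + n) / (real (l + n) - (real n - real i))) * (real (l + n) / (real (l + n) - (2 - real i)))))"
      unfolding c_def stein_factor_def prod.distrib[symmetric] ..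
    also have "\<dots> \<ge> (\<Prod>i=1..j. 1)"
    proof (intro prod_mono conjI)
      fix i assume i: "i \<in> {1..j}"
      define A where "A = real (l + n)"
      have A: "A \<ge> 1" using n2 by (simp add: A_def)
      have d: "A - (real n - real i) = real l + real i" "A - (2 - real i) = real l + (real n - 2) + real i" by (auto simp: A_def)
      have iA: "real i * 1 \<le> real i * A" using A by (intro mult_left_mono) auto
      have "real l + real i > 0" "real l + (real n - 2) + real i > 0" using i n2 by auto
      moreover have "real l + real i \<le> (1 + real i) * A" "real l + (real n - 2) + real i \<le> (1 + real i) * A"
        using iA by (auto simp: A_def algebra_simps)
      ultimately have "1 \<le> (1 + real i) * A / (real l + real i)" "1 \<le> (1 + real i) * A / (real l + (real n - 2) + real i)"
        by (auto simp: le_divide_eq)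
      then have "1 * 1 \<le> ((1 + real i) * A / (real l + real i)) * ((1 + real i) * A / (real l + (real n - 2) + real i))"
        by (intro mult_mono) auto
      then show "1 \<le> (1 + real i)\<^sup>2 * ((real (l + n) / (real (l + n) - (real n - real i))) * (real (l + n) / (real (l + n) - (2 - real i))))"
        unfolding A_def[symmetric] d by (simp add: power2_eq_square mult_ac)
    qed auto
    finally show ?thesis by simp
  qed
  have c0: "c \<ge> 0" unfolding c_def by (intro prod_nonneg) auto
  have le: "\<bar>bessel_moment n (2 * j) \<rho>\<bar> \<le> \<bar>c * bessel_mean n \<rho> (\<lambda>l. (\<rho> / real (l + n)) ^ (2 * j) * stein_factor n j l)\<bar>" if \<rho>: "\<rho> \<ge> 1" for \<rho>
  proof -
    have \<rho>0: "\<rho> > 0" using \<rho> by simp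
    have Bd: "\<bar>(\<rho> / real (l + n)) ^ (2 * j) * stein_factor n j l\<bar> \<le> \<rho> ^ (2 * j) * B" for l
      unfolding abs_mult using ratio_power_bounded[OF \<rho>0] B \<rho>0 by (intro mult_mono) auto
    have "bessel_moment n (2 * j) \<rho> \<le> bessel_mean n \<rho> (\<lambda>l. c * ((\<rho> / real (l + n)) ^ (2 * j) * stein_factor n j l))"
      unfolding bessel_moment_def
    proof (rule bessel_mean_mono[OF \<rho>0 ratio_power_bounded[OF \<rho>0]])
      show "\<bar>c * ((\<rho> / real (l + n)) ^ (2 * j) * stein_factor n j l)\<bar> \<le> c * (\<rho> ^ (2 * j) * B)" for l
        using Bd[of l] c0 by (subst abs_mult) (simp add: mult_left_mono)
      show "(\<rho> / real (l + n)) ^ (2 * j) \<le> c * ((\<rho> / real (l + n)) ^ (2 * j) * stein_factor n j l)" for l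
        using mult_left_mono[OF c[of l], of "(\<rho> / real (l + n)) ^ (2 * j)"] \<rho>0 by (simp add: mult_ac)
    qed
    also have "\<dots> = c * bessel_mean n \<rho> (\<lambda>l. (\<rho> / real (l + n)) ^ (2 * j) * stein_factor n j l)"
      by (rule bessel_mean_cmult[OF \<rho>0 Bd])
    finally show ?thesis using bessel_moment_nonneg[OF \<rho>0, of "2 * j"] by linarith
  qed
  have "(\<lambda>\<rho>. bessel_mean n \<rho> (\<lambda>l. (\<rho> / real (l + n)) ^ (2 * j) * stein_factor n j l) - 1) \<in> O[at_top](\<lambda>\<rho>. 1)"
    by (rule landau_o.big_trans[OF bessel_mean_stein]) (intro bigoI[of _ 1] eventually_mono[OF eventually_ge_at_top[of 1]], auto)
  then have "(\<lambda>\<rho>. (bessel_mean n \<rho> (\<lambda>l. (\<rho> / real (l + n)) ^ (2 * j) * stein_factor n j l) - 1) + 1) \<in> O[at_top](\<lambda>\<rho>. 1)"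
    by (rule sum_in_bigo) simp
  then have "(\<lambda>\<rho>. c * bessel_mean n \<rho> (\<lambda>l. (\<rho> / real (l + n)) ^ (2 * j) * stein_factor n j l)) \<in> O[at_top](\<lambda>\<rho>. 1)"
    by simp
  then show ?thesis
    by (rule landau_o.big_trans[rotated], intro landau_o.bigI[of 1] eventually_mono[OF eventually_ge_at_top[of 1]])
      (use le in auto)
qed

text \<open>Odd powers lie below the sum of the two neighbouring even ones, because v \<le> 1 +
  v^2.\<close>

lemma bessel_moment_bounded: "bessel_moment n k \<in> O[at_top](\<lambda>_. 1)"
proof (cases "even k")
  case True
  then show ?thesis using bessel_moment_even_bounded by (auto elim: evenE)
next
  case False
  then obtain j where k: "k = 2 * j + 1" by (auto elim: oddE)
  have le: "\<bar>bessel_moment n k \<rho>\<bar> \<le> \<bar>bessel_moment n (2 * j) \<rho> + bessel_moment n (2 * (j + 1)) \<rho>\<bar>" if "\<rho> \<ge> 1" for \<rho>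
  proof -
    have \<rho>0: "\<rho> > 0" using that by simp
    have "bessel_moment n k \<rho> \<le> bessel_mean n \<rho> (\<lambda>l. (\<rho> / real (l + n)) ^ (2 * j) + (\<rho> / real (l + n)) ^ (2 * (j + 1)))"
      unfolding bessel_moment_def
    proof (rule bessel_mean_mono[OF \<rho>0 ratio_power_bounded[OF \<rho>0]])
      show "\<bar>(\<rho> / real (l + n)) ^ (2 * j) + (\<rho> / real (l + n)) ^ (2 * (j + 1))\<bar> \<le> \<rho> ^ (2 * j) + \<rho> ^ (2 * (j + 1))" for l
        using ratio_power_bounded[OF \<rho>0, of l "2 * j"] ratio_power_bounded[OF \<rho>0, of l "2 * (j + 1)"] by linarith
      fix l
      define v where "v = \<rho> / real (l + n)"
      have "v \<le> 1 + v\<^sup>2" using sum_squares_bound[of v 1] by (simp add: power2_eq_square) (smt (verit) zero_le_square)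
      then have "v ^ (2 * j) * v \<le> v ^ (2 * j) * (1 + v\<^sup>2)" by (intro mult_left_mono) auto
      then show "v ^ k \<le> v ^ (2 * j) + v ^ (2 * (j + 1))"
        by (simp add: k algebra_simps power_add power2_eq_square)
    qed
    also have "\<dots> = bessel_moment n (2 * j) \<rho> + bessel_moment n (2 * (j + 1)) \<rho>"
      unfolding bessel_moment_def by (rule bessel_mean_add[OF \<rho>0 ratio_power_bounded[OF \<rho>0] ratio_power_bounded[OF \<rho>0]])
    finally show ?thesis using bessel_moment_nonneg[OF \<rho>0, of k] by linarith
  qed
  have "(\<lambda>\<rho>. bessel_moment n (2 * j) \<rho> + bessel_moment n (2 * (j + 1)) \<rho>) \<in> O[at_top](\<lambda>_. 1)"
    by (intro sum_in_bigo bessel_moment_even_bounded)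
  then show ?thesis
    by (rule landau_o.big_trans[rotated], intro landau_o.bigI[of 1] eventually_mono[OF eventually_ge_at_top[of 1]])
      (use le in auto)
qed

text \<open>Since 1/(l+n) = v/\<rho>, each order in 1/(l+n) becomes one order in 1/\<rho> and raises
  the moment by one. The error involves moment k + 2, which is bounded.\<close>

lemma bessel_mean_expands1:
  assumes g: "expands1 n g \<alpha>"
  shows "(\<lambda>\<rho>. bessel_mean n \<rho> (\<lambda>l. (\<rho> / real (l + n)) ^ k * g l) - (bessel_moment n k \<rho> + \<alpha> / \<rho> * bessel_moment n (Suc k) \<rho>))
     \<in> O[at_top](\<lambda>\<rho>. 1 / \<rho>\<^sup>2)"
proof -
  obtain C where C: "C \<ge> 0" "\<And>l. \<bar>g l - 1 - \<alpha> / real (l + n)\<bar> \<le> C / real (l + n) ^ 2"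
    using g by (auto simp: expands1_def)
  obtain B where B: "\<And>l. \<bar>g l\<bar> \<le> B" using expands1_bounded[OF g] n2 by (metis One_nat_def Suc_leD numeral_2_eq_2)
  have le: "\<bar>bessel_mean n \<rho> (\<lambda>l. (\<rho> / real (l + n)) ^ k * g l) - (bessel_moment n k \<rho> + \<alpha> / \<rho> * bessel_moment n (Suc k) \<rho>)\<bar>
      \<le> C * \<bar>bessel_moment n (k + 2) \<rho> * (1 / \<rho>\<^sup>2)\<bar>" if \<rho>: "\<rho> \<ge> 1" for \<rho>
  proof -
    have \<rho>0: "\<rho> > 0" using \<rho> by simp
    define v where "v l = \<rho> / real (l + n)" for l
    have vb: "\<bar>v l ^ i\<bar> \<le> \<rho> ^ i" for l i unfolding v_def by (rule ratio_power_bounded[OF \<rho>0])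
    have b1: "\<bar>v l ^ k * g l\<bar> \<le> \<rho> ^ k * B" for l
      unfolding abs_mult using vb B \<rho>0 by (intro mult_mono) auto
    have b2: "\<bar>(\<alpha> / \<rho>) * v l ^ Suc k\<bar> \<le> \<bar>\<alpha> / \<rho>\<bar> * \<rho> ^ Suc k" for l
      unfolding abs_mult[of "\<alpha> / \<rho>"] by (intro mult_left_mono vb abs_ge_zero)
    have b3: "\<bar>v l ^ k + (\<alpha> / \<rho>) * v l ^ Suc k\<bar> \<le> \<rho> ^ k + \<bar>\<alpha> / \<rho>\<bar> * \<rho> ^ Suc k" for l
      using vb[of l k] b2[of l] by linarith
    have b4: "\<bar>-1 * (v l ^ k + (\<alpha> / \<rho>) * v l ^ Suc k)\<bar> \<le> \<rho> ^ k + \<bar>\<alpha> / \<rho>\<bar> * \<rho> ^ Suc k" for l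
      using b3[of l] by simp
    have b5: "\<bar>v l ^ k * g l + -1 * (v l ^ k + (\<alpha> / \<rho>) * v l ^ Suc k)\<bar> \<le> \<rho> ^ k * B + (\<rho> ^ k + \<bar>\<alpha> / \<rho>\<bar> * \<rho> ^ Suc k)" for l
      using b1[of l] b4[of l] by linarith
    have b6: "\<bar>(C / \<rho>\<^sup>2) * v l ^ (k + 2)\<bar> \<le> \<bar>C / \<rho>\<^sup>2\<bar> * \<rho> ^ (k + 2)" for l
      unfolding abs_mult[of "C / \<rho>\<^sup>2"] by (intro mult_left_mono vb abs_ge_zero)
    have "bessel_mean n \<rho> (\<lambda>l. v l ^ k * g l) - (bessel_moment n k \<rho> + \<alpha> / \<rho> * bessel_moment n (Suc k) \<rho>)
       = bessel_mean n \<rho> (\<lambda>l. v l ^ k * g l + -1 * (v l ^ k + (\<alpha> / \<rho>) * v l ^ Suc k))"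
      unfolding bessel_moment_def v_def[symmetric]
        bessel_mean_add[OF \<rho>0 b1 b4] bessel_mean_cmult[OF \<rho>0 b3] bessel_mean_add[OF \<rho>0 vb b2] bessel_mean_cmult[OF \<rho>0 vb]
      by simp
    also have "\<bar>\<dots>\<bar> \<le> bessel_mean n \<rho> (\<lambda>l. (C / \<rho>\<^sup>2) * v l ^ (k + 2))"
    proof (rule bessel_mean_abs_le[OF \<rho>0 b5 b6])
      fix l
      define A where "A = real (l + n)"
      have A: "A > 0" using n2 by (simp add: A_def)
      have vA: "v l = \<rho> / A" by (simp add: v_def A_def)
      have "v l ^ k * g l + -1 * (v l ^ k + (\<alpha> / \<rho>) * v l ^ Suc k) = v l ^ k * (g l - 1 - \<alpha> / A)"
        using \<rho>0 by (simp add: vA algebra_simps)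
      also have "\<bar>\<dots>\<bar> \<le> v l ^ k * (C / A\<^sup>2)"
        unfolding abs_mult using C(2)[of l] A \<rho>0 by (intro mult_mono) (auto simp: A_def vA)
      also have "\<dots> = (C / \<rho>\<^sup>2) * v l ^ (k + 2)"
        using \<rho>0 by (simp add: vA power_add power_divide power2_eq_square mult_ac)
      finally show "\<bar>v l ^ k * g l + -1 * (v l ^ k + (\<alpha> / \<rho>) * v l ^ Suc k)\<bar> \<le> (C / \<rho>\<^sup>2) * v l ^ (k + 2)" .
    qed
    also have "\<dots> = (C / \<rho>\<^sup>2) * bessel_moment n (k + 2) \<rho>"
      unfolding bessel_mean_cmult[OF \<rho>0 vb] by (simp add: bessel_moment_def v_def)
    also have "\<dots> = C * \<bar>bessel_moment n (k + 2) \<rho> * (1 / \<rho>\<^sup>2)\<bar>"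
      using bessel_moment_nonneg[OF \<rho>0, of "k + 2"] by (simp add: abs_mult)
    finally show ?thesis by (simp add: v_def)
  qed
  have "(\<lambda>\<rho>. bessel_mean n \<rho> (\<lambda>l. (\<rho> / real (l + n)) ^ k * g l) - (bessel_moment n k \<rho> + \<alpha> / \<rho> * bessel_moment n (Suc k) \<rho>))
     \<in> O[at_top](\<lambda>\<rho>. bessel_moment n (k + 2) \<rho> * (1 / \<rho>\<^sup>2))"
    by (intro bigoI[of _ C] eventually_mono[OF eventually_ge_at_top[of 1]]) (use le in auto)
  also have "(\<lambda>\<rho>. bessel_moment n (k + 2) \<rho> * (1 / \<rho>\<^sup>2)) \<in> O[at_top](\<lambda>\<rho>. 1 * (1 / \<rho>\<^sup>2))"
    by (intro landau_o.big.mult bessel_moment_bounded landau_o.big_refl)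
  finally show ?thesis by simp
qed

text \<open>Two evaluations of the same mean: shifting gives 1, expanding the correction gives an
  even moment plus a multiple of the next odd one.\<close>

lemma bessel_moment_even_Suc:
  "(\<lambda>\<rho>. bessel_moment n (2 * j) \<rho> + real j * (real n + 1 - real j) / \<rho> * bessel_moment n (Suc (2 * j)) \<rho> - 1)
     \<in> O[at_top](\<lambda>\<rho>. 1 / \<rho>\<^sup>2)"
  using sum_in_bigo(2)[OF bessel_mean_stein[of j] bessel_mean_expands1[OF expands1_stein_factor, of "2 * j" j]]
  by simp

lemma inverse_square_bigo: "(\<lambda>\<rho>::real. 1 / \<rho>\<^sup>2) \<in> O[at_top](\<lambda>\<rho>. 1 / \<rho>)"
  by (intro bigoI[of _ 1] eventually_mono[OF eventually_ge_at_top[of 1]])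
    (auto simp: divide_simps power2_eq_square mult_le_cancel_left1)

lemma bessel_moment_even_1: "(\<lambda>\<rho>. bessel_moment n (2 * j) \<rho> - 1) \<in> O[at_top](\<lambda>\<rho>. 1 / \<rho>)"
proof -
  have 1: "(\<lambda>\<rho>. bessel_moment n (2 * j) \<rho> + real j * (real n + 1 - real j) / \<rho> * bessel_moment n (Suc (2 * j)) \<rho> - 1) \<in> O[at_top](\<lambda>\<rho>. 1 / \<rho>)"
    by (rule landau_o.big_trans[OF bessel_moment_even_Suc inverse_square_bigo])
  have "(\<lambda>\<rho>. real j * (real n + 1 - real j) * ((1 / \<rho>) * bessel_moment n (Suc (2 * j)) \<rho>)) \<in> O[at_top](\<lambda>\<rho>. 1 * ((1 / \<rho>) * 1))"
    by (intro landau_o.big.mult landau_o.big_refl bessel_moment_bounded) simp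
  from sum_in_bigo(2)[OF 1 this[simplified]] show ?thesis by (simp add: algebra_simps)
qed

text \<open>Squeezed between even moments, as (3 v^2 - v^4)/2 \<le> v \<le> (1 + v^2)/2 for v \<ge>
  0. Both bounds touch v to first order at v = 1, but their second-order gap limits the result to
  O(1/\<rho>).\<close>

lemma bessel_moment_odd_1: "(\<lambda>\<rho>. bessel_moment n (2 * j + 1) \<rho> - 1) \<in> O[at_top](\<lambda>\<rho>. 1 / \<rho>)"
proof -
  define L where "L \<rho> = 3/2 * (bessel_moment n (2 * (j + 1)) \<rho> - 1) + (-1/2) * (bessel_moment n (2 * (j + 2)) \<rho> - 1)" for \<rho>
  define U where "U \<rho> = 1/2 * ((bessel_moment n (2 * j) \<rho> - 1) + (bessel_moment n (2 * (j + 1)) \<rho> - 1))" for \<rho>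
  have LU: "L \<rho> \<le> bessel_moment n (2 * j + 1) \<rho> - 1 \<and> bessel_moment n (2 * j + 1) \<rho> - 1 \<le> U \<rho>" if "\<rho> \<ge> 1" for \<rho>
  proof -
    have \<rho>0: "\<rho> > 0" using that by simp
    define v where "v l = \<rho> / real (l + n)" for l
    have v0: "v l \<ge> 0" for l using \<rho>0 by (simp add: v_def)
    have vb: "\<bar>v l ^ i\<bar> \<le> \<rho> ^ i" for l i unfolding v_def by (rule ratio_power_bounded[OF \<rho>0])
    have cb: "\<bar>c * v l ^ i\<bar> \<le> \<bar>c\<bar> * \<rho> ^ i" for c l i
      unfolding abs_mult[of c] by (intro mult_left_mono vb abs_ge_zero)
    have ab: "\<bar>c * v l ^ i + d * v l ^ k\<bar> \<le> \<bar>c\<bar> * \<rho> ^ i + \<bar>d\<bar> * \<rho> ^ k" for c d l i k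
      using cb[of c l i] cb[of d l k] by linarith
    have lin: "bessel_mean n \<rho> (\<lambda>l. c * v l ^ i + d * v l ^ k) = c * bessel_moment n i \<rho> + d * bessel_moment n k \<rho>" for c d i k
      unfolding bessel_mean_add[OF \<rho>0 cb cb] bessel_mean_cmult[OF \<rho>0 vb] by (simp add: bessel_moment_def v_def)
    have "bessel_moment n (2 * j + 1) \<rho> \<le> bessel_mean n \<rho> (\<lambda>l. (1/2) * v l ^ (2 * j) + (1/2) * v l ^ (2 * (j + 1)))"
      unfolding bessel_moment_def v_def[symmetric]
    proof (rule bessel_mean_mono[OF \<rho>0 vb ab])
      fix l
      have "v l * 2 \<le> 1 + (v l)\<^sup>2" using zero_le_power2[of "v l - 1"] by (simp add: power2_eq_square algebra_simps)
      then have "v l ^ (2 * j) * (v l * 2) \<le> v l ^ (2 * j) * (1 + (v l)\<^sup>2)" using v0 by (intro mult_left_mono) auto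
      then show "v l ^ (2 * j + 1) \<le> (1/2) * v l ^ (2 * j) + (1/2) * v l ^ (2 * (j + 1))"
        by (simp add: algebra_simps power2_eq_square)
    qed
    moreover have "bessel_mean n \<rho> (\<lambda>l. (3/2) * v l ^ (2 * (j + 1)) + (-1/2) * v l ^ (2 * (j + 2))) \<le> bessel_moment n (2 * j + 1) \<rho>"
      unfolding bessel_moment_def v_def[symmetric]
    proof (rule bessel_mean_mono[OF \<rho>0 ab vb])
      fix l
      \<comment> \<open>This product equals v^4 - 3 v^2 + 2 v, which is the lower bound of the
        squeeze.\<close>
      have "0 \<le> v l * (v l - 1)\<^sup>2 * (v l + 2)" using v0[of l] by (intro mult_nonneg_nonneg) auto
      then have "3 * (v l)\<^sup>2 - (v l) ^ 4 \<le> 2 * v l" by (simp add: power2_eq_square power4_eq_xxxx algebra_simps)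
      then have "v l ^ (2 * j) * (3 * (v l)\<^sup>2 - (v l) ^ 4) \<le> v l ^ (2 * j) * (2 * v l)" using v0 by (intro mult_left_mono) auto
      then show "(3/2) * v l ^ (2 * (j + 1)) + (-1/2) * v l ^ (2 * (j + 2)) \<le> v l ^ (2 * j + 1)"
        by (simp add: algebra_simps power2_eq_square power4_eq_xxxx)
    qed
    ultimately show ?thesis unfolding lin L_def U_def by (simp add: field_simps)
  qed
  have "(\<lambda>\<rho>. \<bar>L \<rho>\<bar> + \<bar>U \<rho>\<bar>) \<in> O[at_top](\<lambda>\<rho>. 1 / \<rho>)"
  proof -
    have "L \<in> O[at_top](\<lambda>\<rho>. 1 / \<rho>)" unfolding L_def
      by (intro sum_in_bigo landau_o.big.cmult_in_iff[THEN iffD2] bessel_moment_even_1) auto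
    moreover have "U \<in> O[at_top](\<lambda>\<rho>. 1 / \<rho>)" unfolding U_def
      by (intro sum_in_bigo landau_o.big.cmult_in_iff[THEN iffD2] bessel_moment_even_1) auto
    ultimately show ?thesis by (intro sum_in_bigo) auto
  qed
  moreover have "(\<lambda>\<rho>. bessel_moment n (2 * j + 1) \<rho> - 1) \<in> O[at_top](\<lambda>\<rho>. \<bar>L \<rho>\<bar> + \<bar>U \<rho>\<bar>)"
    by (intro landau_o.bigI[of 1] eventually_mono[OF eventually_ge_at_top[of 1]]) (use LU in \<open>fastforce+\<close>)
  ultimately show ?thesis using landau_o.big_trans by blast
qed

text \<open>A bootstrap: the odd moment in \<open>bessel_moment_even_Suc\<close> carries a factor
  1/\<rho>, so knowing it up to O(1/\<rho>) yields the even moments up to O(1/\<rho>^2).\<close>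

lemma bessel_moment_even_2:
  "(\<lambda>\<rho>. bessel_moment n (2 * j) \<rho> - (1 - real j * (real n + 1 - real j) / \<rho>)) \<in> O[at_top](\<lambda>\<rho>. 1 / \<rho>\<^sup>2)"
proof -
  have "(\<lambda>\<rho>. real j * (real n + 1 - real j) * ((1 / \<rho>) * (bessel_moment n (2 * j + 1) \<rho> - 1))) \<in> O[at_top](\<lambda>\<rho>. 1 * ((1 / \<rho>) * (1 / \<rho>)))"
    by (intro landau_o.big.mult landau_o.big_refl bessel_moment_odd_1) simp
  then have "(\<lambda>\<rho>. real j * (real n + 1 - real j) * ((1 / \<rho>) * (bessel_moment n (2 * j + 1) \<rho> - 1))) \<in> O[at_top](\<lambda>\<rho>. 1 / \<rho>\<^sup>2)"
    by (simp add: power2_eq_square)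
  from sum_in_bigo(2)[OF bessel_moment_even_Suc[of j] this]
  show ?thesis by (simp add: algebra_simps power2_eq_square diff_divide_distrib add_divide_distrib)
qed

text \<open>The polynomial is the Taylor polynomial of \<open>sqrt (1 + x)\<close> at \<open>x = v\<^sup>2 - 1\<close>.\<close>
lemma sqrt_taylor_bound:
  fixes v :: real
  assumes "v \<ge> 0"
  shows "\<bar>v - (5/16 + 15/16 * v ^ 2 - 5/16 * v ^ 4 + 1/16 * v ^ 6)\<bar> \<le> 5/16 * (v\<^sup>2 - 1) ^ 4"
proof -
  have eq: "v - (5/16 + 15/16 * v ^ 2 - 5/16 * v ^ 4 + 1/16 * v ^ 6) = - ((v - 1) ^ 4 * ((v\<^sup>2 + 4 * v + 5) / 16))"
    by (simp add: eval_nat_numeral algebra_simps)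
  have "0 \<le> v\<^sup>2 + 4 * v + 5" using assms by simp
  then have "\<bar>v - (5/16 + 15/16 * v ^ 2 - 5/16 * v ^ 4 + 1/16 * v ^ 6)\<bar> = (v - 1) ^ 4 * ((v\<^sup>2 + 4 * v + 5) / 16)"
    unfolding eq abs_minus_cancel by (intro abs_of_nonneg mult_nonneg_nonneg) auto
  also have "\<dots> \<le> (v - 1) ^ 4 * (5 / 16 * (v + 1) ^ 4)"
  proof (rule mult_left_mono)
    have "v\<^sup>2 + 4 * v + 5 \<le> 5 * (v + 1)\<^sup>2" using assms by (simp add: power2_eq_square algebra_simps)
    also have "(v + 1)\<^sup>2 \<le> (v + 1) ^ 4" using assms by (intro power_increasing) auto
    finally show "(v\<^sup>2 + 4 * v + 5) / 16 \<le> 5 / 16 * (v + 1) ^ 4" by simp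
  qed simp
  also have "\<dots> = 5/16 * ((v - 1) * (v + 1)) ^ 4" by (simp add: power_mult_distrib)
  also have "(v - 1) * (v + 1) = v\<^sup>2 - 1" by (simp add: power2_eq_square algebra_simps)
  finally show ?thesis .
qed

text \<open>The mean of the Taylor error is a fourth difference in j of the even moments. Their
  1/\<rho> coefficients j (n + 1 - j) are quadratic in j, so this difference annihilates both known
  orders. With (v^2 - 1)^2 in its place the second difference would leave a 1/\<rho> term.\<close>

lemma bessel_moment_1:
  "(\<lambda>\<rho>. bessel_moment n 1 \<rho> - (1 - (2 * real n + 1) / 4 / \<rho>)) \<in> O[at_top](\<lambda>\<rho>. 1 / \<rho>\<^sup>2)"
proof -
  define m where "m = bessel_moment n"
  define \<alpha> where "\<alpha> j = j * (real n + 1 - j)" for j :: real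
  define P where "P \<rho> = 5/16 + 15/16 * m 2 \<rho> + (- 5/16) * m 4 \<rho> + 1/16 * m 6 \<rho>" for \<rho>
  define Q where "Q \<rho> = 5/16 * (m 8 \<rho> + (- 4) * m 6 \<rho> + 6 * m 4 \<rho> + (- 4) * m 2 \<rho> + 1)" for \<rho>
  have le: "\<bar>m 1 \<rho> - P \<rho>\<bar> \<le> Q \<rho>" if "\<rho> \<ge> 1" for \<rho>
  proof -
    have \<rho>0: "\<rho> > 0" using that by simp
    define v where "v l = \<rho> / real (l + n)" for l
    have v0: "v l \<ge> 0" for l using \<rho>0 by (simp add: v_def)
    have vb: "\<bar>v l ^ i\<bar> \<le> \<rho> ^ i" for l i unfolding v_def by (rule ratio_power_bounded[OF \<rho>0])
    have cb: "\<bar>c * v l ^ i\<bar> \<le> \<bar>c\<bar> * \<rho> ^ i" for c l i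
      unfolding abs_mult[of c] by (intro mult_left_mono vb abs_ge_zero)
    \<comment> \<open>Boundedness as a predicate, closed under sums, lets linearity of the mean be
      applied to long polynomials by rewriting.\<close>
    define bd where "bd f \<longleftrightarrow> (\<exists>B. \<forall>l. \<bar>f l :: real\<bar> \<le> B)" for f :: "nat \<Rightarrow> real"
    have bd0: "bd (\<lambda>l. c * v l ^ i)" for c i unfolding bd_def using cb by blast
    have bda: "bd (\<lambda>l. f l + g l)" if "bd f" "bd g" for f g
    proof -
      obtain B C where "\<And>l. \<bar>f l\<bar> \<le> B" "\<And>l. \<bar>g l\<bar> \<le> C" using \<open>bd f\<close> \<open>bd g\<close> by (auto simp: bd_def)
      then have "\<bar>f l + g l\<bar> \<le> B + C" for l by (meson abs_triangle_ineq add_mono order_trans)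
      then show ?thesis unfolding bd_def by blast
    qed
    have add: "bessel_mean n \<rho> (\<lambda>l. f l + g l) = bessel_mean n \<rho> f + bessel_mean n \<rho> g" if "bd f" "bd g" for f g
      using that bessel_mean_add[OF \<rho>0] unfolding bd_def by blast
    have cm: "bessel_mean n \<rho> (\<lambda>l. c * v l ^ i) = c * m i \<rho>" for c i
      using bessel_mean_cmult[OF \<rho>0 vb, where n=n and c=c] by (simp add: m_def bessel_moment_def v_def)
    have m0: "m 0 \<rho> = 1" by (simp add: m_def bessel_moment_0 \<rho>0)
    define f where "f l = 1 * v l ^ 1 + ((-5/16) * v l ^ 0 + ((-15/16) * v l ^ 2 + ((5/16) * v l ^ 4 + (-1/16) * v l ^ 6)))" for l
    define g where "g l = (5/16) * v l ^ 8 + ((-20/16) * v l ^ 6 + ((30/16) * v l ^ 4 + ((-20/16) * v l ^ 2 + (5/16) * v l ^ 0)))" for l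
    have "bd f" "bd g" unfolding f_def[abs_def] g_def[abs_def] by (intro bda bd0)+
    then obtain B C where B: "\<And>l. \<bar>f l\<bar> \<le> B" and C: "\<And>l. \<bar>g l\<bar> \<le> C" unfolding bd_def by blast
    have "\<bar>bessel_mean n \<rho> f\<bar> \<le> bessel_mean n \<rho> g"
    proof (rule bessel_mean_abs_le[OF \<rho>0 B C])
      fix l
      have "f l = v l - (5/16 + 15/16 * v l ^ 2 - 5/16 * v l ^ 4 + 1/16 * v l ^ 6)" by (simp add: f_def)
      moreover have "g l = 5/16 * ((v l)\<^sup>2 - 1) ^ 4" by (simp add: g_def eval_nat_numeral algebra_simps)
      ultimately show "\<bar>f l\<bar> \<le> g l" using sqrt_taylor_bound[OF v0[of l]] by simp
    qed
    moreover have "bessel_mean n \<rho> f = m 1 \<rho> - P \<rho>"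
      unfolding f_def[abs_def] by (simp only: add bda bd0 cm m0) (simp add: P_def)
    moreover have "bessel_mean n \<rho> g = Q \<rho>"
      unfolding g_def[abs_def] by (simp only: add bda bd0 cm m0) (simp add: Q_def algebra_simps)
    ultimately show ?thesis by simp
  qed
  have e: "(\<lambda>\<rho>. m 2 \<rho> - (1 - \<alpha> 1 / \<rho>)) \<in> O[at_top](\<lambda>\<rho>. 1 / \<rho>\<^sup>2)"
    "(\<lambda>\<rho>. m 4 \<rho> - (1 - \<alpha> 2 / \<rho>)) \<in> O[at_top](\<lambda>\<rho>. 1 / \<rho>\<^sup>2)"
    "(\<lambda>\<rho>. m 6 \<rho> - (1 - \<alpha> 3 / \<rho>)) \<in> O[at_top](\<lambda>\<rho>. 1 / \<rho>\<^sup>2)"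
    "(\<lambda>\<rho>. m 8 \<rho> - (1 - \<alpha> 4 / \<rho>)) \<in> O[at_top](\<lambda>\<rho>. 1 / \<rho>\<^sup>2)"
    using bessel_moment_even_2[of 1] bessel_moment_even_2[of 2] bessel_moment_even_2[of 3] bessel_moment_even_2[of 4]
    by (simp_all add: m_def \<alpha>_def)
  have Q: "Q \<in> O[at_top](\<lambda>\<rho>. 1 / \<rho>\<^sup>2)"
  proof -
    have "(\<lambda>\<rho>. 5/16 * ((m 8 \<rho> - (1 - \<alpha> 4 / \<rho>)) + ((- 4) * (m 6 \<rho> - (1 - \<alpha> 3 / \<rho>)) + (6 * (m 4 \<rho> - (1 - \<alpha> 2 / \<rho>)) + (- 4) * (m 2 \<rho> - (1 - \<alpha> 1 / \<rho>))))))
      \<in> O[at_top](\<lambda>\<rho>. 1 / \<rho>\<^sup>2)"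
      by (intro landau_o.big.cmult_in_iff[THEN iffD2] sum_in_bigo(1) e) auto
    moreover have "5/16 * ((m 8 \<rho> - (1 - \<alpha> 4 / \<rho>)) + ((- 4) * (m 6 \<rho> - (1 - \<alpha> 3 / \<rho>)) + (6 * (m 4 \<rho> - (1 - \<alpha> 2 / \<rho>)) + (- 4) * (m 2 \<rho> - (1 - \<alpha> 1 / \<rho>)))))
      = Q \<rho>" for \<rho>
    proof -
      \<comment> \<open>The fourth difference of \<alpha> at 0; its fifth term is \<alpha> 0 =
        0.\<close>
      have "\<alpha> 4 / \<rho> - 4 * (\<alpha> 3 / \<rho>) + 6 * (\<alpha> 2 / \<rho>) - 4 * (\<alpha> 1 / \<rho>) = (\<alpha> 4 - 4 * \<alpha> 3 + 6 * \<alpha> 2 - 4 * \<alpha> 1) / \<rho>"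
        by (simp add: add_divide_distrib diff_divide_distrib)
      also have "\<alpha> 4 - 4 * \<alpha> 3 + 6 * \<alpha> 2 - 4 * \<alpha> 1 = 0" by (simp add: \<alpha>_def algebra_simps)
      finally show ?thesis unfolding Q_def by simp
    qed
    ultimately show ?thesis by simp
  qed
  have P: "(\<lambda>\<rho>. P \<rho> - (1 - (2 * real n + 1) / 4 / \<rho>)) \<in> O[at_top](\<lambda>\<rho>. 1 / \<rho>\<^sup>2)"
  proof -
    have "(\<lambda>\<rho>. 15/16 * (m 2 \<rho> - (1 - \<alpha> 1 / \<rho>)) + ((- 5/16) * (m 4 \<rho> - (1 - \<alpha> 2 / \<rho>)) + 1/16 * (m 6 \<rho> - (1 - \<alpha> 3 / \<rho>))))
      \<in> O[at_top](\<lambda>\<rho>. 1 / \<rho>\<^sup>2)"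
      by (intro landau_o.big.cmult_in_iff[THEN iffD2] sum_in_bigo(1) e) auto
    moreover have "15/16 * (m 2 \<rho> - (1 - \<alpha> 1 / \<rho>)) + ((- 5/16) * (m 4 \<rho> - (1 - \<alpha> 2 / \<rho>)) + 1/16 * (m 6 \<rho> - (1 - \<alpha> 3 / \<rho>)))
      = P \<rho> - (1 - (2 * real n + 1) / 4 / \<rho>)" for \<rho>
    proof -
      have "15/16 * (\<alpha> 1 / \<rho>) - 5/16 * (\<alpha> 2 / \<rho>) + 1/16 * (\<alpha> 3 / \<rho>) = (15/16 * \<alpha> 1 - 5/16 * \<alpha> 2 + 1/16 * \<alpha> 3) / \<rho>"
        by (simp add: add_divide_distrib diff_divide_distrib)
      \<comment> \<open>(15 n - 10 (n - 1) + 3 (n - 2)) / 16 = (8 n + 4) / 16.\<close>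
      also have "15/16 * \<alpha> 1 - 5/16 * \<alpha> 2 + 1/16 * \<alpha> 3 = (2 * real n + 1) / 4" by (simp add: \<alpha>_def field_simps)
      finally have h: "15/16 * (\<alpha> 1 / \<rho>) - 5/16 * (\<alpha> 2 / \<rho>) + 1/16 * (\<alpha> 3 / \<rho>) = (2 * real n + 1) / 4 / \<rho>" .
      have "15/16 * (a - (1 - x)) + ((- 5/16) * (b - (1 - y)) + 1/16 * (c - (1 - w)))
          = 5/16 + 15/16 * a + (- 5/16) * b + 1/16 * c - (1 - (15/16 * x - 5/16 * y + 1/16 * w))" for a b c x y w :: real
        by (simp add: field_simps)
      then show ?thesis unfolding P_def h[symmetric] .
    qed
    ultimately show ?thesis by simp
  qed
  have "(\<lambda>\<rho>. m 1 \<rho> - P \<rho>) \<in> O[at_top](Q)"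
    by (intro landau_o.bigI[of 1] eventually_mono[OF eventually_ge_at_top[of 1]]) (use le in \<open>fastforce+\<close>)
  then have "(\<lambda>\<rho>. m 1 \<rho> - P \<rho>) \<in> O[at_top](\<lambda>\<rho>. 1 / \<rho>\<^sup>2)" using Q landau_o.big_trans by blast
  from sum_in_bigo(1)[OF this P] show ?thesis by (simp only: m_def add_diff_eq diff_add_cancel)
qed

lemma bessel_moment_1_div: "(\<lambda>\<rho>. c / \<rho> * bessel_moment n 1 \<rho> - c / \<rho>) \<in> O[at_top](\<lambda>\<rho>. 1 / \<rho>\<^sup>2)"
proof -
  have "(\<lambda>\<rho>. c * ((1 / \<rho>) * (bessel_moment n (2 * 0 + 1) \<rho> - 1))) \<in> O[at_top](\<lambda>\<rho>. 1 * ((1 / \<rho>) * (1 / \<rho>)))"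
    by (intro landau_o.big.mult landau_o.big_refl bessel_moment_odd_1) simp
  then show ?thesis by (simp add: algebra_simps power2_eq_square)
qed

text \<open>Here (l+1)/(l+n) = 1 - (n-1)/(l+n) exactly, so only the leading order of the first
  moment enters. This will be the mean of |\<zeta>|^2.\<close>

lemma bessel_mean_modulus:
  "(\<lambda>\<rho>. bessel_mean n \<rho> (\<lambda>l. real (l + 1) / real (l + n)) - (1 - (real n - 1) / \<rho>)) \<in> O[at_top](\<lambda>\<rho>. 1 / \<rho>\<^sup>2)"
proof -
  have "bessel_mean n \<rho> (\<lambda>l. real (l + 1) / real (l + n)) - (1 - (real n - 1) / \<rho>)
    = (real n - 1) / \<rho> - (real n - 1) / \<rho> * bessel_moment n 1 \<rho>" if \<rho>: "\<rho> > 0" for \<rho>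
  proof -
    have eq: "real (l + 1) / real (l + n) = 1 + (- (real n - 1) / \<rho>) * (\<rho> / real (l + n)) ^ 1" for l
      using \<rho> n2 by (simp add: divide_simps)
    have b: "\<bar>(- (real n - 1) / \<rho>) * (\<rho> / real (l + n)) ^ 1\<bar> \<le> \<bar>- (real n - 1) / \<rho>\<bar> * \<rho> ^ 1" for l
      unfolding abs_mult[of "- (real n - 1) / \<rho>"] by (intro mult_left_mono ratio_power_bounded[OF \<rho>] abs_ge_zero)
    have "bessel_mean n \<rho> (\<lambda>l. 1 + (- (real n - 1) / \<rho>) * (\<rho> / real (l + n)) ^ 1)
        = bessel_mean n \<rho> (\<lambda>l. 1) + bessel_mean n \<rho> (\<lambda>l. (- (real n - 1) / \<rho>) * (\<rho> / real (l + n)) ^ 1)"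
      by (rule bessel_mean_add[OF \<rho> _ b, of _ 1]) simp
    also have "\<dots> = 1 + (- (real n - 1) / \<rho>) * bessel_moment n 1 \<rho>"
      by (simp only: bessel_mean_const[OF \<rho>] bessel_mean_cmult[OF \<rho> ratio_power_bounded[OF \<rho>]] bessel_moment_def)
    finally have "bessel_mean n \<rho> (\<lambda>l. real (l + 1) / real (l + n)) = 1 + (- (real n - 1) / \<rho>) * bessel_moment n 1 \<rho>"
      by (simp only: eq)
    then show ?thesis by (simp add: algebra_simps diff_divide_distrib)
  qed
  then have ev: "\<forall>\<^sub>F \<rho> in at_top. bessel_mean n \<rho> (\<lambda>l. real (l + 1) / real (l + n)) - (1 - (real n - 1) / \<rho>)
      = - ((real n - 1) / \<rho> * bessel_moment n 1 \<rho> - (real n - 1) / \<rho>)"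
    by (intro eventually_mono[OF eventually_gt_at_top[of 0]]) simp
  show ?thesis
    by (rule landau_o.big.in_cong[OF ev, THEN iffD2, OF landau_o.big.uminus_in_iff[THEN iffD2, OF bessel_moment_1_div]])
qed

text \<open>The root of A/(A - 1), with A = l + n, adds 1/(2 \<rho>) to the first moment of v,
  turning (2n+1)/4 into (2n-1)/4. This will be the mean of \<zeta>.\<close>

lemma bessel_mean_first:
  "(\<lambda>\<rho>. bessel_mean n \<rho> (\<lambda>l. \<rho> / sqrt (real (l + n - 1) * real (l + n))) - (1 - (2 * real n - 1) / 4 / \<rho>)) \<in> O[at_top](\<lambda>\<rho>. 1 / \<rho>\<^sup>2)"
proof -
  define g where "g l = sqrt (real (l + n) / (real (l + n) - 1))" for l
  have g: "expands1 n g (1/2)"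
    unfolding g_def[abs_def] using n2 by (intro expands1_sqrt expands1_shift) auto
  have eq: "\<rho> / sqrt (real (l + n - 1) * real (l + n)) = (\<rho> / real (l + n)) ^ 1 * g l" for l \<rho>
  proof -
    define A where "A = real (l + n)"
    have A: "A > 1" using n2 by (simp add: A_def)
    have "real (l + n - 1) = A - 1" using n2 by (simp add: A_def)
    moreover have "sqrt (A / (A - 1)) = A / sqrt ((A - 1) * A)"
      using A by (simp add: real_sqrt_divide real_sqrt_mult divide_simps)
    ultimately show ?thesis unfolding g_def A_def[symmetric] using A by simp
  qed
  have a: "(\<lambda>\<rho>. bessel_mean n \<rho> (\<lambda>l. \<rho> / sqrt (real (l + n - 1) * real (l + n))) - (bessel_moment n 1 \<rho> + (1/2) / \<rho> * bessel_moment n 2 \<rho>)) \<in> O[at_top](\<lambda>\<rho>. 1 / \<rho>\<^sup>2)"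
    using bessel_mean_expands1[OF g, of 1] unfolding eq by (simp add: numeral_2_eq_2)
  have "(\<lambda>\<rho>. (1/2) * ((1 / \<rho>) * (bessel_moment n (2 * 1) \<rho> - 1))) \<in> O[at_top](\<lambda>\<rho>. 1 * ((1 / \<rho>) * (1 / \<rho>)))"
    by (intro landau_o.big.mult landau_o.big_refl bessel_moment_even_1) simp
  then have b: "(\<lambda>\<rho>. (1/2) * ((1 / \<rho>) * (bessel_moment n 2 \<rho> - 1))) \<in> O[at_top](\<lambda>\<rho>. 1 / \<rho>\<^sup>2)"
    by (simp add: power2_eq_square)
  have "(x - (y + (1/2) / r * w)) + ((y - (1 - (2 * N + 1) / 4 / r)) + (1/2) * ((1 / r) * (w - 1))) = x - (1 - (2 * N - 1) / 4 / r)" for x y w r N :: real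
    by (cases "r = 0") (simp_all add: field_simps)
  with sum_in_bigo(1)[OF a sum_in_bigo(1)[OF bessel_moment_1 b]] show ?thesis by (simp only:)
qed

text \<open>The shifts 1 and -1 under the root cancel to first order, so the second moment of v is
  left unchanged. This will be the mean of \<zeta>^2.\<close>

lemma bessel_mean_second:
  "(\<lambda>\<rho>. bessel_mean n \<rho> (\<lambda>l. \<rho>\<^sup>2 / (real (l + n) * sqrt (real (l + n - 1) * real (l + n + 1)))) - (1 - real n / \<rho>)) \<in> O[at_top](\<lambda>\<rho>. 1 / \<rho>\<^sup>2)"
proof -
  define g where "g l = sqrt (real (l + n) / (real (l + n) - 1) * (real (l + n) / (real (l + n) - (- 1))))" for l
  have "expands1 n g ((1 + (- 1)) / 2)"
    unfolding g_def[abs_def] using n2 by (intro expands1_sqrt expands1_mult expands1_shift) auto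
  then have g: "expands1 n g 0" by simp
  have eq: "\<rho>\<^sup>2 / (real (l + n) * sqrt (real (l + n - 1) * real (l + n + 1))) = (\<rho> / real (l + n)) ^ 2 * g l" for l \<rho>
  proof -
    define A where "A = real (l + n)"
    have A: "A > 1" using n2 by (simp add: A_def)
    have "real (l + n - 1) = A - 1" "real (l + n + 1) = A + 1" using n2 by (auto simp: A_def)
    moreover have "sqrt (A / (A - 1) * (A / (A - (- 1)))) = A / sqrt ((A - 1) * (A + 1))"
      using A by (simp add: real_sqrt_divide)
    ultimately show ?thesis unfolding g_def A_def[symmetric] using A by (simp add: power2_eq_square)
  qed
  have a: "(\<lambda>\<rho>. bessel_mean n \<rho> (\<lambda>l. \<rho>\<^sup>2 / (real (l + n) * sqrt (real (l + n - 1) * real (l + n + 1)))) - bessel_moment n 2 \<rho>) \<in> O[at_top](\<lambda>\<rho>. 1 / \<rho>\<^sup>2)"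
    using bessel_mean_expands1[OF g, of 2] unfolding eq by simp
  have b: "(\<lambda>\<rho>. bessel_moment n 2 \<rho> - (1 - real n / \<rho>)) \<in> O[at_top](\<lambda>\<rho>. 1 / \<rho>\<^sup>2)"
    using bessel_moment_even_2[of 1] by simp
  from sum_in_bigo(1)[OF a b] show ?thesis by (simp only: add_diff_eq diff_add_cancel)
qed

end

section \<open>The Berezin transform as a mean on the sphere\<close>

text \<open>Powers of \<zeta> are orthogonal, so the l-th term of the first series meets only index
  l + (i - j) of the second. The series are exchanged with the integral one at a time, first the
  conjugated one.\<close>

lemma power_series_inner_sums:
  fixes u :: "complex^'n::finite"
  assumes a: "entire_coeffs a" and b: "entire_coeffs b" and u: "norm u = 1" and ij: "j \<le> i"
  shows "(\<lambda>l. a l * (cnj (b (l + (i - j))) * of_real (sphere_moment CARD('n) (l + i)))) sums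
    (LINT x|sphere_measure. herm_inner x u ^ i * (\<Sum>l. a l * herm_inner x u ^ l) *
       cnj (herm_inner x u ^ j * (\<Sum>l. b l * herm_inner x u ^ l)))"
proof -
  define B where "B c = (\<Sum>l. b l * c ^ l)" for c
  have cB: "continuous_on S B" for S unfolding B_def[abs_def] by (rule continuous_on_entire_series[OF b])
  have sb: "summable (\<lambda>l. cmod (b l))" using b by (auto simp: entire_coeffs_def dest: spec[of _ 1])
  have sa: "summable (\<lambda>l. cmod (a l))" using a by (auto simp: entire_coeffs_def dest: spec[of _ 1])
  have hle: "cmod (herm_inner x u) \<le> 1" if "norm x = 1" for x using cmod_herm_inner_le[of x u] u that by simp
  have hle': "cmod (herm_inner x u) ^ l \<le> 1" if "norm x = 1" for x l using hle[OF that] by (simp add: power_le_one)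
  have mono: "(LINT x|sphere_measure. herm_inner x u ^ p * cnj (herm_inner x u) ^ q) = (if p = q then of_real (sphere_moment CARD('n) p) else 0)" for p q
    unfolding integral_sphere_moment[symmetric, of _ _ "undefined :: 'n"]
    by (rule integral_sphere_herm_inner[OF u, of "\<lambda>c. c ^ p * cnj c ^ q"]) (intro continuous_intros)
  have inner: "(LINT x|sphere_measure. herm_inner x u ^ (l + i) * cnj (herm_inner x u ^ j * B (herm_inner x u)))
      = cnj (b (l + (i - j))) * of_real (sphere_moment CARD('n) (l + i))" for l
  proof -
    have "(\<lambda>m. LINT x|sphere_measure. cnj (b m) * (herm_inner x u ^ (l + i) * cnj (herm_inner x u) ^ (m + j))) sums
      (LINT x|sphere_measure. (\<Sum>m. cnj (b m) * (herm_inner x u ^ (l + i) * cnj (herm_inner x u) ^ (m + j))))"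
    proof (rule sphere_sums_integral[OF _ _ sb])
      show "continuous_on (sphere 0 1) (\<lambda>x. cnj (b m) * (herm_inner x u ^ (l + i) * cnj (herm_inner x u) ^ (m + j)))" for m
        by (intro continuous_intros)
      show "cmod (cnj (b m) * (herm_inner x u ^ (l + i) * cnj (herm_inner x u) ^ (m + j))) \<le> cmod (b m)" if "norm x = 1" for m x
        using mult_mono[OF hle'[OF that, of "l + i"] hle'[OF that, of "m + j"]]
        by (simp add: norm_mult norm_power mult_left_le)
    qed
    moreover have "(\<Sum>m. cnj (b m) * (herm_inner x u ^ (l + i) * cnj (herm_inner x u) ^ (m + j)))
       = herm_inner x u ^ (l + i) * cnj (herm_inner x u ^ j * B (herm_inner x u))" for x
    proof -
      have "(\<lambda>m. b m * herm_inner x u ^ m) sums B (herm_inner x u)"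
        unfolding B_def by (rule summable_sums[OF entire_coeffs_summable[OF b]])
      from sums_mult[OF sums_cnj[THEN iffD2, OF this], of "herm_inner x u ^ (l + i) * cnj (herm_inner x u) ^ j"]
      have "(\<lambda>m. herm_inner x u ^ (l + i) * cnj (herm_inner x u) ^ j * cnj (b m * herm_inner x u ^ m)) sums (herm_inner x u ^ (l + i) * cnj (herm_inner x u) ^ j * cnj (B (herm_inner x u)))" .
      then show ?thesis by (simp add: sums_iff power_add mult_ac)
    qed
    moreover have "(LINT x|sphere_measure. cnj (b m) * (herm_inner x u ^ (l + i) * cnj (herm_inner x u) ^ (m + j)))
       = (if m = l + (i - j) then cnj (b m) * of_real (sphere_moment CARD('n) (l + i)) else 0)" for m
      using ij by (auto simp: mono)
    ultimately have "(\<lambda>m. if m = l + (i - j) then cnj (b m) * of_real (sphere_moment CARD('n) (l + i)) else 0) sums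
       (LINT x|sphere_measure. herm_inner x u ^ (l + i) * cnj (herm_inner x u ^ j * B (herm_inner x u)))"
      by (simp only:)
    from sums_unique2[OF this sums_single[of "l + (i - j)" "\<lambda>m. cnj (b m) * of_real (sphere_moment CARD('n) (l + i))"]]
    show ?thesis .
  qed
  obtain K where K: "\<And>c. c \<in> cball 0 1 \<Longrightarrow> cmod (B c) \<le> K"
    using compact_imp_bounded[OF compact_continuous_image[OF cB compact_cball[of 0 1]]] unfolding bounded_iff by (metis imageI)
  have K0: "K \<ge> 0" using K[of 0] norm_ge_zero order_trans by (metis centre_in_cball zero_le_one)
  have "(\<lambda>l. LINT x|sphere_measure. a l * (herm_inner x u ^ (l + i) * cnj (herm_inner x u ^ j * B (herm_inner x u)))) sums
    (LINT x|sphere_measure. (\<Sum>l. a l * (herm_inner x u ^ (l + i) * cnj (herm_inner x u ^ j * B (herm_inner x u)))))"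
  proof (rule sphere_sums_integral[OF _ _ summable_mult2[OF sa, of K]])
    show "continuous_on (sphere 0 1) (\<lambda>x. a l * (herm_inner x u ^ (l + i) * cnj (herm_inner x u ^ j * B (herm_inner x u))))" for l
      by (intro continuous_intros continuous_on_compose2[OF cB[of UNIV]]) auto
    show "cmod (a l * (herm_inner x u ^ (l + i) * cnj (herm_inner x u ^ j * B (herm_inner x u)))) \<le> cmod (a l) * K" if "norm x = 1" for l x
    proof -
      have "cmod (herm_inner x u) ^ (l + i) * (cmod (herm_inner x u) ^ j * cmod (B (herm_inner x u))) \<le> 1 * (1 * K)"
        using hle'[OF that] hle[OF that] K0 by (intro mult_mono K) auto
      then show ?thesis by (simp add: norm_mult norm_power mult_left_mono)
    qed
  qed
  moreover have "(\<Sum>l. a l * (herm_inner x u ^ (l + i) * cnj (herm_inner x u ^ j * B (herm_inner x u))))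
     = herm_inner x u ^ i * (\<Sum>l. a l * herm_inner x u ^ l) * cnj (herm_inner x u ^ j * B (herm_inner x u))" for x
    using sums_mult2[OF summable_sums[OF entire_coeffs_summable[OF a, of "herm_inner x u"]], of "herm_inner x u ^ i * cnj (herm_inner x u ^ j * B (herm_inner x u))"]
    by (simp add: sums_iff power_add mult_ac)
  moreover have "(LINT x|sphere_measure. a l * (herm_inner x u ^ (l + i) * cnj (herm_inner x u ^ j * B (herm_inner x u))))
    = a l * (cnj (b (l + (i - j))) * of_real (sphere_moment CARD('n) (l + i)))" for l
    by (simp add: inner del: complex_cnj_mult complex_cnj_power)
  ultimately show ?thesis unfolding B_def by (simp only:)
qed

text \<open>The two rising factorials overlap in all but one factor each, since (n-1)(n)_l = (n-1)_l
  (n-1+l).\<close>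

lemma kernel_coeff_minus_one:
  assumes "n \<ge> 2"
  shows "kernel_coeff n (-1) l = sqrt ((real l + real n - 1) / (real n - 1))"
proof -
  have "(real n - 1) * pochhammer (real n) l = pochhammer (real n - 1) l * (real n - 1 + real l)"
    using pochhammer_rec[of "real n - 1" l] pochhammer_Suc[of "real n - 1" l] by simp
  moreover have "pochhammer (real n - 1) l > 0" using assms by (intro pochhammer_pos) auto
  ultimately have "pochhammer (real n) l / pochhammer (real n - 1) l = (real l + real n - 1) / (real n - 1)"
    using assms by (simp add: field_simps)
  then show ?thesis by (simp add: kernel_coeff_def)
qed

definition coherent_coeff :: "nat \<Rightarrow> real \<Rightarrow> nat \<Rightarrow> real" where
  "coherent_coeff n \<rho> l = kernel_coeff n (-1) l / fact l * \<rho> ^ l"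

definition coherent_series :: "nat \<Rightarrow> real \<Rightarrow> complex \<Rightarrow> complex" where
  "coherent_series n \<rho> c = (\<Sum>l. of_real (coherent_coeff n \<rho> l) * c ^ l)"

lemma entire_coeffs_coherent:
  assumes "n \<ge> 2"
  shows "entire_coeffs (\<lambda>l. of_real (coherent_coeff n \<rho> l))"
  unfolding entire_coeffs_def
proof (intro allI impI)
  fix R :: real assume R: "R \<ge> 0"
  show "summable (\<lambda>l. cmod (of_real (coherent_coeff n \<rho> l)) * R ^ l)"
  proof (rule summable_comparison_test'[OF summable_exp[of "2 * \<bar>\<rho>\<bar> * R"]])
    fix l
    \<comment> \<open>Any geometric bound on the coefficients would do: sqrt (l + 1) \<le> 2^l
      leaves an exponential series as majorant.\<close>
    have "(real l + real n - 1) / (real n - 1) \<le> real l + 1"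
      using assms mult_left_mono[of 2 "real n" "real l"] by (simp add: divide_le_eq algebra_simps)
    also have "\<dots> \<le> 2 ^ l"
      using of_nat_mono[OF less_exp[of l, THEN Suc_leI], where 'a=real] by simp
    also have "(2::real) ^ l \<le> (2 ^ l)\<^sup>2" by (intro self_le_power) auto
    finally have "kernel_coeff n (-1) l \<le> 2 ^ l"
      unfolding kernel_coeff_minus_one[OF assms] by (intro real_le_lsqrt) auto
    moreover have "kernel_coeff n (-1) l \<ge> 0"
      unfolding kernel_coeff_minus_one[OF assms] using assms by simp
    ultimately have "\<bar>kernel_coeff n (-1) l\<bar> * (\<bar>\<rho>\<bar> ^ l * R ^ l) / fact l \<le> 2 ^ l * (\<bar>\<rho>\<bar> ^ l * R ^ l) / fact l"
      using R by (intro divide_right_mono mult_right_mono) auto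
    then show "norm (cmod (of_real (coherent_coeff n \<rho> l)) * R ^ l) \<le> inverse (fact l) * (2 * \<bar>\<rho>\<bar> * R) ^ l"
      using R unfolding norm_of_real coherent_coeff_def
      by (simp add: abs_mult abs_divide power_abs power_mult_distrib divide_inverse mult_ac)
  qed
qed

text \<open>For p = -1 the squared coefficient (l+n-1)/(n-1) removes the top factor of (n-1+l)! from
  the sphere moment and leaves the index weight. The other products, belonging to |\<zeta>|^2,
  \<zeta> and \<zeta>^2, are that weight times the quantity averaged above.\<close>

lemma coherent_coeff_products:
  assumes n: "n \<ge> 2" and \<rho>: "\<rho> > 0"
  shows "coherent_coeff n \<rho> l * (coherent_coeff n \<rho> l * sphere_moment n l) = fact (n - 2) * bessel_weight n \<rho> l"
    and "coherent_coeff n \<rho> l * (coherent_coeff n \<rho> l * sphere_moment n (l + 1))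
      = fact (n - 2) * (bessel_weight n \<rho> l * (real (l + 1) / real (l + n)))"
    and "coherent_coeff n \<rho> l * (coherent_coeff n \<rho> (l + 1) * sphere_moment n (l + 1))
      = fact (n - 2) * (bessel_weight n \<rho> l * (\<rho> / sqrt (real (l + n - 1) * real (l + n))))"
    and "coherent_coeff n \<rho> l * (coherent_coeff n \<rho> (l + 2) * sphere_moment n (l + 2))
      = fact (n - 2) * (bessel_weight n \<rho> l * (\<rho>\<^sup>2 / (real (l + n) * sqrt (real (l + n - 1) * real (l + n + 1)))))"
proof -
  obtain m where m: "n = m + 2" using n by (metis add.commute le_Suc_ex)
  \<comment> \<open>X = l + n - 1 and k = n - 1: the numerator and denominator under the root of the
    kernel coefficient.\<close>
  define X where "X = real l + real m + 1"
  define k where "k = real m + 1"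
  have X: "X > 0" and k: "k > 0" by (auto simp: X_def k_def)
  have fX: "fact (Suc (l + m)) = X * fact (l + m)" "fact (Suc (Suc (l + m))) = (X + 1) * (X * fact (l + m))"
     "fact (Suc (Suc (Suc (l + m)))) = (X + 2) * ((X + 1) * (X * fact (l + m)))" "fact (Suc m) = k * (fact m :: real)"
    by (simp_all add: X_def k_def)
  have kc: "kernel_coeff n (-1) l = sqrt X / sqrt k" "kernel_coeff n (-1) (l + 1) = sqrt (X + 1) / sqrt k"
    "kernel_coeff n (-1) (l + 2) = sqrt (X + 2) / sqrt k"
    unfolding kernel_coeff_minus_one[OF n] by (simp_all add: m X_def k_def real_sqrt_divide add_ac)
  have ss: "sqrt X * sqrt X = X" "sqrt k * sqrt k = k" "sqrt (X + 1) * sqrt (X + 1) = X + 1" "sqrt (X + 2) * sqrt (X + 2) = X + 2"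
    using X k by auto
  have idx: "n - 1 + l = Suc (l + m)" "n - 1 + (l + 1) = Suc (Suc (l + m))" "n - 1 + (l + 2) = Suc (Suc (Suc (l + m)))"
    "l + n - 2 = l + m" "n - 2 = m" using m by auto
  have fn: "fact (n - 1) = k * (fact m :: real)" by (simp add: m k_def)
  have sm: "sphere_moment n l = fact l * (k * fact m) / (X * fact (l + m))"
    "sphere_moment n (l + 1) = fact (l + 1) * (k * fact m) / ((X + 1) * (X * fact (l + m)))"
    "sphere_moment n (l + 2) = fact (l + 2) * (k * fact m) / ((X + 2) * ((X + 1) * (X * fact (l + m))))"
    unfolding sphere_moment_def by (simp_all only: idx fn fX)
  have ss2: "sqrt X * (sqrt X * y) = X * y" "sqrt k * (sqrt k * y) = k * y" "sqrt (X + 1) * (sqrt (X + 1) * y) = (X + 1) * y"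
    "sqrt (X + 2) * (sqrt (X + 2) * y) = (X + 2) * y" for y
    using X k by (simp_all flip: mult.assoc)
  have rl: "real (l + n) = X + 1" "real (l + n - 1) = X" "real (l + n + 1) = X + 2" by (auto simp: m X_def)
  have sp: "sqrt X > 0" "sqrt k > 0" "sqrt (X + 1) > 0" "sqrt (X + 2) > 0" using X k by auto
  show "coherent_coeff n \<rho> l * (coherent_coeff n \<rho> l * sphere_moment n l) = fact (n - 2) * bessel_weight n \<rho> l"
    unfolding coherent_coeff_def bessel_weight_def kc idx(4,5) sm
    using X k sp \<rho> by (simp add: divide_simps power_mult power2_eq_square power_mult_distrib) (simp add: ss ss2 mult_ac)
  show "coherent_coeff n \<rho> l * (coherent_coeff n \<rho> l * sphere_moment n (l + 1))
      = fact (n - 2) * (bessel_weight n \<rho> l * (real (l + 1) / real (l + n)))"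
    unfolding coherent_coeff_def bessel_weight_def kc idx(4,5) sm rl
    using X k sp \<rho> by (simp add: divide_simps power_mult power2_eq_square power_mult_distrib) (simp add: ss ss2 mult_ac)
  show "coherent_coeff n \<rho> l * (coherent_coeff n \<rho> (l + 1) * sphere_moment n (l + 1))
      = fact (n - 2) * (bessel_weight n \<rho> l * (\<rho> / sqrt (real (l + n - 1) * real (l + n))))"
    unfolding coherent_coeff_def bessel_weight_def kc idx(4,5) sm rl real_sqrt_mult
    using X k sp \<rho> by (simp add: divide_simps power_mult power2_eq_square power_mult_distrib) (simp add: ss ss2 mult_ac)
  show "coherent_coeff n \<rho> l * (coherent_coeff n \<rho> (l + 2) * sphere_moment n (l + 2))
      = fact (n - 2) * (bessel_weight n \<rho> l * (\<rho>\<^sup>2 / (real (l + n) * sqrt (real (l + n - 1) * real (l + n + 1)))))"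
    unfolding coherent_coeff_def bessel_weight_def kc idx(4,5) sm rl real_sqrt_mult
    using X k sp \<rho> by (simp add: divide_simps power_mult power2_eq_square power_mult_distrib) (simp add: ss ss2 mult_ac)
qed

definition coherent_density :: "real \<Rightarrow> complex^'n::finite \<Rightarrow> complex^'n \<Rightarrow> real" where
  "coherent_density \<rho> u x = (cmod (coherent_series CARD('n) \<rho> (herm_inner x u)))\<^sup>2"

definition coherent_mean :: "real \<Rightarrow> complex^'n::finite \<Rightarrow> (complex^'n \<Rightarrow> complex) \<Rightarrow> complex" where
  "coherent_mean \<rho> u f = (LINT x|sphere_measure. f x * of_real (coherent_density \<rho> u x)) /
     (LINT x|sphere_measure. of_real (coherent_density \<rho> u x))"

lemma continuous_on_coherent_series: "n \<ge> 2 \<Longrightarrow> continuous_on S (coherent_series n \<rho>)"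
  unfolding coherent_series_def[abs_def] by (rule continuous_on_entire_series[OF entire_coeffs_coherent])

lemma continuous_on_coherent_density:
  fixes u :: "complex^'n::finite"
  shows "CARD('n) \<ge> 2 \<Longrightarrow> continuous_on S (coherent_density \<rho> u)"
  unfolding coherent_density_def[abs_def]
  by (intro continuous_intros continuous_on_compose2[OF continuous_on_coherent_series[of _ UNIV]]) auto

text \<open>The four integrals are the cases (i, j) = (0,0), (1,1), (1,0), (2,0) of
  \<open>power_series_inner_sums\<close> with both series equal. The common factor (n-2)! drops out
  of the quotients.\<close>

lemma coherent_mean_moments:
  fixes u :: "complex^'n::finite"
  assumes n: "CARD('n) \<ge> 2" and \<rho>: "\<rho> > 0" and u: "norm u = 1"
  shows "(LINT x|sphere_measure. complex_of_real (coherent_density \<rho> u x)) = of_real (fact (CARD('n) - 2) * (\<Sum>l. bessel_weight CARD('n) \<rho> l))"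
    and "coherent_mean \<rho> u (\<lambda>x. of_real ((cmod (herm_inner x u))\<^sup>2)) = of_real (bessel_mean CARD('n) \<rho> (\<lambda>l. real (l + 1) / real (l + CARD('n))))"
    and "coherent_mean \<rho> u (\<lambda>x. herm_inner x u)
      = of_real (bessel_mean CARD('n) \<rho> (\<lambda>l. \<rho> / sqrt (real (l + CARD('n) - 1) * real (l + CARD('n)))))"
    and "coherent_mean \<rho> u (\<lambda>x. (herm_inner x u)\<^sup>2)
      = of_real (bessel_mean CARD('n) \<rho> (\<lambda>l. \<rho>\<^sup>2 / (real (l + CARD('n)) * sqrt (real (l + CARD('n) - 1) * real (l + CARD('n) + 1)))))"
proof -
  define N where "N = CARD('n)"
  have N: "N \<ge> 2" using n by (simp add: N_def)
  define F where "F = coherent_series N \<rho>"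
  note ent = entire_coeffs_coherent[OF N, of \<rho>]
  have sums: "(\<lambda>l. complex_of_real (coherent_coeff N \<rho> l * (coherent_coeff N \<rho> (l + (i - j)) * sphere_moment N (l + i)))) sums
    (LINT x|sphere_measure. herm_inner x u ^ i * F (herm_inner x u) * cnj (herm_inner x u ^ j * F (herm_inner x u)))" if "j \<le> i" for i j
    using power_series_inner_sums[OF ent ent u that] unfolding F_def coherent_series_def N_def by simp
  have dens: "complex_of_real (coherent_density \<rho> u x) = F (herm_inner x u) * cnj (F (herm_inner x u))" for x
    by (simp add: coherent_density_def F_def N_def complex_norm_square flip: of_real_power)
  define W where "W = (\<Sum>l. bessel_weight N \<rho> l)"
  have W: "W > 0" unfolding W_def by (rule suminf_bessel_weight_pos[OF \<rho>])
  have den: "(LINT x|sphere_measure. complex_of_real (coherent_density \<rho> u x)) = of_real (fact (N - 2) * W)"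
  proof -
    have "(\<lambda>l. complex_of_real (fact (N - 2) * bessel_weight N \<rho> l)) sums (LINT x|sphere_measure. complex_of_real (coherent_density \<rho> u x))"
      using sums[of 0 0] coherent_coeff_products(1)[OF N \<rho>] by (simp add: dens)
    moreover have "(\<lambda>l. complex_of_real (fact (N - 2) * bessel_weight N \<rho> l)) sums of_real (fact (N - 2) * W)"
      unfolding W_def by (intro sums_of_real sums_mult summable_sums summable_bessel_weight[OF \<rho>])
    ultimately show ?thesis by (rule sums_unique2)
  qed
  then show "(LINT x|sphere_measure. complex_of_real (coherent_density \<rho> u x)) = of_real (fact (CARD('n) - 2) * (\<Sum>l. bessel_weight CARD('n) \<rho> l))"
    by (simp add: N_def W_def)
  \<comment> \<open>Convergence of the weighted series is read off from the integral identity
    itself, so no bound on f is required here.\<close>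
  have mean: "coherent_mean \<rho> u g = of_real (bessel_mean N \<rho> f)"
    if s: "(\<lambda>l. complex_of_real (fact (N - 2) * (bessel_weight N \<rho> l * f l))) sums (LINT x|sphere_measure. g x * of_real (coherent_density \<rho> u x))" for f g
  proof -
    have s2: "(\<lambda>l. complex_of_real (bessel_weight N \<rho> l * f l)) sums ((LINT x|sphere_measure. g x * of_real (coherent_density \<rho> u x)) / of_real (fact (N - 2)))"
      using sums_divide[OF s, of "of_real (fact (N - 2))"] by simp
    then have "summable (\<lambda>l. bessel_weight N \<rho> l * f l)" using summable_of_real_iff sums_summable by blast
    then have "(\<lambda>l. complex_of_real (bessel_weight N \<rho> l * f l)) sums of_real (\<Sum>l. bessel_weight N \<rho> l * f l)"
      by (intro sums_of_real summable_sums)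
    from sums_unique2[OF s2 this]
    have "(LINT x|sphere_measure. g x * of_real (coherent_density \<rho> u x)) = of_real (fact (N - 2) * (\<Sum>l. bessel_weight N \<rho> l * f l))"
      by (simp add: field_simps)
    then show ?thesis using W unfolding coherent_mean_def den by (simp add: bessel_mean_def W_def)
  qed
  show "coherent_mean \<rho> u (\<lambda>x. of_real ((cmod (herm_inner x u))\<^sup>2)) = of_real (bessel_mean CARD('n) \<rho> (\<lambda>l. real (l + 1) / real (l + CARD('n))))"
  proof (fold N_def, rule mean)
    have eq: "complex_of_real ((cmod (herm_inner x u))\<^sup>2) * of_real (coherent_density \<rho> u x)
      = herm_inner x u ^ 1 * F (herm_inner x u) * cnj (herm_inner x u ^ 1 * F (herm_inner x u))" for x
      unfolding dens complex_norm_square by simp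
    show "(\<lambda>l. complex_of_real (fact (N - 2) * (bessel_weight N \<rho> l * (real (l + 1) / real (l + N))))) sums
      (LINT x|sphere_measure. complex_of_real ((cmod (herm_inner x u))\<^sup>2) * of_real (coherent_density \<rho> u x))"
      unfolding eq using sums[of 1 1] unfolding coherent_coeff_products(2)[OF N \<rho>, symmetric] by simp
  qed
  show "coherent_mean \<rho> u (\<lambda>x. herm_inner x u)
      = of_real (bessel_mean CARD('n) \<rho> (\<lambda>l. \<rho> / sqrt (real (l + CARD('n) - 1) * real (l + CARD('n)))))"
  proof (fold N_def, rule mean)
    have eq: "herm_inner x u * of_real (coherent_density \<rho> u x)
      = herm_inner x u ^ 1 * F (herm_inner x u) * cnj (herm_inner x u ^ 0 * F (herm_inner x u))" for x
      unfolding dens by simp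
    show "(\<lambda>l. complex_of_real (fact (N - 2) * (bessel_weight N \<rho> l * (\<rho> / sqrt (real (l + N - 1) * real (l + N)))))) sums
      (LINT x|sphere_measure. herm_inner x u * of_real (coherent_density \<rho> u x))"
      unfolding eq using sums[of 0 1] unfolding coherent_coeff_products(3)[OF N \<rho>, symmetric] by simp
  qed
  show "coherent_mean \<rho> u (\<lambda>x. (herm_inner x u)\<^sup>2)
      = of_real (bessel_mean CARD('n) \<rho> (\<lambda>l. \<rho>\<^sup>2 / (real (l + CARD('n)) * sqrt (real (l + CARD('n) - 1) * real (l + CARD('n) + 1)))))"
  proof (fold N_def, rule mean)
    have eq: "(herm_inner x u)\<^sup>2 * of_real (coherent_density \<rho> u x)
      = herm_inner x u ^ 2 * F (herm_inner x u) * cnj (herm_inner x u ^ 0 * F (herm_inner x u))" for x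
      unfolding dens by simp
    show "(\<lambda>l. complex_of_real (fact (N - 2) * (bessel_weight N \<rho> l * (\<rho>\<^sup>2 / (real (l + N) * sqrt (real (l + N - 1) * real (l + N + 1))))))) sums
      (LINT x|sphere_measure. (herm_inner x u)\<^sup>2 * of_real (coherent_density \<rho> u x))"
      unfolding eq using sums[of 0 2] unfolding coherent_coeff_products(4)[OF N \<rho>, symmetric] by simp
  qed
qed

text \<open>The projection occurs only inside an inner product with the kernel, a Hardy function, so
  neither its values nor the choice of representative matter. Scaling turns z and h into u and
  \<rho>.\<close>

lemma berezin_transform_eq_coherent_mean:
  fixes z :: "complex^'n::finite"
  assumes n: "CARD('n) \<ge> 2" and z: "z \<noteq> 0" and h: "h > 0" and \<phi>: "continuous_on (sphere 0 1) \<phi>"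
  shows "berezin_transform h (-1) \<phi> z = coherent_mean (norm z / h) (z /\<^sub>R norm z) \<phi>"
proof -
  define u where "u = z /\<^sub>R norm z"
  define \<rho> where "\<rho> = norm z / h"
  have zu: "z = of_real (norm z) *s u"
    using z by (simp add: u_def vec_eq_iff scaleR_conv_of_real[where 'a=complex])
  define K where "K x = coherent_kernel h (-1) x z" for x
  have K: "K = (\<lambda>x. \<Sum>l. of_real (coherent_coeff CARD('n) \<rho> l) * herm_inner x u ^ l)"
  proof
    fix x
    have "herm_inner x z / of_real h = of_real \<rho> * herm_inner x u"
      by (subst zu) (simp add: \<rho>_def)
    then show "K x = (\<Sum>l. of_real (coherent_coeff CARD('n) \<rho> l) * herm_inner x u ^ l)"
      by (simp add: K_def coherent_kernel_def coherent_coeff_def power_mult_distrib mult_ac)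
  qed
  have hardy: "K \<in> hardy_space"
    unfolding K by (rule hardy_space_power_series[OF entire_coeffs_coherent[OF n]])
  have cK: "continuous_on (sphere 0 1) K"
    unfolding K
    by (intro continuous_on_compose2[OF continuous_on_entire_series[OF entire_coeffs_coherent[OF n], of UNIV]] continuous_intros) auto
  have "compact ((\<lambda>x. \<phi> x * K x) ` sphere 0 1)" using cK \<phi> by (intro compact_continuous_image continuous_intros) auto
  then obtain B where B: "\<And>x. x \<in> sphere 0 1 \<Longrightarrow> norm (\<phi> x * K x) \<le> B"
    using compact_imp_bounded bounded_iff by (metis (mono_tags, lifting) imageI)
  have L2: "sq_integrable sphere_measure (\<lambda>x. \<phi> x * K x)"
  proof (rule sphere.sq_integrable_bounded[of _ B])
    show "(\<lambda>x. \<phi> x * K x) \<in> borel_measurable sphere_measure"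
      using cK \<phi> by (intro borel_measurable_sphere_measureI continuous_intros)
  qed (use B in simp)
  have dens: "complex_of_real (coherent_density \<rho> u x) = K x * cnj (K x)" for x
    by (simp add: coherent_density_def K coherent_series_def complex_norm_square flip: of_real_power)
  have "berezin_transform h (-1) \<phi> z = sphere_inner (hardy_projection (\<lambda>x. \<phi> x * K x)) K / sphere_inner K K"
    by (simp add: berezin_transform_def covariant_symbol_def toeplitz_def K_def[abs_def])
  also have "sphere_inner (hardy_projection (\<lambda>x. \<phi> x * K x)) K = sphere_inner (\<lambda>x. \<phi> x * K x) K"
    by (rule hardy_projection(2)[OF L2 hardy])
  finally show ?thesis
    by (simp add: sphere_inner_def coherent_mean_def dens mult.assoc flip: u_def \<rho>_def)
qed

section \<open>Taylor expansion along great circles\<close>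

abbreviation dir_deriv :: "('a::real_normed_vector \<Rightarrow> 'b::real_normed_vector) \<Rightarrow> 'a \<Rightarrow> 'a \<Rightarrow> 'b" where
  "dir_deriv f v x \<equiv> frechet_derivative f (at x) v"

text \<open>\<open>frechet_derivative\<close> is a choice among all derivatives, so the two sets of
  derivatives are compared. The equality thus holds also at points where no derivative
  exists.\<close>

lemma frechet_derivative_cong_open:
  fixes f g :: "'a::real_normed_vector \<Rightarrow> 'b::real_normed_vector"
  assumes "open U" "x \<in> U" "\<And>y. y \<in> U \<Longrightarrow> f y = g y"
  shows "frechet_derivative f (at x) = frechet_derivative g (at x)"
proof -
  have "(f has_derivative D) (at x) \<longleftrightarrow> (g has_derivative D) (at x)" for D
    using has_derivative_transform_within_open[OF _ assms(1,2), of f D UNIV g]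
      has_derivative_transform_within_open[OF _ assms(1,2), of g D UNIV f] assms(3) by auto
  then show ?thesis unfolding frechet_derivative_def by simp
qed

lemma Ck_on_cong:
  assumes "open U" "\<And>y. y \<in> U \<Longrightarrow> f y = g y"
  shows "Ck_on k U f \<longleftrightarrow> Ck_on k U g"
  using assms(2)
proof (induction k arbitrary: f g)
  case 0
  then show ?case by (simp cong: continuous_on_cong)
next
  case (Suc k)
  have "f differentiable (at x) \<longleftrightarrow> g differentiable (at x)" if "x \<in> U" for x
    unfolding differentiable_def
    using has_derivative_transform_within_open[OF _ assms(1) that, of f _ UNIV g]
      has_derivative_transform_within_open[OF _ assms(1) that, of g _ UNIV f] Suc.prems by auto
  moreover have "Ck_on k U (\<lambda>x. dir_deriv f v x) \<longleftrightarrow> Ck_on k U (\<lambda>x. dir_deriv g v x)" for v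
    using frechet_derivative_cong_open[OF assms(1) _ Suc.prems] by (intro Suc.IH) auto
  ultimately show ?case by auto
qed

lemma Ck_on_Suc_imp: "Ck_on (Suc k) U f \<Longrightarrow> Ck_on k U f"
proof (induction k arbitrary: f)
  case 0
  then show ?case
    by (auto intro!: continuous_at_imp_continuous_on differentiable_imp_continuous_within)
next
  case (Suc k)
  have "Ck_on k U (\<lambda>x. dir_deriv f v x)" for v
    using Suc.prems unfolding Ck_on.simps(2)[of "Suc k"] by (intro Suc.IH) blast
  moreover have "\<forall>x\<in>U. f differentiable (at x)" using Suc.prems unfolding Ck_on.simps(2)[of "Suc k"] by blast
  ultimately show ?case by simp
qed

lemma Ck_on_add:
  assumes "open U"
  shows "Ck_on k U f \<Longrightarrow> Ck_on k U g \<Longrightarrow> Ck_on k U (\<lambda>x. f x + g x)"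
proof (induction k arbitrary: f g)
  case 0
  then show ?case by (auto intro: continuous_intros)
next
  case (Suc k)
  have d: "f differentiable (at x)" "g differentiable (at x)" if "x \<in> U" for x
    using Suc.prems that by auto
  have "dir_deriv (\<lambda>x. f x + g x) v x = dir_deriv f v x + dir_deriv g v x" if "x \<in> U" for x v
    using frechet_derivative_at[OF has_derivative_add[OF frechet_derivative_works[THEN iffD1, OF d(1)[OF that]]
      frechet_derivative_works[THEN iffD1, OF d(2)[OF that]]]] by (simp add: fun_eq_iff)
  then have "Ck_on k U (\<lambda>x. dir_deriv (\<lambda>x. f x + g x) v x)" for v
    using Ck_on_cong[OF assms, of "\<lambda>x. dir_deriv (\<lambda>x. f x + g x) v x" "\<lambda>x. dir_deriv f v x + dir_deriv g v x" k]
      Suc by simp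
  then show ?case using d by auto
qed

text \<open>Affine factors are the only products that rotation fields produce. The class is stable
  under differentiation, which replaces the factor by a constant one, so the induction stays within
  it.\<close>

lemma Ck_on_inner_scaleR:
  fixes f :: "'a::real_inner \<Rightarrow> 'b::real_normed_vector"
  assumes "open U"
  shows "Ck_on k U f \<Longrightarrow> Ck_on k U (\<lambda>x. (c + x \<bullet> a) *\<^sub>R f x)"
proof (induction k arbitrary: f c a)
  case 0
  then show ?case by (auto intro!: continuous_intros)
next
  case (Suc k)
  have d: "f differentiable (at x)" if "x \<in> U" for x using Suc.prems that by auto
  have hd: "((\<lambda>x. (c + x \<bullet> a) *\<^sub>R f x) has_derivative (\<lambda>v. (c + x \<bullet> a) *\<^sub>R dir_deriv f v x + (v \<bullet> a) *\<^sub>R f x)) (at x)" if "x \<in> U" for x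
    using frechet_derivative_works[THEN iffD1, OF d[OF that]]
    by (auto intro!: derivative_eq_intros)
  \<comment> \<open>The summand \<open>x \<bullet> 0\<close> writes a constant factor in the affine
    form of the induction hypothesis.\<close>
  have e: "dir_deriv (\<lambda>x. (c + x \<bullet> a) *\<^sub>R f x) v x = (c + x \<bullet> a) *\<^sub>R dir_deriv f v x + (v \<bullet> a + x \<bullet> 0) *\<^sub>R f x" if "x \<in> U" for x v
    using frechet_derivative_at[OF hd[OF that]] by (simp add: fun_eq_iff)
  have c: "Ck_on k U (\<lambda>x. (c + x \<bullet> a) *\<^sub>R dir_deriv f v x + (v \<bullet> a + x \<bullet> 0) *\<^sub>R f x)" for v
  proof (intro Ck_on_add[OF assms] Suc.IH)
    show "Ck_on k U f" by (rule Ck_on_Suc_imp[OF Suc.prems])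
    show "Ck_on k U (\<lambda>x. dir_deriv f v x)" using Suc.prems by simp
  qed
  have "Ck_on k U (\<lambda>x. dir_deriv (\<lambda>x. (c + x \<bullet> a) *\<^sub>R f x) v x)" for v
    by (rule Ck_on_cong[OF assms e, THEN iffD2, OF _ c])
  moreover have "(\<lambda>x. (c + x \<bullet> a) *\<^sub>R f x) differentiable (at x)" if "x \<in> U" for x
    using hd[OF that] by (auto simp: differentiable_def)
  ultimately show ?case by auto
qed

lemma smooth_on_differentiable: "smooth_on U f \<Longrightarrow> x \<in> U \<Longrightarrow> f differentiable (at x)"
  unfolding smooth_on_def using Ck_on.simps(2)[of 0 U f] by blast

lemma smooth_on_continuous_on: "smooth_on U f \<Longrightarrow> continuous_on U f"
  unfolding smooth_on_def using Ck_on.simps(1)[of U f] by blast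

lemma smooth_on_dir_deriv: "smooth_on U f \<Longrightarrow> smooth_on U (\<lambda>x. dir_deriv f v x)"
  unfolding smooth_on_def using Ck_on.simps(2)[of _ U f] by blast

lemma smooth_on_add: "open U \<Longrightarrow> smooth_on U f \<Longrightarrow> smooth_on U g \<Longrightarrow> smooth_on U (\<lambda>x. f x + g x)"
  unfolding smooth_on_def by (simp add: Ck_on_add)

lemma smooth_on_inner_scaleR:
  fixes f :: "'a::real_inner \<Rightarrow> 'b::real_normed_vector"
  shows "open U \<Longrightarrow> smooth_on U f \<Longrightarrow> smooth_on U (\<lambda>x. (c + x \<bullet> a) *\<^sub>R f x)"
  unfolding smooth_on_def by (simp add: Ck_on_inner_scaleR)

lemma smooth_on_cong: "open U \<Longrightarrow> (\<And>y. y \<in> U \<Longrightarrow> f y = g y) \<Longrightarrow> smooth_on U f \<longleftrightarrow> smooth_on U g"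
  unfolding smooth_on_def using Ck_on_cong by blast

lemma dir_deriv_linear:
  assumes "smooth_on U f" "x \<in> U"
  shows "linear (\<lambda>v. dir_deriv f v x)"
  using linear_frechet_derivative[OF smooth_on_differentiable[OF assms]] by simp

text \<open>The vector field generating the rotation in the plane spanned by \<open>u\<close> and \<open>\<nu>\<close>.\<close>
definition rot_deriv :: "'a::real_inner \<Rightarrow> 'a \<Rightarrow> ('a \<Rightarrow> 'b::real_normed_vector) \<Rightarrow> 'a \<Rightarrow> 'b" where
  "rot_deriv u \<nu> f x = dir_deriv f ((x \<bullet> u) *\<^sub>R \<nu> - (x \<bullet> \<nu>) *\<^sub>R u) x"

lemma rot_deriv_eq:
  assumes "smooth_on U f" "x \<in> U"
  shows "rot_deriv u \<nu> f x = (x \<bullet> u) *\<^sub>R dir_deriv f \<nu> x + (x \<bullet> (- \<nu>)) *\<^sub>R dir_deriv f u x"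
  using dir_deriv_linear[OF assms]
  by (simp add: rot_deriv_def linear_diff[of "\<lambda>v. dir_deriv f v x"] linear_scale[of "\<lambda>v. dir_deriv f v x"])

lemma smooth_on_rot_deriv:
  assumes U: "open U" and f: "smooth_on U f"
  shows "smooth_on U (rot_deriv u \<nu> f)"
proof -
  have "smooth_on U (\<lambda>x. (0 + x \<bullet> u) *\<^sub>R dir_deriv f \<nu> x + (0 + x \<bullet> (- \<nu>)) *\<^sub>R dir_deriv f u x)"
    by (intro smooth_on_add smooth_on_inner_scaleR smooth_on_dir_deriv U f)
  then show ?thesis
    using smooth_on_cong[OF U, of "rot_deriv u \<nu> f"] rot_deriv_eq[OF f] by simp
qed

lemma smooth_on_funpow_rot_deriv:
  "open U \<Longrightarrow> smooth_on U f \<Longrightarrow> smooth_on U ((rot_deriv u \<nu> ^^ k) f)"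
  by (induction k) (auto intro: smooth_on_rot_deriv)

lemma rot_deriv_cong:
  "open U \<Longrightarrow> (\<And>y. y \<in> U \<Longrightarrow> f y = g y) \<Longrightarrow> x \<in> U \<Longrightarrow> rot_deriv u \<nu> f x = rot_deriv u \<nu> g x"
  unfolding rot_deriv_def using frechet_derivative_cong_open by metis

lemma funpow_rot_deriv_cong:
  assumes "open U" "\<And>y. y \<in> U \<Longrightarrow> f y = g y" "x \<in> U"
  shows "(rot_deriv u \<nu> ^^ k) f x = (rot_deriv u \<nu> ^^ k) g x"
  using assms(3) by (induction k arbitrary: x) (auto intro: rot_deriv_cong[OF assms(1)] assms(2))

lemma rot_deriv_sum:
  fixes f :: "'i \<Rightarrow> 'a::real_inner \<Rightarrow> 'b::real_normed_vector"
  assumes U: "open U" and I: "finite I" and f: "\<And>i. i \<in> I \<Longrightarrow> smooth_on U (f i)" and x: "x \<in> U"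
  shows "rot_deriv u \<nu> (\<lambda>x. \<Sum>i\<in>I. c i *\<^sub>R f i x) x = (\<Sum>i\<in>I. c i *\<^sub>R rot_deriv u \<nu> (f i) x)"
proof -
  have "((\<lambda>x. \<Sum>i\<in>I. c i *\<^sub>R f i x) has_derivative (\<lambda>v. \<Sum>i\<in>I. c i *\<^sub>R dir_deriv (f i) v x)) (at x)"
    using frechet_derivative_works[THEN iffD1, OF smooth_on_differentiable[OF f x]]
    by (intro has_derivative_sum has_derivative_scaleR_right) auto
  from frechet_derivative_at[OF this] show ?thesis by (simp add: rot_deriv_def fun_eq_iff)
qed

lemma funpow_rot_deriv_sum:
  fixes f :: "'i \<Rightarrow> 'a::real_inner \<Rightarrow> 'b::real_normed_vector"
  assumes U: "open U" and I: "finite I" and f: "\<And>i. i \<in> I \<Longrightarrow> smooth_on U (f i)" and x: "x \<in> U"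
  shows "(rot_deriv u \<nu> ^^ k) (\<lambda>x. \<Sum>i\<in>I. c i *\<^sub>R f i x) x = (\<Sum>i\<in>I. c i *\<^sub>R (rot_deriv u \<nu> ^^ k) (f i) x)"
  using x
proof (induction k arbitrary: x)
  case (Suc k)
  have "(rot_deriv u \<nu> ^^ Suc k) (\<lambda>x. \<Sum>i\<in>I. c i *\<^sub>R f i x) x
     = rot_deriv u \<nu> (\<lambda>x. \<Sum>i\<in>I. c i *\<^sub>R (rot_deriv u \<nu> ^^ k) (f i) x) x"
    using rot_deriv_cong[OF U Suc.IH Suc.prems] by simp
  also have "\<dots> = (\<Sum>i\<in>I. c i *\<^sub>R (rot_deriv u \<nu> ^^ Suc k) (f i) x)"
    using rot_deriv_sum[OF U I smooth_on_funpow_rot_deriv[OF U f] Suc.prems] by simp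
  finally show ?case .
qed simp

text \<open>The rotation field is linear in \<nu>, so derivatives for all directions reduce to
  finitely many.\<close>

lemma rot_deriv_Basis:
  fixes f :: "'a::euclidean_space \<Rightarrow> 'b::real_normed_vector"
  assumes f: "smooth_on U f" and x: "x \<in> U"
  shows "rot_deriv u \<nu> f x = (\<Sum>b\<in>Basis. (\<nu> \<bullet> b) *\<^sub>R rot_deriv u b f x)"
proof -
  define T where "T v = dir_deriv f v x" for v
  have lin: "linear T" unfolding T_def[abs_def] by (rule dir_deriv_linear[OF f x])
  have "(x \<bullet> u) *\<^sub>R \<nu> - (x \<bullet> \<nu>) *\<^sub>R u = (\<Sum>b\<in>Basis. (\<nu> \<bullet> b) *\<^sub>R ((x \<bullet> u) *\<^sub>R b - (x \<bullet> b) *\<^sub>R u))"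
  proof -
    have 1: "(x \<bullet> u) *\<^sub>R \<nu> = (\<Sum>b\<in>Basis. (\<nu> \<bullet> b) *\<^sub>R ((x \<bullet> u) *\<^sub>R b))"
      by (subst euclidean_representation[of \<nu>, symmetric]) (simp add: scaleR_sum_right mult.commute)
    have 2: "(x \<bullet> \<nu>) *\<^sub>R u = (\<Sum>b\<in>Basis. (\<nu> \<bullet> b) *\<^sub>R ((x \<bullet> b) *\<^sub>R u))"
      by (subst euclidean_inner) (simp add: scaleR_sum_left mult.commute)
    show ?thesis unfolding 1 2 by (simp add: scaleR_diff_right sum_subtractf)
  qed
  then show ?thesis
    unfolding rot_deriv_def T_def[symmetric] by (simp add: linear_sum[OF lin] linear_scale[OF lin])
qed

text \<open>The Taylor remainder has to be uniform over all great circles through u. Expanding \<nu>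
  in the basis leaves finitely many smooth functions on the compact sphere.\<close>

lemma funpow_rot_deriv_bounded:
  fixes f :: "'a::euclidean_space \<Rightarrow> 'b::real_normed_vector"
  assumes U: "open U" and S: "sphere 0 1 \<subseteq> U" and f: "smooth_on U f"
  shows "\<exists>C. \<forall>\<nu> x. norm \<nu> = 1 \<longrightarrow> norm x = 1 \<longrightarrow> norm ((rot_deriv u \<nu> ^^ k) f x) \<le> C"
  using f
proof (induction k arbitrary: f)
  case 0
  have "compact (f ` sphere 0 1)"
    using continuous_on_subset[OF smooth_on_continuous_on[OF 0] S] by (intro compact_continuous_image) auto
  then obtain C where "\<And>x. x \<in> sphere 0 1 \<Longrightarrow> norm (f x) \<le> C"
    using compact_imp_bounded bounded_iff by (metis imageI)
  then show ?case by auto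
next
  case (Suc k)
  have "\<exists>C. \<forall>\<nu> x. norm \<nu> = 1 \<longrightarrow> norm x = 1 \<longrightarrow> norm ((rot_deriv u \<nu> ^^ k) (rot_deriv u b f) x) \<le> C" for b
    by (rule Suc.IH[OF smooth_on_rot_deriv[OF U Suc.prems]])
  then obtain C where C: "\<And>b \<nu> x. norm \<nu> = 1 \<Longrightarrow> norm x = 1 \<Longrightarrow> norm ((rot_deriv u \<nu> ^^ k) (rot_deriv u b f) x) \<le> C b"
    by metis
  have "norm ((rot_deriv u \<nu> ^^ Suc k) f x) \<le> (\<Sum>b\<in>Basis. C b)" if \<nu>: "norm \<nu> = 1" and x: "norm x = 1" for \<nu> x
  proof -
    have xU: "x \<in> U" using S x by auto
    \<comment> \<open>The innermost derivative is the one expanded, because the induction hypothesis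
      applies to iterates on the fixed functions \<open>rot_deriv u b f\<close>.\<close>
    have "(rot_deriv u \<nu> ^^ Suc k) f x = (rot_deriv u \<nu> ^^ k) (rot_deriv u \<nu> f) x"
      by (simp add: funpow_Suc_right del: funpow.simps)
    also have "\<dots> = (rot_deriv u \<nu> ^^ k) (\<lambda>x. \<Sum>b\<in>Basis. (\<nu> \<bullet> b) *\<^sub>R rot_deriv u b f x) x"
      by (rule funpow_rot_deriv_cong[OF U rot_deriv_Basis[OF Suc.prems] xU])
    also have "\<dots> = (\<Sum>b\<in>Basis. (\<nu> \<bullet> b) *\<^sub>R (rot_deriv u \<nu> ^^ k) (rot_deriv u b f) x)"
      by (rule funpow_rot_deriv_sum[OF U finite_Basis smooth_on_rot_deriv[OF U Suc.prems] xU])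
    also have "norm \<dots> \<le> (\<Sum>b\<in>Basis. C b)"
    proof (rule sum_norm_le)
      fix b :: 'a assume b: "b \<in> Basis"
      have "\<bar>\<nu> \<bullet> b\<bar> \<le> 1" using Basis_le_norm[OF b, of \<nu>] \<nu> by simp
      then have "\<bar>\<nu> \<bullet> b\<bar> * norm ((rot_deriv u \<nu> ^^ k) (rot_deriv u b f) x) \<le> 1 * C b"
        using C[OF \<nu> x] by (intro mult_mono) auto
      then show "norm ((\<nu> \<bullet> b) *\<^sub>R (rot_deriv u \<nu> ^^ k) (rot_deriv u b f) x) \<le> C b" by simp
    qed
    finally show ?thesis .
  qed
  then show ?case by blast
qed

text \<open>The velocity of the circle is the rotation field at the current point. Derivatives of f
  along the circle are therefore values of iterated rotation derivatives, and no higher chain rule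
  is involved.\<close>

lemma has_vector_derivative_circle:
  fixes f :: "'a::euclidean_space \<Rightarrow> 'b::real_normed_vector"
  assumes S: "sphere 0 1 \<subseteq> U" and f: "smooth_on U f"
    and u: "norm u = 1" "norm \<nu> = 1" "u \<bullet> \<nu> = 0"
  shows "((\<lambda>\<theta>. f (cos \<theta> *\<^sub>R u + sin \<theta> *\<^sub>R \<nu>)) has_vector_derivative rot_deriv u \<nu> f (cos \<theta> *\<^sub>R u + sin \<theta> *\<^sub>R \<nu>)) (at \<theta>)"
proof -
  let ?c = "\<lambda>\<theta>. cos \<theta> *\<^sub>R u + sin \<theta> *\<^sub>R \<nu>"
  have uu: "u \<bullet> u = 1" "\<nu> \<bullet> \<nu> = 1" "\<nu> \<bullet> u = 0" using u by (auto simp: norm_eq_1 inner_commute)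
  have "(norm (?c \<theta>))\<^sup>2 = (cos \<theta>)\<^sup>2 + (sin \<theta>)\<^sup>2"
    unfolding power2_norm_eq_inner by (simp add: inner_add_left inner_add_right uu u power2_eq_square)
  then have "norm (?c \<theta>) = 1" by (simp add: power2_eq_1_iff) (metis norm_ge_zero neg_0_le_iff_le not_one_le_zero)
  then have cU: "?c \<theta> \<in> U" using S by auto
  have "((\<lambda>\<theta>. ?c \<theta>) has_vector_derivative (- sin \<theta>) *\<^sub>R u + cos \<theta> *\<^sub>R \<nu>) (at \<theta>)"
    by (auto intro!: derivative_eq_intros simp: has_vector_derivative_def scaleR_add_right scaleR_diff_right)
  then have c: "(?c has_vector_derivative (?c \<theta> \<bullet> u) *\<^sub>R \<nu> - (?c \<theta> \<bullet> \<nu>) *\<^sub>R u) (at \<theta>)"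
    by (simp add: inner_add_left uu u)
  have "(f has_derivative frechet_derivative f (at (?c \<theta>))) (at (?c \<theta>))"
    using frechet_derivative_works smooth_on_differentiable[OF f cU] by blast
  from vector_derivative_diff_chain_within[OF c has_derivative_at_withinI[OF this]]
  show ?thesis by (simp add: o_def rot_deriv_def)
qed

section \<open>Trigonometric bounds and an even Taylor estimate in one variable\<close>

lemma cos_bounds:
  fixes x :: real
  shows "1 - x\<^sup>2 / 2 \<le> cos x" and "cos x \<le> 1 - x\<^sup>2 / 2 + x ^ 4 / 24"
proof -
  have c: "cos_coeff 0 = 1" "cos_coeff 1 = 0" "cos_coeff 2 = -1/2" "cos_coeff 3 = 0"
    by (simp_all add: cos_coeff_def)
  obtain t where t: "cos x = (\<Sum>m<4. cos_coeff m * x ^ m) + cos (t + 1/2 * real 4 * pi) / fact 4 * x ^ 4"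
    using Maclaurin_cos_expansion[of x 4] by auto
  have "cos (t + 1/2 * real 4 * pi) = cos t" by simp
  then have e: "cos x = 1 - x\<^sup>2 / 2 + cos t * x ^ 4 / 24"
    unfolding t using c by (simp add: eval_nat_numeral fact_numeral)
  have "cos t * x ^ 4 \<le> 1 * x ^ 4" by (intro mult_right_mono) auto
  then show "cos x \<le> 1 - x\<^sup>2 / 2 + x ^ 4 / 24" unfolding e by simp
  have "1 - cos x = 2 * (sin (x/2))\<^sup>2" using cos_double_sin[of "x/2"] by simp
  also have "(sin (x/2))\<^sup>2 \<le> (x/2)\<^sup>2"
    using abs_sin_x_le_abs_x[of "x/2"] by (simp only: abs_le_square_iff)
  finally show "1 - x\<^sup>2 / 2 \<le> cos x" by (simp add: power2_eq_square)
qed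

text \<open>The quartic bound for cos is too weak near pi, so it is applied at half the angle, where
  y \<le> 2 gives cos y \<le> 1 - y^2/3. The constant is not sharp.\<close>

lemma one_minus_cos_ge:
  fixes x :: real
  assumes "0 \<le> x" "x \<le> pi"
  shows "x\<^sup>2 \<le> 12 * (1 - cos x)"
proof -
  define y where "y = x / 2"
  have y: "0 \<le> y" "y \<le> pi / 2" "y \<le> 2" and xy: "x = 2 * y"
    using assms pi_less_4 by (auto simp: y_def)
  have "y ^ 4 = y\<^sup>2 * y\<^sup>2" by (simp add: power2_eq_square power4_eq_xxxx)
  also have "\<dots> \<le> y\<^sup>2 * 2\<^sup>2" using y by (intro mult_left_mono power_mono) auto
  finally have "cos y \<le> 1 - y\<^sup>2 / 3" using cos_bounds(2)[of y] by simp
  moreover have "(cos y)\<^sup>2 \<le> cos y"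
    using cos_ge_zero[of y] y by (simp add: power2_eq_square mult_left_le)
  moreover have "cos x = 2 * (cos y)\<^sup>2 - 1" unfolding xy by (rule cos_double_cos)
  ultimately have "12 * (2 * y\<^sup>2 / 3) \<le> 12 * (1 - cos x)" by (intro mult_left_mono) auto
  moreover have "x\<^sup>2 \<le> 12 * (2 * y\<^sup>2 / 3)" by (simp add: xy power_mult_distrib)
  ultimately show ?thesis by (rule order_trans[rotated])
qed

lemma sin_square_diff_le: "\<bar>x\<^sup>2 - (sin x)\<^sup>2\<bar> \<le> x ^ 4 / 3" for x :: real
proof -
  have s: "(sin x)\<^sup>2 = (1 - cos (2 * x)) / 2" using cos_double_sin[of x] by simp
  have "(2 * x)\<^sup>2 = 4 * x\<^sup>2" "(2 * x) ^ 4 = 16 * x ^ 4" by (simp_all add: power_mult_distrib)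
  then have "1 - 2 * x\<^sup>2 \<le> cos (2 * x)" "cos (2 * x) \<le> 1 - 2 * x\<^sup>2 + 2 * x ^ 4 / 3" "0 \<le> x ^ 4"
    using cos_bounds[of "2 * x"] by auto
  then show ?thesis unfolding s by (intro abs_leI) (simp_all add: field_simps)
qed

text \<open>The odd terms of the two expansions cancel. Real values are used because the remainder
  is in Lagrange form, which fails for complex-valued functions.\<close>

lemma taylor_even_real:
  fixes g :: "nat \<Rightarrow> real \<Rightarrow> real"
  assumes d: "\<And>m x. (g m has_real_derivative g (Suc m) x) (at x)" and C: "\<And>x. \<bar>g 4 x\<bar> \<le> C"
  shows "\<bar>g 0 \<theta> + g 0 (- \<theta>) - 2 * g 0 0 - \<theta>\<^sup>2 * g 2 0\<bar> \<le> C * \<theta> ^ 4"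
proof -
  have *: "\<bar>g 0 x - (g 0 0 + g 1 0 * x + g 2 0 / 2 * x\<^sup>2 + g 3 0 / 6 * x ^ 3)\<bar> \<le> C / 24 * x ^ 4" for x
  proof -
    have "\<exists>t. \<bar>t\<bar> \<le> \<bar>x\<bar> \<and> g 0 x = (\<Sum>m<4. g m 0 / fact m * x ^ m) + g 4 t / fact 4 * x ^ 4"
      by (rule Maclaurin_all_le[of g "g 0"]) (auto intro: d)
    then obtain t where "g 0 x = (\<Sum>m<4. g m 0 / fact m * x ^ m) + g 4 t / fact 4 * x ^ 4" by blast
    then have e: "g 0 x - (g 0 0 + g 1 0 * x + g 2 0 / 2 * x\<^sup>2 + g 3 0 / 6 * x ^ 3) = g 4 t / 24 * x ^ 4"
      by (simp add: eval_nat_numeral fact_numeral)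
    show ?thesis unfolding e using C[of t] by (simp add: abs_mult mult_right_mono)
  qed
  have C0: "C \<ge> 0" using C[of 0] abs_ge_zero order_trans by blast
  have "0 \<le> C * \<theta> ^ 4" using C0 by simp
  moreover have "\<bar>g 0 \<theta> + g 0 (- \<theta>) - 2 * g 0 0 - \<theta>\<^sup>2 * g 2 0\<bar> \<le> C / 24 * \<theta> ^ 4 + C / 24 * \<theta> ^ 4"
  proof -
    have e: "g 0 \<theta> + g 0 (- \<theta>) - 2 * g 0 0 - \<theta>\<^sup>2 * g 2 0
      = (g 0 \<theta> - (g 0 0 + g 1 0 * \<theta> + g 2 0 / 2 * \<theta>\<^sup>2 + g 3 0 / 6 * \<theta> ^ 3))
      + (g 0 (- \<theta>) - (g 0 0 + g 1 0 * (- \<theta>) + g 2 0 / 2 * (- \<theta>)\<^sup>2 + g 3 0 / 6 * (- \<theta>) ^ 3))"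
      by (simp add: algebra_simps)
    show ?thesis
      unfolding e by (rule order_trans[OF abs_triangle_ineq add_mono[OF * order_trans[OF *]]]) simp
  qed
  ultimately show ?thesis by simp
qed

text \<open>A point x and its reflection are the points at angles \<theta> and -\<theta> on a great
  circle through u. Replacing \<theta>^2 by (sin \<theta>)^2, the squared length of the orthogonal
  part, costs O(\<theta>^4), and \<theta>^4 is at most a multiple of (1 - cos \<theta>)^2.\<close>

lemma taylor_sphere:
  fixes f :: "'a::euclidean_space \<Rightarrow> complex"
  assumes U: "open U" and S: "sphere 0 1 \<subseteq> U" and f: "smooth_on U f" and u: "norm u = 1" and dim: "DIM('a) \<ge> 2"
  obtains C where "C \<ge> 0" "\<And>x. norm x = 1 \<Longrightarrow>
    cmod ((f x + f (2 *\<^sub>R (x \<bullet> u) *\<^sub>R u - x)) / 2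
      - (f u + (dir_deriv (\<lambda>y. dir_deriv f (x - (x \<bullet> u) *\<^sub>R u) y) (x - (x \<bullet> u) *\<^sub>R u) u
            - of_real ((norm (x - (x \<bullet> u) *\<^sub>R u))\<^sup>2) * dir_deriv f u u) / 2)) \<le> C * (1 - x \<bullet> u)\<^sup>2"
proof -
  have uU: "u \<in> U" using S u by auto
  have uu: "u \<bullet> u = 1" using u by (simp add: norm_eq_1)
  obtain C where C: "\<And>\<nu> x. norm \<nu> = 1 \<Longrightarrow> norm x = 1 \<Longrightarrow> norm ((rot_deriv u \<nu> ^^ 4) f x) \<le> C"
    using funpow_rot_deriv_bounded[OF U S f] by blast
  obtain D where D: "\<And>\<nu> x. norm \<nu> = 1 \<Longrightarrow> norm x = 1 \<Longrightarrow> norm ((rot_deriv u \<nu> ^^ 2) f x) \<le> D"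
    using funpow_rot_deriv_bounded[OF U S f] by blast
  have C0: "C \<ge> 0" and D0: "D \<ge> 0" using C[OF u u] D[OF u u] norm_ge_zero order_trans by blast+
  define D1 where "D1 = dir_deriv f u u"
  define B where "B v = dir_deriv (\<lambda>y. dir_deriv f v y) v u" for v
  have Bs: "B (r *\<^sub>R v) = of_real (r\<^sup>2) * B v" for r v
  proof -
    have "dir_deriv (\<lambda>y. dir_deriv f (r *\<^sub>R v) y) w u = dir_deriv (\<lambda>y. r *\<^sub>R dir_deriv f v y) w u" for w
      using frechet_derivative_cong_open[OF U uU, of "\<lambda>y. dir_deriv f (r *\<^sub>R v) y" "\<lambda>y. r *\<^sub>R dir_deriv f v y"]
        linear_scale[OF dir_deriv_linear[OF f]] by simp
    moreover have "((\<lambda>y. r *\<^sub>R dir_deriv f v y) has_derivative (\<lambda>w. r *\<^sub>R dir_deriv (\<lambda>y. dir_deriv f v y) w u)) (at u)"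
      using frechet_derivative_works smooth_on_differentiable[OF smooth_on_dir_deriv[OF f] uU]
      by (intro has_derivative_scaleR_right) blast
    from frechet_derivative_at[OF this]
    have "dir_deriv (\<lambda>y. r *\<^sub>R dir_deriv f v y) w u = r *\<^sub>R dir_deriv (\<lambda>y. dir_deriv f v y) w u" for w by (simp add: fun_eq_iff)
    ultimately have "B (r *\<^sub>R v) = r *\<^sub>R dir_deriv (\<lambda>y. dir_deriv f v y) (r *\<^sub>R v) u" by (simp add: B_def)
    also have "\<dots> = r *\<^sub>R (r *\<^sub>R B v)"
      using linear_scale[OF dir_deriv_linear[OF smooth_on_dir_deriv[OF f] uU]] by (simp add: B_def)
    finally show ?thesis by (simp add: power2_eq_square scaleR_conv_of_real)
  qed
  \<comment> \<open>The term -D1 comes from the curvature of the circle, whose acceleration at u is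
    -u.\<close>
  have second: "(rot_deriv u \<nu> ^^ 2) f u = B \<nu> - D1" if \<nu>: "norm \<nu> = 1" "u \<bullet> \<nu> = 0" for \<nu>
  proof -
    have nn: "\<nu> \<bullet> \<nu> = 1" "\<nu> \<bullet> u = 0" using \<nu> by (auto simp: norm_eq_1 inner_commute)
    have "((\<lambda>x. (x \<bullet> u) *\<^sub>R dir_deriv f \<nu> x + (x \<bullet> (- \<nu>)) *\<^sub>R dir_deriv f u x) has_derivative
       (\<lambda>v. ((u \<bullet> u) *\<^sub>R dir_deriv (\<lambda>y. dir_deriv f \<nu> y) v u + (v \<bullet> u) *\<^sub>R dir_deriv f \<nu> u)
          + ((u \<bullet> (- \<nu>)) *\<^sub>R dir_deriv (\<lambda>y. dir_deriv f u y) v u + (v \<bullet> (- \<nu>)) *\<^sub>R dir_deriv f u u))) (at u)"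
      using frechet_derivative_works[THEN iffD1, OF smooth_on_differentiable[OF smooth_on_dir_deriv[OF f] uU]]
      by (auto intro!: derivative_eq_intros)
    note fd = frechet_derivative_at[OF this, symmetric]
    have "(rot_deriv u \<nu> ^^ 2) f u = rot_deriv u \<nu> (rot_deriv u \<nu> f) u" by (simp add: numeral_2_eq_2)
    also have "\<dots> = rot_deriv u \<nu> (\<lambda>x. (x \<bullet> u) *\<^sub>R dir_deriv f \<nu> x + (x \<bullet> (- \<nu>)) *\<^sub>R dir_deriv f u x) u"
      by (rule rot_deriv_cong[OF U rot_deriv_eq[OF f] uU])
    also have "\<dots> = B \<nu> - D1"
      unfolding rot_deriv_def fd by (simp add: uu \<nu> nn B_def D1_def)
    finally show ?thesis .
  qed
  have taylor: "cmod (f (cos \<theta> *\<^sub>R u + sin \<theta> *\<^sub>R \<nu>) + f (cos \<theta> *\<^sub>R u - sin \<theta> *\<^sub>R \<nu>) - 2 * f u - of_real (\<theta>\<^sup>2) * (B \<nu> - D1)) \<le> 2 * C * \<theta> ^ 4"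
    if \<nu>: "norm \<nu> = 1" "u \<bullet> \<nu> = 0" for \<nu> \<theta>
  proof -
    define G where "G m \<theta> = (rot_deriv u \<nu> ^^ m) f (cos \<theta> *\<^sub>R u + sin \<theta> *\<^sub>R \<nu>)" for m \<theta>
    have dG: "(G m has_vector_derivative G (Suc m) \<theta>) (at \<theta>)" for m \<theta>
      unfolding G_def[abs_def] funpow.simps o_def
      by (rule has_vector_derivative_circle[OF S smooth_on_funpow_rot_deriv[OF U f] u \<nu>])
    have nc: "norm (cos \<theta> *\<^sub>R u + sin \<theta> *\<^sub>R \<nu>) = 1" for \<theta>
    proof -
      have "(norm (cos \<theta> *\<^sub>R u + sin \<theta> *\<^sub>R \<nu>))\<^sup>2 = (cos \<theta>)\<^sup>2 + (sin \<theta>)\<^sup>2"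
        unfolding power2_norm_eq_inner using \<nu> uu by (simp add: inner_add_left inner_add_right inner_commute norm_eq_1 power2_eq_square)
      then show ?thesis by (simp add: power2_eq_1_iff) (metis norm_ge_zero neg_0_le_iff_le not_one_le_zero)
    qed
    have G4: "cmod (G 4 \<theta>) \<le> C" for \<theta> unfolding G_def by (rule C[OF \<nu>(1) nc])
    have dRe: "((\<lambda>\<theta>. Re (G m \<theta>)) has_real_derivative Re (G (Suc m) \<theta>)) (at \<theta>)" for m \<theta>
      using bounded_linear.has_vector_derivative[OF bounded_linear_Re dG] by (simp add: has_real_derivative_iff_has_vector_derivative)
    have dIm: "((\<lambda>\<theta>. Im (G m \<theta>)) has_real_derivative Im (G (Suc m) \<theta>)) (at \<theta>)" for m \<theta>
      using bounded_linear.has_vector_derivative[OF bounded_linear_Im dG] by (simp add: has_real_derivative_iff_has_vector_derivative)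
    have 1: "\<bar>Re (G 0 \<theta>) + Re (G 0 (- \<theta>)) - 2 * Re (G 0 0) - \<theta>\<^sup>2 * Re (G 2 0)\<bar> \<le> C * \<theta> ^ 4"
      by (rule taylor_even_real[where g="\<lambda>m \<theta>. Re (G m \<theta>)", OF dRe]) (meson G4 abs_Re_le_cmod order_trans)
    have 2: "\<bar>Im (G 0 \<theta>) + Im (G 0 (- \<theta>)) - 2 * Im (G 0 0) - \<theta>\<^sup>2 * Im (G 2 0)\<bar> \<le> C * \<theta> ^ 4"
      by (rule taylor_even_real[where g="\<lambda>m \<theta>. Im (G m \<theta>)", OF dIm]) (meson G4 abs_Im_le_cmod order_trans)
    have "cmod (G 0 \<theta> + G 0 (- \<theta>) - 2 * G 0 0 - of_real (\<theta>\<^sup>2) * G 2 0) \<le> C * \<theta> ^ 4 + C * \<theta> ^ 4"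
      by (rule order_trans[OF cmod_le], rule add_mono) (use 1 2 in simp_all)
    moreover have "G 2 0 = B \<nu> - D1" using second[OF \<nu>] by (simp add: G_def)
    ultimately show ?thesis by (simp add: G_def)
  qed
  \<comment> \<open>144 is the square of the 12 in \<open>one_minus_cos_ge\<close>; C bounds the
    Taylor remainder and D the second derivative met on passing from \<theta>^2 to (sin
    \<theta>)^2.\<close>
  define K where "K = 144 * (C + D)"
  have "cmod ((f x + f (2 *\<^sub>R (x \<bullet> u) *\<^sub>R u - x)) / 2 - (f u + (B (x - (x \<bullet> u) *\<^sub>R u)
            - of_real ((norm (x - (x \<bullet> u) *\<^sub>R u))\<^sup>2) * D1) / 2)) \<le> K * (1 - x \<bullet> u)\<^sup>2" if x: "norm x = 1" for x
  proof -
    define y where "y = x - (x \<bullet> u) *\<^sub>R u"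
    define \<theta> where "\<theta> = arccos (x \<bullet> u)"
    have xu: "-1 \<le> x \<bullet> u" "x \<bullet> u \<le> 1" using Cauchy_Schwarz_ineq2[of x u] x u by auto
    have \<theta>: "0 \<le> \<theta>" "\<theta> \<le> pi" "cos \<theta> = x \<bullet> u" using xu by (auto simp: \<theta>_def arccos_lbound arccos_ubound)
    have yu: "u \<bullet> y = 0" by (simp add: y_def inner_diff_right uu inner_commute)
    have xx: "x \<bullet> x = 1" using x by (simp add: norm_eq_1)
    have "(norm y)\<^sup>2 = 1 - (x \<bullet> u)\<^sup>2"
      unfolding power2_norm_eq_inner y_def by (simp add: inner_diff_left inner_diff_right uu xx inner_commute power2_eq_square)
    also have "\<dots> = (sin \<theta>)\<^sup>2" by (simp add: sin_squared_eq \<theta>)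
    finally have ny: "norm y = sin \<theta>" using sin_ge_zero[OF \<theta>(1,2)] by simp
    \<comment> \<open>If x is u or -u, every direction orthogonal to u serves, and one exists
      because the dimension is at least 2.\<close>
    obtain \<nu> where \<nu>: "norm \<nu> = 1" "u \<bullet> \<nu> = 0" "y = sin \<theta> *\<^sub>R \<nu>"
    proof (cases "y = 0")
      case True
      obtain a where a: "a \<noteq> 0" "orthogonal u a"
        using orthogonal_to_vector_exists[OF dim] by metis
      show thesis
        using a ny True by (intro that[of "a /\<^sub>R norm a"]) (auto simp: orthogonal_def)
    next
      case False
      show thesis
        using False yu by (intro that[of "y /\<^sub>R norm y"]) (auto simp flip: ny)
    qed
    have xeq: "x = cos \<theta> *\<^sub>R u + sin \<theta> *\<^sub>R \<nu>" "2 *\<^sub>R (x \<bullet> u) *\<^sub>R u - x = cos \<theta> *\<^sub>R u - sin \<theta> *\<^sub>R \<nu>"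
    proof -
      have "sin \<theta> *\<^sub>R \<nu> = x - (x \<bullet> u) *\<^sub>R u" using \<nu>(3) by (simp add: y_def)
      then show "x = cos \<theta> *\<^sub>R u + sin \<theta> *\<^sub>R \<nu>" "2 *\<^sub>R (x \<bullet> u) *\<^sub>R u - x = cos \<theta> *\<^sub>R u - sin \<theta> *\<^sub>R \<nu>"
        by (simp_all only: \<theta>(3) scaleR_2) simp_all
    qed
    have By: "B y = of_real ((sin \<theta>)\<^sup>2) * B \<nu>" unfolding \<nu>(3) by (rule Bs)
    have \<theta>4: "\<theta> ^ 4 \<le> 144 * (1 - x \<bullet> u)\<^sup>2"
    proof -
      have "(\<theta>\<^sup>2)\<^sup>2 \<le> (12 * (1 - cos \<theta>))\<^sup>2" using one_minus_cos_ge[OF \<theta>(1,2)] by (intro power_mono) auto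
      also have "(12 * (1 - cos \<theta>))\<^sup>2 = 144 * (1 - cos \<theta>)\<^sup>2" by (simp only: power_mult_distrib) simp
      finally show ?thesis by (simp add: \<theta> flip: power_mult)
    qed
    have Dle: "cmod (B \<nu> - D1) \<le> D" using D[OF \<nu>(1) u] second[OF \<nu>(1,2)] by simp
    have "(f x + f (2 *\<^sub>R (x \<bullet> u) *\<^sub>R u - x)) / 2 - (f u + (B y - of_real ((norm y)\<^sup>2) * D1) / 2)
      = ((f x + f (2 *\<^sub>R (x \<bullet> u) *\<^sub>R u - x) - 2 * f u - of_real (\<theta>\<^sup>2) * (B \<nu> - D1)) + of_real (\<theta>\<^sup>2 - (sin \<theta>)\<^sup>2) * (B \<nu> - D1)) / 2"
      unfolding By ny by (simp add: field_simps)
    also have "cmod \<dots> \<le> (2 * C * \<theta> ^ 4 + \<theta> ^ 4 / 3 * D) / 2"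
    proof -
      have "cmod (of_real (\<theta>\<^sup>2 - (sin \<theta>)\<^sup>2) * (B \<nu> - D1)) \<le> \<theta> ^ 4 / 3 * D"
        unfolding norm_mult norm_of_real by (intro mult_mono sin_square_diff_le Dle) auto
      moreover note taylor[OF \<nu>(1,2), of \<theta>, folded xeq]
      ultimately show ?thesis
        unfolding norm_divide by (simp add: divide_right_mono norm_triangle_le)
    qed
    also have "\<dots> \<le> (C + D) * \<theta> ^ 4" using D0 by (simp add: algebra_simps)
    also have "\<dots> \<le> (C + D) * (144 * (1 - x \<bullet> u)\<^sup>2)" using C0 D0 \<theta>4 by (intro mult_left_mono) auto
    finally show ?thesis unfolding K_def y_def by (simp only: mult_ac)
  qed
  moreover have "K \<ge> 0" using C0 D0 by (simp add: K_def)
  ultimately show thesis using that unfolding B_def D1_def by blast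
qed

section \<open>Second derivatives and the operators in the expansion\<close>

lemma second_difference_mvt:
  fixes g gv gvw :: "'a::real_normed_vector \<Rightarrow> real"
  assumes gv: "\<And>y. y \<in> U \<Longrightarrow> ((\<lambda>t. g (y + t *\<^sub>R v)) has_real_derivative gv y) (at 0)"
    and gvw: "\<And>y. y \<in> U \<Longrightarrow> ((\<lambda>t. gv (y + t *\<^sub>R w)) has_real_derivative gvw y) (at 0)"
    and U: "ball x r \<subseteq> U" and s: "s > 0" "s * (norm v + norm w) < r"
  obtains y where "norm (y - x) \<le> s * (norm v + norm w)"
    "g (x + s *\<^sub>R v + s *\<^sub>R w) - g (x + s *\<^sub>R v) - g (x + s *\<^sub>R w) + g x = s\<^sup>2 * gvw y"
proof -
  have near: "norm (a *\<^sub>R v + b *\<^sub>R w) \<le> s * (norm v + norm w)" if "0 \<le> a" "a \<le> s" "0 \<le> b" "b \<le> s" for a b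
  proof -
    have "norm (a *\<^sub>R v + b *\<^sub>R w) \<le> a * norm v + b * norm w"
      using norm_triangle_ineq[of "a *\<^sub>R v" "b *\<^sub>R w"] that by simp
    also have "\<dots> \<le> s * norm v + s * norm w" using that by (intro add_mono mult_right_mono) auto
    finally show ?thesis by (simp add: algebra_simps)
  qed
  have inU: "x + a *\<^sub>R v + b *\<^sub>R w \<in> U" if "0 \<le> a" "a \<le> s" "0 \<le> b" "b \<le> s" for a b
  proof (rule subsetD[OF U])
    have "dist x (x + z) = norm z" for z by (simp add: dist_norm)
    then have "dist x (x + (a *\<^sub>R v + b *\<^sub>R w)) < r" using near[OF that] s(2) by (simp only:)
    then show "x + a *\<^sub>R v + b *\<^sub>R w \<in> ball x r" by (simp only: mem_ball add.assoc)
  qed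
  have shift: "((\<lambda>t. g (y + t *\<^sub>R v)) has_real_derivative gv (y + a *\<^sub>R v)) (at a)" if "y + a *\<^sub>R v \<in> U" for y a
  proof -
    have e: "y + (t + a) *\<^sub>R v = y + a *\<^sub>R v + t *\<^sub>R v" for t by (simp add: scaleR_add_left)
    have "((\<lambda>t. g (y + (t + a) *\<^sub>R v)) has_real_derivative gv (y + a *\<^sub>R v)) (at 0)"
      unfolding e by (rule gv[OF that])
    then show ?thesis
      using DERIV_shift[of "\<lambda>t. g (y + t *\<^sub>R v)" "gv (y + a *\<^sub>R v)" 0 a] by (simp only: add_0)
  qed
  have shift2: "((\<lambda>t. gv (y + t *\<^sub>R w)) has_real_derivative gvw (y + a *\<^sub>R w)) (at a)" if "y + a *\<^sub>R w \<in> U" for y a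
  proof -
    have e: "y + (t + a) *\<^sub>R w = y + a *\<^sub>R w + t *\<^sub>R w" for t by (simp add: scaleR_add_left)
    have "((\<lambda>t. gv (y + (t + a) *\<^sub>R w)) has_real_derivative gvw (y + a *\<^sub>R w)) (at 0)"
      unfolding e by (rule gvw[OF that])
    then show ?thesis
      using DERIV_shift[of "\<lambda>t. gv (y + t *\<^sub>R w)" "gvw (y + a *\<^sub>R w)" 0 a] by (simp only: add_0)
  qed
  have "\<exists>a. 0 < a \<and> a < s \<and> (g ((x + s *\<^sub>R w) + s *\<^sub>R v) - g (x + s *\<^sub>R v)) - (g ((x + s *\<^sub>R w) + 0 *\<^sub>R v) - g (x + 0 *\<^sub>R v))
      = (s - 0) * (gv ((x + s *\<^sub>R w) + a *\<^sub>R v) - gv (x + a *\<^sub>R v))"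
  proof (rule MVT2[OF s(1)])
    fix a assume "0 \<le> a" "a \<le> s"
    then show "((\<lambda>t. g (x + s *\<^sub>R w + t *\<^sub>R v) - g (x + t *\<^sub>R v)) has_real_derivative gv (x + s *\<^sub>R w + a *\<^sub>R v) - gv (x + a *\<^sub>R v)) (at a)"
      using inU[of a s] inU[of a 0] s by (intro DERIV_diff shift) (auto simp: add_ac)
  qed
  then obtain a where a: "0 < a" "a < s" "g (x + s *\<^sub>R v + s *\<^sub>R w) - g (x + s *\<^sub>R v) - g (x + s *\<^sub>R w) + g x
      = s * (gv (x + s *\<^sub>R w + a *\<^sub>R v) - gv (x + a *\<^sub>R v))"
    by (auto simp: algebra_simps)
  have "\<exists>b. 0 < b \<and> b < s \<and> gv (x + a *\<^sub>R v + s *\<^sub>R w) - gv (x + a *\<^sub>R v + 0 *\<^sub>R w) = (s - 0) * gvw (x + a *\<^sub>R v + b *\<^sub>R w)"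
    by (rule MVT2[OF s(1)]) (intro shift2 inU, use a in auto)
  then obtain b where b: "0 < b" "b < s" "gv (x + a *\<^sub>R v + s *\<^sub>R w) - gv (x + a *\<^sub>R v) = s * gvw (x + a *\<^sub>R v + b *\<^sub>R w)"
    by auto
  show thesis
  proof (rule that)
    show "norm ((x + a *\<^sub>R v + b *\<^sub>R w) - x) \<le> s * (norm v + norm w)"
      using near[of a b] a b by (simp add: add.assoc)
    show "g (x + s *\<^sub>R v + s *\<^sub>R w) - g (x + s *\<^sub>R v) - g (x + s *\<^sub>R w) + g x = s\<^sup>2 * gvw (x + a *\<^sub>R v + b *\<^sub>R w)"
      unfolding a(3) using b(3) by (simp add: power2_eq_square add_ac)
  qed
qed

text \<open>Schwarz's theorem: the second difference over a small parallelogram does not depend on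
  the order of the directions, and the mean value theorem expresses it by either mixed derivative at
  a nearby point. The mean value theorem confines the lemma to real functions.\<close>

lemma mixed_partials_eq_real:
  fixes g gv gw gvw gwv :: "'a::real_normed_vector \<Rightarrow> real"
  assumes U: "open U" "x \<in> U"
    and gv: "\<And>y. y \<in> U \<Longrightarrow> ((\<lambda>t. g (y + t *\<^sub>R v)) has_real_derivative gv y) (at 0)"
    and gw: "\<And>y. y \<in> U \<Longrightarrow> ((\<lambda>t. g (y + t *\<^sub>R w)) has_real_derivative gw y) (at 0)"
    and gvw: "\<And>y. y \<in> U \<Longrightarrow> ((\<lambda>t. gv (y + t *\<^sub>R w)) has_real_derivative gvw y) (at 0)"
    and gwv: "\<And>y. y \<in> U \<Longrightarrow> ((\<lambda>t. gw (y + t *\<^sub>R v)) has_real_derivative gwv y) (at 0)"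
    and cont: "continuous_on U gvw" "continuous_on U gwv"
  shows "gvw x = gwv x"
proof (rule ccontr)
  assume "gvw x \<noteq> gwv x"
  define e where "e = \<bar>gvw x - gwv x\<bar> / 2"
  have e: "e > 0" using \<open>gvw x \<noteq> gwv x\<close> by (simp add: e_def)
  have "isCont gvw x" "isCont gwv x" using cont U by (auto simp: continuous_on_eq_continuous_at)
  then obtain d1 d2 where d: "d1 > 0" "d2 > 0" "\<And>y. dist y x < d1 \<Longrightarrow> dist (gvw y) (gvw x) < e" "\<And>y. dist y x < d2 \<Longrightarrow> dist (gwv y) (gwv x) < e"
    using e unfolding continuous_at_eps_delta by metis
  obtain r where r: "r > 0" "ball x r \<subseteq> U" using U open_contains_ball by blast
  define m where "m = min r (min d1 d2)"
  define s where "s = m / (2 * (norm v + norm w + 1))"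
  have m: "m > 0" using r d by (simp add: m_def)
  have pos: "norm v + norm w + 1 > 0" by (simp add: add_nonneg_pos)
  have s: "s > 0" "s * (norm v + norm w) < m"
  proof -
    show "s > 0" using m pos by (simp add: s_def)
    have "s * (norm v + norm w) \<le> s * (norm v + norm w + 1)" using \<open>s > 0\<close> by (intro mult_left_mono) auto
    also have "\<dots> = m / 2" using pos by (simp add: s_def field_simps)
    finally show "s * (norm v + norm w) < m" using m by simp
  qed
  have sr: "s * (norm v + norm w) < r" "s * (norm w + norm v) < r" using s by (auto simp: m_def add.commute)
  obtain y where y: "norm (y - x) \<le> s * (norm v + norm w)"
    "g (x + s *\<^sub>R v + s *\<^sub>R w) - g (x + s *\<^sub>R v) - g (x + s *\<^sub>R w) + g x = s\<^sup>2 * gvw y"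
    using second_difference_mvt[OF gv gvw r(2) s(1) sr(1)] by blast
  obtain y' where y': "norm (y' - x) \<le> s * (norm w + norm v)"
    "g (x + s *\<^sub>R w + s *\<^sub>R v) - g (x + s *\<^sub>R w) - g (x + s *\<^sub>R v) + g x = s\<^sup>2 * gwv y'"
    using second_difference_mvt[OF gw gwv r(2) s(1) sr(2)] by blast
  have "g (x + s *\<^sub>R v + s *\<^sub>R w) = g (x + s *\<^sub>R w + s *\<^sub>R v)" by (simp add: add_ac)
  then have "s\<^sup>2 * gvw y = s\<^sup>2 * gwv y'" using y(2) y'(2) by linarith
  then have "gvw y = gwv y'" using s(1) by simp
  moreover have "dist y x < d1" "dist y' x < d2"
    using y(1) y'(1) s(2) by (auto simp: dist_norm m_def add.commute)
  then have "\<bar>gvw y - gvw x\<bar> < e" "\<bar>gwv y' - gwv x\<bar> < e" using d by (auto simp: dist_real_def)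
  ultimately show False unfolding e_def by (auto simp: abs_if split: if_splits)
qed

lemma has_real_derivative_dir_deriv:
  fixes f :: "'a::real_normed_vector \<Rightarrow> complex"
  assumes "f differentiable (at y)"
  shows "((\<lambda>t. Re (f (y + t *\<^sub>R v))) has_real_derivative Re (dir_deriv f v y)) (at 0)"
    and "((\<lambda>t. Im (f (y + t *\<^sub>R v))) has_real_derivative Im (dir_deriv f v y)) (at 0)"
proof -
  have "((\<lambda>t. y + t *\<^sub>R v) has_vector_derivative v) (at 0)"
    by (auto intro!: derivative_eq_intros simp: has_vector_derivative_def)
  moreover have "(f has_derivative frechet_derivative f (at y)) (at (y + 0 *\<^sub>R v) within range (\<lambda>t. y + t *\<^sub>R v))"
    using frechet_derivative_works[THEN iffD1, OF assms] by (simp add: has_derivative_at_withinI)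
  ultimately have "(f \<circ> (\<lambda>t. y + t *\<^sub>R v) has_vector_derivative dir_deriv f v y) (at 0)"
    by (rule vector_derivative_diff_chain_within)
  from bounded_linear.has_vector_derivative[OF bounded_linear_Re this] bounded_linear.has_vector_derivative[OF bounded_linear_Im this]
  show "((\<lambda>t. Re (f (y + t *\<^sub>R v))) has_real_derivative Re (dir_deriv f v y)) (at 0)"
    "((\<lambda>t. Im (f (y + t *\<^sub>R v))) has_real_derivative Im (dir_deriv f v y)) (at 0)"
    by (simp_all add: has_real_derivative_iff_has_vector_derivative o_def)
qed

lemma mixed_dir_deriv_eq:
  fixes f :: "'a::real_inner \<Rightarrow> complex"
  assumes U: "open U" "x \<in> U" and f: "smooth_on U f"
  shows "dir_deriv (\<lambda>y. dir_deriv f v y) w x = dir_deriv (\<lambda>y. dir_deriv f w y) v x"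
proof (rule complex_eqI)
  note d = smooth_on_differentiable[OF f] smooth_on_differentiable[OF smooth_on_dir_deriv[OF f]]
  have c: "continuous_on U (\<lambda>x. dir_deriv (\<lambda>y. dir_deriv f v y) w x)" for v w
    by (rule smooth_on_continuous_on[OF smooth_on_dir_deriv[OF smooth_on_dir_deriv[OF f]]])
  show "Re (dir_deriv (\<lambda>y. dir_deriv f v y) w x) = Re (dir_deriv (\<lambda>y. dir_deriv f w y) v x)"
    by (rule mixed_partials_eq_real[where v=v and w=w and g="\<lambda>y. Re (f y)" and gv="\<lambda>y. Re (dir_deriv f v y)" and gw="\<lambda>y. Re (dir_deriv f w y)"
      and gvw="\<lambda>x. Re (dir_deriv (\<lambda>y. dir_deriv f v y) w x)" and gwv="\<lambda>x. Re (dir_deriv (\<lambda>y. dir_deriv f w y) v x)", OF U])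
      (intro has_real_derivative_dir_deriv d continuous_on_Re c | assumption)+
  show "Im (dir_deriv (\<lambda>y. dir_deriv f v y) w x) = Im (dir_deriv (\<lambda>y. dir_deriv f w y) v x)"
    by (rule mixed_partials_eq_real[where v=v and w=w and g="\<lambda>y. Im (f y)" and gv="\<lambda>y. Im (dir_deriv f v y)" and gw="\<lambda>y. Im (dir_deriv f w y)"
      and gvw="\<lambda>x. Im (dir_deriv (\<lambda>y. dir_deriv f v y) w x)" and gwv="\<lambda>x. Im (dir_deriv (\<lambda>y. dir_deriv f w y) v x)", OF U])
      (intro has_real_derivative_dir_deriv d continuous_on_Im c | assumption)+
qed

lemma sum_Basis_vec:
  fixes f :: "complex^'n::finite \<Rightarrow> 'b::comm_monoid_add"
  shows "(\<Sum>b\<in>Basis. f b) = (\<Sum>j\<in>UNIV. f (axis j 1) + f (axis j \<i>))"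
proof -
  have B: "Basis = (\<lambda>(j, s). axis j s :: complex^'n) ` (UNIV \<times> {1, \<i>})"
    by (auto simp: Basis_vec_def Basis_complex_def)
  have inj: "inj_on (\<lambda>(j, s). axis j s :: complex^'n) (UNIV \<times> {1, \<i>})"
    by (auto simp: inj_on_def axis_eq_axis)
  have "(\<Sum>b\<in>Basis. f b) = (\<Sum>(j, s)\<in>UNIV \<times> {1, \<i>}. f (axis j s))"
    unfolding B sum.reindex[OF inj] by (simp add: o_def case_prod_unfold)
  also have "\<dots> = (\<Sum>j\<in>UNIV. \<Sum>s\<in>{1, \<i>}. f (axis j s))" by (rule sum.cartesian_product[symmetric])
  finally show ?thesis by simp
qed

text \<open>The product of the two Wirtinger operators also contains the mixed real derivatives with
  factors i and -i; these cancel by symmetry.\<close>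

lemma complex_laplace_eq:
  fixes f :: "complex^'n::finite \<Rightarrow> complex"
  assumes U: "open U" "x \<in> U" and f: "smooth_on U f"
  shows "4 * complex_laplace f x = (\<Sum>b\<in>Basis. dir_deriv (\<lambda>y. dir_deriv f b y) b x)"
proof -
  have "4 * wirtinger j (wirtinger_bar j f) x
     = dir_deriv (\<lambda>y. dir_deriv f (axis j 1) y) (axis j 1) x + dir_deriv (\<lambda>y. dir_deriv f (axis j \<i>) y) (axis j \<i>) x" for j
  proof -
    define p where "p y = dir_deriv f (axis j 1) y" for y
    define q where "q y = dir_deriv f (axis j \<i>) y" for y
    have "(p has_derivative frechet_derivative p (at x)) (at x)" "(q has_derivative frechet_derivative q (at x)) (at x)"
      unfolding p_def[abs_def] q_def[abs_def]
      using frechet_derivative_works[THEN iffD1, OF smooth_on_differentiable[OF smooth_on_dir_deriv[OF f] U(2)]] by auto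
    then have "(wirtinger_bar j f has_derivative (\<lambda>v. (dir_deriv p v x + \<i> * dir_deriv q v x) / 2)) (at x)"
      unfolding wirtinger_bar_def[abs_def] p_def[symmetric] q_def[symmetric]
      by (auto intro!: derivative_eq_intros)
    note fd = frechet_derivative_at[OF this, symmetric]
    have "dir_deriv p (axis j \<i>) x = dir_deriv q (axis j 1) x"
      unfolding p_def[abs_def] q_def[abs_def] by (rule mixed_dir_deriv_eq[OF U f])
    then show ?thesis
      unfolding wirtinger_def[of _ "wirtinger_bar j f"] fd p_def[symmetric] q_def[symmetric]
      by (simp add: field_simps)
  qed
  then show ?thesis by (simp add: complex_laplace_def sum_distrib_left sum_Basis_vec)
qed

lemma radial_deriv_eq:
  fixes f :: "complex^'n::finite \<Rightarrow> complex"
  assumes f: "f differentiable (at x)"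
  shows "radial_deriv f x = dir_deriv f x x"
proof -
  define T where "T v = dir_deriv f v x" for v
  have lin: "linear T" using linear_frechet_derivative[OF f] by (simp add: T_def[abs_def])
  have "T x = T (\<Sum>b\<in>Basis. (x \<bullet> b) *\<^sub>R b)" by (simp add: euclidean_representation)
  also have "\<dots> = (\<Sum>b\<in>Basis. (x \<bullet> b) *\<^sub>R T b)" by (simp add: linear_sum[OF lin] linear_scale[OF lin])
  also have "\<dots> = (\<Sum>j\<in>UNIV. (x \<bullet> axis j 1) *\<^sub>R T (axis j 1) + (x \<bullet> axis j \<i>) *\<^sub>R T (axis j \<i>))" by (rule sum_Basis_vec)
  also have "\<dots> = radial_deriv f x"
    unfolding radial_deriv_def wirtinger_def wirtinger_bar_def T_def[symmetric]
  proof (intro sum.cong refl)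
    fix j
    have i: "x \<bullet> axis j 1 = Re (x $ j)" "x \<bullet> axis j \<i> = Im (x $ j)" by (simp_all add: inner_axis inner_complex_def)
    show "(x \<bullet> axis j 1) *\<^sub>R T (axis j 1) + (x \<bullet> axis j \<i>) *\<^sub>R T (axis j \<i>)
      = x $ j * ((T (axis j 1) - \<i> * T (axis j \<i>)) / 2) + cnj (x $ j) * ((T (axis j 1) + \<i> * T (axis j \<i>)) / 2)"
      unfolding i by (simp add: complex_eq_iff field_simps)
  qed
  finally show ?thesis by (simp add: T_def)
qed

text \<open>The second application also differentiates the coefficients of the radial field, giving
  an extra first-order term. It turns the factor 2n - 2 of the theorem into the 2n - 1 of the
  spherical Laplacian.\<close>

lemma radial_deriv_twice:
  fixes f :: "complex^'n::finite \<Rightarrow> complex"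
  assumes U: "open U" "x \<in> U" and f: "smooth_on U f"
  shows "radial_deriv (radial_deriv f) x = dir_deriv (\<lambda>y. dir_deriv f x y) x x + dir_deriv f x x"
proof -
  define g where "g y = (\<Sum>b\<in>Basis. (y \<bullet> b) *\<^sub>R dir_deriv f b y)" for y
  have lin_rep: "dir_deriv f v y = (\<Sum>b\<in>Basis. (v \<bullet> b) *\<^sub>R dir_deriv f b y)" if "y \<in> U" for y v
  proof -
    define T where "T v = dir_deriv f v y" for v
    have lin: "linear T" unfolding T_def[abs_def] by (rule dir_deriv_linear[OF f that])
    have "T v = T (\<Sum>b\<in>Basis. (v \<bullet> b) *\<^sub>R b)" by (simp add: euclidean_representation)
    also have "\<dots> = (\<Sum>b\<in>Basis. (v \<bullet> b) *\<^sub>R T b)" by (simp add: linear_sum[OF lin] linear_scale[OF lin])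
    finally show ?thesis by (simp add: T_def)
  qed
  have rg: "radial_deriv f y = g y" if "y \<in> U" for y
    using radial_deriv_eq[OF smooth_on_differentiable[OF f that]] lin_rep[OF that, of y] by (simp add: g_def)
  have hd: "((\<lambda>y. dir_deriv f b y) has_derivative (\<lambda>v. dir_deriv (\<lambda>y. dir_deriv f b y) v x)) (at x)" for b
    using frechet_derivative_works[THEN iffD1, OF smooth_on_differentiable[OF smooth_on_dir_deriv[OF f] U(2)]] by simp
  have gd: "(g has_derivative (\<lambda>v. \<Sum>b\<in>Basis. (x \<bullet> b) *\<^sub>R dir_deriv (\<lambda>y. dir_deriv f b y) v x + (v \<bullet> b) *\<^sub>R dir_deriv f b x)) (at x)"
    unfolding g_def[abs_def] by (intro has_derivative_sum has_derivative_scaleR hd has_derivative_inner_left has_derivative_ident)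
  then have rd: "radial_deriv f differentiable (at x)"
    unfolding differentiable_def
    using has_derivative_transform_within_open[OF gd U, of "radial_deriv f"] rg by metis
  have "radial_deriv (radial_deriv f) x = dir_deriv (radial_deriv f) x x" by (rule radial_deriv_eq[OF rd])
  also have "\<dots> = dir_deriv g x x" using frechet_derivative_cong_open[OF U rg] by simp
  also have "\<dots> = (\<Sum>b\<in>Basis. (x \<bullet> b) *\<^sub>R dir_deriv (\<lambda>y. dir_deriv f b y) x x) + g x"
    using frechet_derivative_at[OF gd, symmetric] by (simp add: g_def sum.distrib)
  also have "g x = dir_deriv f x x" using lin_rep[OF U(2), of x] by (simp add: g_def)
  also have "(\<Sum>b\<in>Basis. (x \<bullet> b) *\<^sub>R dir_deriv (\<lambda>y. dir_deriv f b y) x x) = dir_deriv (\<lambda>y. dir_deriv f x y) x x"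
  proof -
    have "((\<lambda>y. \<Sum>b\<in>Basis. (x \<bullet> b) *\<^sub>R dir_deriv f b y) has_derivative (\<lambda>v. \<Sum>b\<in>Basis. (x \<bullet> b) *\<^sub>R dir_deriv (\<lambda>y. dir_deriv f b y) v x)) (at x)"
      by (intro has_derivative_sum has_derivative_scaleR_right hd)
    from frechet_derivative_at[OF this, symmetric] frechet_derivative_cong_open[OF U lin_rep[of _ x]]
    show ?thesis by simp
  qed
  finally show ?thesis .
qed

section \<open>The mean of a quadratic form\<close>

text \<open>For v = 0 the quotient is 0 and the map is the identity.\<close>

definition reflection :: "'a::real_inner \<Rightarrow> 'a \<Rightarrow> 'a" where
  "reflection v x = x - (2 * (x \<bullet> v) / (v \<bullet> v)) *\<^sub>R v"

lemma orthogonal_transformation_reflection: "orthogonal_transformation (reflection v)"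
  unfolding orthogonal_transformation_def
proof (intro conjI allI)
  show "linear (reflection v)"
    by (rule linearI) (simp_all add: reflection_def inner_add_left algebra_simps add_divide_distrib)
  show "reflection v a \<bullet> reflection v b = a \<bullet> b" for a b
  proof (cases "v = 0")
    case False
    then have "v \<bullet> v \<noteq> 0" by simp
    then show ?thesis
      by (simp add: reflection_def inner_diff_left inner_diff_right inner_commute[of v b] field_simps)
  qed (simp add: reflection_def)
qed

text \<open>The coefficients are real. Consequently the density is invariant under conjugation of
  \<zeta>.\<close>

lemma coherent_series_cnj: "n \<ge> 2 \<Longrightarrow> coherent_series n \<rho> (cnj c) = cnj (coherent_series n \<rho> c)"
proof -
  assume n: "n \<ge> 2"
  have "(\<lambda>l. of_real (coherent_coeff n \<rho> l) * c ^ l) sums coherent_series n \<rho> c"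
    unfolding coherent_series_def
    by (rule summable_sums[OF entire_coeffs_summable[OF entire_coeffs_coherent[OF n]]])
  from sums_cnj[THEN iffD2, OF this] show ?thesis by (simp add: coherent_series_def sums_iff)
qed

text \<open>Admitting maps that conjugate \<zeta> goes beyond the unitary group. It covers real
  reflections, among them the one that reverses i u.\<close>

lemma LINT_coherent_orthogonal:
  fixes u :: "complex^'n::finite"
  assumes n: "CARD('n) \<ge> 2" and W: "orthogonal_transformation W"
    and inv: "\<And>x. herm_inner (W x) u = herm_inner x u \<or> herm_inner (W x) u = cnj (herm_inner x u)"
    and f: "continuous_on (sphere 0 1) f"
  shows "(LINT x|sphere_measure. f (W x) * complex_of_real (coherent_density \<rho> u x))
    = (LINT x|sphere_measure. f x * of_real (coherent_density \<rho> u x))"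
proof -
  have "coherent_density \<rho> u (W x) = coherent_density \<rho> u x" for x
    using inv[of x] by (auto simp: coherent_density_def coherent_series_cnj[OF n])
  moreover have "(LINT x|sphere_measure. f (W x) * complex_of_real (coherent_density \<rho> u (W x)))
    = (LINT x|sphere_measure. f x * of_real (coherent_density \<rho> u x))"
    by (rule integral_sphere_orthogonal[OF W borel_measurable_sphere_measureI])
      (intro continuous_intros f continuous_on_coherent_density[OF n])
  ultimately show ?thesis by simp
qed

lemma Basis_vec_nth:
  assumes "b \<in> (Basis :: (complex^'n::finite) set)" "b \<noteq> axis k 1"
  shows "b $ k = 0 \<or> b = axis k \<i>"
  using assms by (auto simp: Basis_vec_def Basis_complex_def axis_def)

lemma coherent_cross_moment_0:
  fixes k :: "'n::finite" and b c :: "complex^'n"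
  assumes n: "CARD('n) \<ge> 2" and b: "b \<in> Basis" "b \<noteq> axis k 1" and c: "c \<in> Basis" "c \<noteq> b"
  shows "(LINT x|sphere_measure. complex_of_real ((x \<bullet> b) * (x \<bullet> c)) * of_real (coherent_density \<rho> (axis k 1) x)) = 0"
proof -
  let ?u = "axis k (1::complex)"
  have bb: "b \<bullet> b = 1" "b \<bullet> c = 0" using b c by (auto simp: inner_Basis)
  have Rb: "reflection b x \<bullet> b = - (x \<bullet> b)" "reflection b x \<bullet> c = x \<bullet> c" for x
    by (simp_all add: reflection_def inner_diff_left bb)
  have Ru: "herm_inner (reflection b x) ?u = herm_inner x ?u \<or> herm_inner (reflection b x) ?u = cnj (herm_inner x ?u)" for x
  proof (cases "b $ k = 0")
    case False
    then have bk: "b = axis k \<i>" using Basis_vec_nth[OF b] by blast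
    have "x \<bullet> b = Im (x $ k)" by (simp add: bk inner_axis inner_complex_def)
    then have "reflection b x $ k = cnj (x $ k)"
      by (simp add: reflection_def bb bk complex_eq_iff)
    then show ?thesis by simp
  qed (simp add: reflection_def)
  have "(LINT x|sphere_measure. complex_of_real ((x \<bullet> b) * (x \<bullet> c)) * of_real (coherent_density \<rho> ?u x))
    = (LINT x|sphere_measure. complex_of_real ((reflection b x \<bullet> b) * (reflection b x \<bullet> c)) * of_real (coherent_density \<rho> ?u x))"
    by (rule LINT_coherent_orthogonal[OF n orthogonal_transformation_reflection Ru, symmetric])
      (intro continuous_intros)
  also have "\<dots> = - (LINT x|sphere_measure. complex_of_real ((x \<bullet> b) * (x \<bullet> c)) * of_real (coherent_density \<rho> ?u x))"
    by (simp add: Rb)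
  finally show ?thesis by simp
qed

text \<open>Reflecting along b - c exchanges two real coordinates transversal to the complex line of
  e_k, so all 2n - 2 of these have the same mean square, while the squares sum to 1 -
  |\<zeta>|^2.\<close>

lemma coherent_square_moment:
  fixes k :: "'n::finite" and b :: "complex^'n"
  assumes n: "CARD('n) \<ge> 2" and b: "b \<in> Basis" "b $ k = 0"
  shows "(LINT x|sphere_measure. complex_of_real ((x \<bullet> b) * (x \<bullet> b)) * of_real (coherent_density \<rho> (axis k 1) x))
    = (LINT x|sphere_measure. of_real (1 - (cmod (x $ k))\<^sup>2) * of_real (coherent_density \<rho> (axis k 1) x)) / of_nat (2 * CARD('n) - 2)"
proof -
  let ?u = "axis k (1::complex)"
  define I where "I b = (LINT x|sphere_measure. complex_of_real ((x \<bullet> b) * (x \<bullet> b)) * of_real (coherent_density \<rho> ?u x))" for b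
  define B' where "B' = (Basis :: (complex^'n) set) - {axis k 1} - {axis k \<i>}"
  have inB: "axis k 1 \<in> (Basis :: (complex^'n) set)" "axis k \<i> \<in> (Basis :: (complex^'n) set)"
    by (auto simp: axis_in_Basis_iff Basis_complex_def)
  have ne: "axis k 1 \<noteq> (axis k \<i> :: complex^'n)" by (simp add: axis_eq_axis)
  have B'0: "c $ k = 0" if "c \<in> B'" for c
    using Basis_vec_nth[of c k] that by (auto simp: B'_def)
  have bB: "b \<in> B'" using b by (auto simp: B'_def axis_def)
  have swap: "I c = I b" if c: "c \<in> B'" for c
  proof (cases "c = b")
    case False
    have bc: "b \<bullet> b = 1" "c \<bullet> c = 1" "b \<bullet> c = 0" "c \<bullet> b = 0"
      using b(1) c False by (auto simp: inner_Basis B'_def)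
    have R: "reflection (b - c) x \<bullet> b = x \<bullet> c" for x
      by (simp add: reflection_def inner_diff_left inner_diff_right bc diff_divide_distrib)
    have Ru: "herm_inner (reflection (b - c) x) ?u = herm_inner x ?u \<or> herm_inner (reflection (b - c) x) ?u = cnj (herm_inner x ?u)" for x
      using b(2) B'0[OF c] by (simp add: reflection_def)
    have "I b = (LINT x|sphere_measure. complex_of_real ((reflection (b - c) x \<bullet> b) * (reflection (b - c) x \<bullet> b)) * of_real (coherent_density \<rho> ?u x))"
      unfolding I_def
      by (rule LINT_coherent_orthogonal[OF n orthogonal_transformation_reflection Ru, symmetric]) (intro continuous_intros)
    then show ?thesis by (simp add: R I_def)
  qed simp
  have "(LINT x|sphere_measure. of_real (1 - (cmod (x $ k))\<^sup>2) * complex_of_real (coherent_density \<rho> ?u x))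
    = (LINT x|sphere_measure. (\<Sum>c\<in>B'. complex_of_real ((x \<bullet> c) * (x \<bullet> c)) * of_real (coherent_density \<rho> ?u x)))"
  proof (rule LINT_sphere_cong)
    fix x :: "complex^'n" assume "norm x = 1"
    then have "1 = (\<Sum>c\<in>Basis. (x \<bullet> c) * (x \<bullet> c))" using euclidean_inner[of x x] by (simp add: norm_eq_1)
    also have "\<dots> = (x \<bullet> axis k 1) * (x \<bullet> axis k 1) + ((x \<bullet> axis k \<i>) * (x \<bullet> axis k \<i>) + (\<Sum>c\<in>B'. (x \<bullet> c) * (x \<bullet> c)))"
    proof -
      have "(\<Sum>c\<in>Basis. (x \<bullet> c) * (x \<bullet> c)) = (x \<bullet> axis k 1) * (x \<bullet> axis k 1) + (\<Sum>c\<in>Basis - {axis k 1}. (x \<bullet> c) * (x \<bullet> c))"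
        by (rule sum.remove[OF finite_Basis inB(1)])
      also have "(\<Sum>c\<in>Basis - {axis k 1}. (x \<bullet> c) * (x \<bullet> c)) = (x \<bullet> axis k \<i>) * (x \<bullet> axis k \<i>) + (\<Sum>c\<in>B'. (x \<bullet> c) * (x \<bullet> c))"
        unfolding B'_def using inB ne by (intro sum.remove) auto
      finally show ?thesis .
    qed
    also have "x \<bullet> axis k 1 = Re (x $ k)" by (simp add: inner_axis inner_complex_def)
    also have "x \<bullet> axis k \<i> = Im (x $ k)" by (simp add: inner_axis inner_complex_def)
    finally have "1 - (cmod (x $ k))\<^sup>2 = (\<Sum>c\<in>B'. (x \<bullet> c) * (x \<bullet> c))"
      unfolding cmod_power2 by (simp add: power2_eq_square)
    then show "of_real (1 - (cmod (x $ k))\<^sup>2) * complex_of_real (coherent_density \<rho> ?u x)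
      = (\<Sum>c\<in>B'. complex_of_real ((x \<bullet> c) * (x \<bullet> c)) * of_real (coherent_density \<rho> ?u x))"
      by (simp add: sum_distrib_right)
  qed
  also have "\<dots> = (\<Sum>c\<in>B'. I c)"
    unfolding I_def
    by (intro Bochner_Integration.integral_sum integrable_sphere_continuous continuous_intros continuous_on_coherent_density[OF n])
  also have "\<dots> = of_nat (card B') * I b" by (simp add: swap)
  also have "card B' = 2 * CARD('n) - 2"
    unfolding B'_def using inB ne by (simp add: card_Diff_singleton)
  finally show ?thesis using n by (simp add: I_def divide_simps)
qed

text \<open>The vectors W b form another orthonormal basis. This permits computing in coordinates
  adapted to u while the trace stays with the standard basis.\<close>

lemma trace_bilinear_orthogonal:
  fixes B :: "'a::euclidean_space \<Rightarrow> 'a \<Rightarrow> 'b::real_vector" and W :: "'a \<Rightarrow> 'a"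
  assumes B: "bilinear B" and W: "orthogonal_transformation W"
  shows "(\<Sum>b\<in>Basis. B (W b) (W b)) = (\<Sum>b\<in>Basis. B b b)"
proof -
  have surj: "\<exists>c'. c = W c'" for c using orthogonal_transformation_surj[OF W] by (metis surjD)
  have inn: "W a \<bullet> W b = a \<bullet> b" for a b using W by (simp add: orthogonal_transformation_def)
  have ortho: "(\<Sum>b\<in>Basis. (W b \<bullet> c) * (W b \<bullet> d)) = c \<bullet> d" for c d
  proof -
    obtain c' d' where "c = W c'" "d = W d'" using surj by metis
    then show ?thesis using euclidean_inner[of c' d'] by (simp add: inn inner_commute)
  qed
  have "B (W b) (W b) = (\<Sum>c\<in>Basis. \<Sum>d\<in>Basis. ((W b \<bullet> c) * (W b \<bullet> d)) *\<^sub>R B c d)" for b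
  proof -
    have "B (W b) (W b) = B (\<Sum>c\<in>Basis. (W b \<bullet> c) *\<^sub>R c) (\<Sum>d\<in>Basis. (W b \<bullet> d) *\<^sub>R d)"
      by (simp only: euclidean_representation)
    also have "\<dots> = (\<Sum>(c, d)\<in>Basis \<times> Basis. ((W b \<bullet> c) * (W b \<bullet> d)) *\<^sub>R B c d)"
      by (subst bilinear_sum[OF B]) (simp_all add: bilinear_lmul[OF B] bilinear_rmul[OF B] mult.commute)
    finally show ?thesis by (simp add: sum.cartesian_product)
  qed
  then have "(\<Sum>b\<in>Basis. B (W b) (W b)) = (\<Sum>b\<in>Basis. \<Sum>c\<in>Basis. \<Sum>d\<in>Basis. ((W b \<bullet> c) * (W b \<bullet> d)) *\<^sub>R B c d)" by simp
  also have "\<dots> = (\<Sum>c\<in>Basis. \<Sum>b\<in>Basis. \<Sum>d\<in>Basis. ((W b \<bullet> c) * (W b \<bullet> d)) *\<^sub>R B c d)" by (rule sum.swap)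
  also have "\<dots> = (\<Sum>c\<in>Basis. \<Sum>d\<in>Basis. \<Sum>b\<in>Basis. ((W b \<bullet> c) * (W b \<bullet> d)) *\<^sub>R B c d)" by (intro sum.cong refl sum.swap)
  also have "\<dots> = (\<Sum>c\<in>Basis. \<Sum>d\<in>Basis. (if d = c then B c d else 0))"
    by (intro sum.cong refl) (simp add: ortho inner_Basis flip: scaleR_sum_left)
  also have "\<dots> = (\<Sum>c\<in>Basis. B c c)" by (simp add: sum.delta)
  finally show ?thesis .
qed

lemma continuous_on_bilinear_diag:
  fixes B :: "'a::euclidean_space \<Rightarrow> 'a \<Rightarrow> complex" and f :: "'a \<Rightarrow> 'a"
  assumes B: "bilinear B" and f: "continuous_on S f"
  shows "continuous_on S (\<lambda>x. B (f x) (f x))"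
  using bilinear_continuous_on_compose[OF f f B] .

text \<open>Only diagonal terms survive. The direction i e_k keeps its own mean square, since the
  density depends on Im \<zeta>, while the other directions share one value and contribute through
  the rest of the trace.\<close>

lemma coherent_mean_bilinear_axis:
  fixes k :: "'n::finite" and B :: "complex^'n \<Rightarrow> complex^'n \<Rightarrow> complex"
  assumes n: "CARD('n) \<ge> 2" and B: "bilinear B"
  defines "e \<equiv> axis k (1::complex)" and "e' \<equiv> axis k \<i>"
  shows "coherent_mean \<rho> e (\<lambda>x. B (x - (x \<bullet> e) *\<^sub>R e) (x - (x \<bullet> e) *\<^sub>R e))
    = coherent_mean \<rho> e (\<lambda>x. of_real ((Im (herm_inner x e))\<^sup>2)) * B e' e'
      + coherent_mean \<rho> e (\<lambda>x. of_real (1 - (cmod (herm_inner x e))\<^sup>2)) / of_nat (2 * CARD('n) - 2)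
        * ((\<Sum>b\<in>Basis. B b b) - B e e - B e' e')"
proof -
  define G where "G x = complex_of_real (coherent_density \<rho> e x)" for x
  have cG: "continuous_on S G" for S
    unfolding G_def by (intro continuous_intros continuous_on_coherent_density[OF n])
  define D where "D = (Basis :: (complex^'n) set) - {e}"
  have inB: "e \<in> Basis" "e' \<in> Basis" by (auto simp: e_def e'_def axis_in_Basis_iff Basis_complex_def)
  have ne: "e \<noteq> e'" by (simp add: e_def e'_def axis_eq_axis)
  define I where "I b c = (LINT x|sphere_measure. complex_of_real ((x \<bullet> b) * (x \<bullet> c)) * G x)" for b c
  have expand: "B (x - (x \<bullet> e) *\<^sub>R e) (x - (x \<bullet> e) *\<^sub>R e) * G x = (\<Sum>b\<in>D. \<Sum>c\<in>D. complex_of_real ((x \<bullet> b) * (x \<bullet> c)) * G x * B b c)" for x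
  proof -
    have "x = (\<Sum>b\<in>Basis. (x \<bullet> b) *\<^sub>R b)" by (simp add: euclidean_representation)
    also have "\<dots> = (x \<bullet> e) *\<^sub>R e + (\<Sum>b\<in>D. (x \<bullet> b) *\<^sub>R b)" unfolding D_def using inB by (simp add: sum.remove)
    finally have y: "x - (x \<bullet> e) *\<^sub>R e = (\<Sum>b\<in>D. (x \<bullet> b) *\<^sub>R b)" by (simp add: algebra_simps)
    have "B (x - (x \<bullet> e) *\<^sub>R e) (x - (x \<bullet> e) *\<^sub>R e) = (\<Sum>(b, c)\<in>D \<times> D. ((x \<bullet> b) * (x \<bullet> c)) *\<^sub>R B b c)"
      unfolding y by (subst bilinear_sum[OF B]) (simp_all add: D_def bilinear_lmul[OF B] bilinear_rmul[OF B] mult.commute)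
    also have "\<dots> = (\<Sum>b\<in>D. \<Sum>c\<in>D. ((x \<bullet> b) * (x \<bullet> c)) *\<^sub>R B b c)" by (simp add: sum.cartesian_product)
    finally have y2: "B (x - (x \<bullet> e) *\<^sub>R e) (x - (x \<bullet> e) *\<^sub>R e) = (\<Sum>b\<in>D. \<Sum>c\<in>D. ((x \<bullet> b) * (x \<bullet> c)) *\<^sub>R B b c)" .
    show ?thesis unfolding y2 sum_distrib_right by (intro sum.cong refl) (simp add: scaleR_conv_of_real)
  qed
  have ii: "integrable sphere_measure (\<lambda>x. complex_of_real ((x \<bullet> b) * (x \<bullet> c)) * G x * d)" for b c d
    by (intro integrable_sphere_continuous continuous_intros cG)
  have "(LINT x|sphere_measure. B (x - (x \<bullet> e) *\<^sub>R e) (x - (x \<bullet> e) *\<^sub>R e) * G x)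
     = (\<Sum>b\<in>D. LINT x|sphere_measure. (\<Sum>c\<in>D. complex_of_real ((x \<bullet> b) * (x \<bullet> c)) * G x * B b c))"
    unfolding expand by (intro Bochner_Integration.integral_sum Bochner_Integration.integrable_sum ii)
  also have "\<dots> = (\<Sum>b\<in>D. \<Sum>c\<in>D. LINT x|sphere_measure. complex_of_real ((x \<bullet> b) * (x \<bullet> c)) * G x * B b c)"
    by (intro sum.cong refl Bochner_Integration.integral_sum ii)
  also have "\<dots> = (\<Sum>b\<in>D. \<Sum>c\<in>D. I b c * B b c)"
    by (simp add: I_def)
  also have "\<dots> = (\<Sum>b\<in>D. I b b * B b b)"
  proof (intro sum.cong refl)
    fix b assume b: "b \<in> D"
    have "I b c = 0" if "c \<in> D" "c \<noteq> b" for c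
      unfolding I_def G_def e_def using b that by (intro coherent_cross_moment_0[OF n]) (auto simp: D_def e_def)
    then have "(\<Sum>c\<in>D. I b c * B b c) = (\<Sum>c\<in>{b}. I b c * B b c)"
      using b by (intro sum.mono_neutral_right) (auto simp: D_def)
    then show "(\<Sum>c\<in>D. I b c * B b c) = I b b * B b b" by simp
  qed
  also have "\<dots> = I e' e' * B e' e' + (\<Sum>b\<in>D - {e'}. I b b * B b b)"
    using inB ne by (subst sum.remove[of _ e']) (auto simp: D_def)
  also have "(\<Sum>b\<in>D - {e'}. I b b * B b b) = (\<Sum>b\<in>D - {e'}. (LINT x|sphere_measure. of_real (1 - (cmod (x $ k))\<^sup>2) * G x) / of_nat (2 * CARD('n) - 2) * B b b)"
  proof (intro sum.cong refl)
    fix b assume "b \<in> D - {e'}"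
    then have "b \<in> Basis" "b $ k = 0" using Basis_vec_nth[of b k] by (auto simp: D_def e_def e'_def)
    from coherent_square_moment[OF n this, of \<rho>]
    show "I b b * B b b = (LINT x|sphere_measure. of_real (1 - (cmod (x $ k))\<^sup>2) * G x) / of_nat (2 * CARD('n) - 2) * B b b"
      by (simp only: I_def G_def e_def)
  qed
  also have "\<dots> = (LINT x|sphere_measure. of_real (1 - (cmod (x $ k))\<^sup>2) * G x) / of_nat (2 * CARD('n) - 2) * (\<Sum>b\<in>D - {e'}. B b b)"
    by (simp add: sum_distrib_left)
  also have "(\<Sum>b\<in>D - {e'}. B b b) = (\<Sum>b\<in>Basis. B b b) - B e e - B e' e'"
    unfolding D_def using inB ne by (simp add: sum_diff1)
  also have "I e' e' = (LINT x|sphere_measure. of_real ((Im (x $ k))\<^sup>2) * G x)"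
    by (simp add: I_def e_def e'_def inner_axis inner_complex_def power2_eq_square)
  finally have X: "(LINT x|sphere_measure. B (x - (x \<bullet> e) *\<^sub>R e) (x - (x \<bullet> e) *\<^sub>R e) * G x)
    = (LINT x|sphere_measure. of_real ((Im (x $ k))\<^sup>2) * G x) * B e' e'
      + (LINT x|sphere_measure. of_real (1 - (cmod (x $ k))\<^sup>2) * G x) / of_nat (2 * CARD('n) - 2) * ((\<Sum>b\<in>Basis. B b b) - B e e - B e' e')" .
  have hk: "herm_inner x e = x $ k" for x by (simp add: e_def)
  have "(p * b + c / m * t) / N = p / N * b + c / N / m * t" for p b c m t N :: complex
    by (simp add: add_divide_distrib mult_ac)
  then show ?thesis
    unfolding coherent_mean_def G_def[symmetric] hk X .
qed

lemma coherent_mean_unitary: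
  fixes u :: "complex^'n::finite"
  assumes n: "CARD('n) \<ge> 2" and W: "unitary W" and f: "continuous_on (sphere 0 1) f"
  shows "coherent_mean \<rho> (W u) f = coherent_mean \<rho> u (\<lambda>x. f (W x))"
proof -
  have d: "coherent_density \<rho> (W u) (W x) = coherent_density \<rho> u x" for x
    by (simp add: coherent_density_def herm_inner_unitary[OF W])
  have "(LINT x|sphere_measure. f x * complex_of_real (coherent_density \<rho> (W u) x))
    = (LINT x|sphere_measure. f (W x) * complex_of_real (coherent_density \<rho> (W u) (W x)))"
    by (intro integral_sphere_unitary[OF W, symmetric] continuous_intros f continuous_on_coherent_density[OF n])
  moreover have "(LINT x|sphere_measure. complex_of_real (coherent_density \<rho> (W u) x))
    = (LINT x|sphere_measure. complex_of_real (coherent_density \<rho> (W u) (W x)))"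
    by (intro integral_sphere_unitary[OF W, symmetric] continuous_intros continuous_on_coherent_density[OF n])
  ultimately show ?thesis by (simp add: coherent_mean_def d)
qed

text \<open>Transport of the axis case by a unitary map taking e_k to u. Complex homogeneity is what
  takes the exceptional direction i e_k to i u.\<close>

lemma coherent_mean_bilinear:
  fixes u :: "complex^'n::finite" and B :: "complex^'n \<Rightarrow> complex^'n \<Rightarrow> complex"
  assumes n: "CARD('n) \<ge> 2" and B: "bilinear B" and u: "norm u = 1"
  shows "coherent_mean \<rho> u (\<lambda>x. B (x - (x \<bullet> u) *\<^sub>R u) (x - (x \<bullet> u) *\<^sub>R u))
    = coherent_mean \<rho> u (\<lambda>x. of_real ((Im (herm_inner x u))\<^sup>2)) * B (\<i> *s u) (\<i> *s u)
      + coherent_mean \<rho> u (\<lambda>x. of_real (1 - (cmod (herm_inner x u))\<^sup>2)) / of_nat (2 * CARD('n) - 2)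
        * ((\<Sum>b\<in>Basis. B b b) - B u u - B (\<i> *s u) (\<i> *s u))"
proof -
  obtain k :: 'n where True by simp
  obtain W where W: "unitary W" "W (axis k 1) = u" using unitary_exists[OF u] .
  define e where "e = axis k (1::complex)"
  have We: "W e = u" using W by (simp add: e_def)
  have oW: "orthogonal_transformation W" using W(1) by (simp add: unitary_def)
  note linW = orthogonal_transformation_linear[OF oW]
  have ie: "\<i> *s e = axis k \<i>" by (simp add: e_def vec_eq_iff axis_def)
  have Wie: "W (axis k \<i>) = \<i> *s u" using W(1) unfolding ie[symmetric] unitary_def by (simp add: We)
  have inn: "W a \<bullet> W b = a \<bullet> b" for a b using oW by (simp add: orthogonal_transformation_def)
  define B' where "B' a b = B (W a) (W b)" for a b
  have B': "bilinear B'"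
    using B linW unfolding bilinear_def B'_def by (auto intro: linear_compose[unfolded o_def])
  have cy: "continuous_on (sphere 0 1) (\<lambda>x. B (x - (x \<bullet> u) *\<^sub>R u) (x - (x \<bullet> u) *\<^sub>R u))"
    by (intro continuous_on_bilinear_diag[OF B] continuous_intros)
  have "W x - (W x \<bullet> u) *\<^sub>R u = W (x - (x \<bullet> e) *\<^sub>R e)" for x
    unfolding linear_diff[OF linW] linear_scale[OF linW] We[symmetric] inn ..
  then have "coherent_mean \<rho> u (\<lambda>x. B (x - (x \<bullet> u) *\<^sub>R u) (x - (x \<bullet> u) *\<^sub>R u))
     = coherent_mean \<rho> e (\<lambda>x. B' (x - (x \<bullet> e) *\<^sub>R e) (x - (x \<bullet> e) *\<^sub>R e))"
    using coherent_mean_unitary[OF n W(1) cy, of \<rho> e] by (simp add: We B'_def)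
  also have "\<dots> = coherent_mean \<rho> e (\<lambda>x. of_real ((Im (herm_inner x e))\<^sup>2)) * B' (axis k \<i>) (axis k \<i>)
      + coherent_mean \<rho> e (\<lambda>x. of_real (1 - (cmod (herm_inner x e))\<^sup>2)) / of_nat (2 * CARD('n) - 2)
        * ((\<Sum>b\<in>Basis. B' b b) - B' e e - B' (axis k \<i>) (axis k \<i>))"
    unfolding e_def by (rule coherent_mean_bilinear_axis[OF n B'])
  also have "(\<Sum>b\<in>Basis. B' b b) = (\<Sum>b\<in>Basis. B b b)"
    unfolding B'_def by (rule trace_bilinear_orthogonal[OF B oW])
  also have "coherent_mean \<rho> e (\<lambda>x. of_real ((Im (herm_inner x e))\<^sup>2)) = coherent_mean \<rho> u (\<lambda>x. of_real ((Im (herm_inner x u))\<^sup>2))"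
    using coherent_mean_unitary[OF n W(1), of "\<lambda>x. of_real ((Im (herm_inner x u))\<^sup>2)" \<rho> e]
    by (simp add: We[symmetric] herm_inner_unitary[OF W(1)] continuous_intros)
  also have "coherent_mean \<rho> e (\<lambda>x. of_real (1 - (cmod (herm_inner x e))\<^sup>2)) = coherent_mean \<rho> u (\<lambda>x. of_real (1 - (cmod (herm_inner x u))\<^sup>2))"
    using coherent_mean_unitary[OF n W(1), of "\<lambda>x. of_real (1 - (cmod (herm_inner x u))\<^sup>2)" \<rho> e]
    by (simp add: We[symmetric] herm_inner_unitary[OF W(1)] continuous_intros)
  finally show ?thesis by (simp add: B'_def We Wie)
qed

section \<open>Linearity and positivity of the coherent mean\<close>

context
  fixes u :: "complex^'n::finite" and \<rho> :: real
  assumes n: "CARD('n) \<ge> 2" and u: "norm u = 1" and \<rho>: "\<rho> > 0"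
begin

lemma coherent_normalization:
  obtains N where "N > 0" "(LINT x|sphere_measure. complex_of_real (coherent_density \<rho> u x)) = of_real N"
  using coherent_mean_moments(1)[OF n \<rho> u] suminf_bessel_weight_pos[OF \<rho>, of "CARD('n)"]
  by (intro that[of "fact (CARD('n) - 2) * (\<Sum>l. bessel_weight CARD('n) \<rho> l)"]) auto

lemma integrable_coherent:
  assumes "continuous_on (sphere 0 1) f"
  shows "integrable sphere_measure (\<lambda>x. f x * complex_of_real (coherent_density \<rho> u x))"
  by (intro integrable_sphere_continuous continuous_intros assms continuous_on_coherent_density[OF n])

lemma coherent_mean_add:
  "continuous_on (sphere 0 1) f \<Longrightarrow> continuous_on (sphere 0 1) g \<Longrightarrow>
    coherent_mean \<rho> u (\<lambda>x. f x + g x) = coherent_mean \<rho> u f + coherent_mean \<rho> u g"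
  using integrable_coherent[of f] integrable_coherent[of g]
  by (simp add: coherent_mean_def distrib_right add_divide_distrib)

lemma coherent_mean_cmult: "coherent_mean \<rho> u (\<lambda>x. c * f x) = c * coherent_mean \<rho> u f"
  by (simp add: coherent_mean_def mult.assoc)

lemma coherent_mean_diff:
  "continuous_on (sphere 0 1) f \<Longrightarrow> continuous_on (sphere 0 1) g \<Longrightarrow>
    coherent_mean \<rho> u (\<lambda>x. f x - g x) = coherent_mean \<rho> u f - coherent_mean \<rho> u g"
  using coherent_mean_add[of f "\<lambda>x. -1 * g x"] coherent_mean_cmult[of "-1" g]
  by (simp add: continuous_intros)

lemma coherent_mean_const: "coherent_mean \<rho> u (\<lambda>x. c) = c"
proof -
  obtain N where "N > 0" "(LINT x|sphere_measure. complex_of_real (coherent_density \<rho> u x)) = of_real N"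
    by (rule coherent_normalization)
  then show ?thesis by (simp add: coherent_mean_def del: integral_complex_of_real)
qed

lemma coherent_mean_Re:
  assumes f: "continuous_on (sphere 0 1) f"
  shows "coherent_mean \<rho> u (\<lambda>x. of_real (Re (f x))) = of_real (Re (coherent_mean \<rho> u f))"
proof -
  obtain N where N: "N > 0" "(LINT x|sphere_measure. complex_of_real (coherent_density \<rho> u x)) = of_real N"
    by (rule coherent_normalization)
  have "(LINT x|sphere_measure. complex_of_real (Re (f x)) * of_real (coherent_density \<rho> u x))
    = (LINT x|sphere_measure. complex_of_real (Re (f x * of_real (coherent_density \<rho> u x))))" by simp
  also have "\<dots> = of_real (Re (LINT x|sphere_measure. f x * of_real (coherent_density \<rho> u x)))"
    unfolding integral_complex_of_real integral_Re[OF integrable_coherent[OF f]] ..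
  finally show ?thesis unfolding coherent_mean_def N(2) by simp
qed

lemma coherent_mean_bound:
  assumes f: "continuous_on (sphere 0 1) f" and g: "continuous_on (sphere 0 1) g"
    and le: "\<And>x. norm x = 1 \<Longrightarrow> cmod (f x) \<le> g x"
  shows "cmod (coherent_mean \<rho> u f) \<le> Re (coherent_mean \<rho> u (\<lambda>x. of_real (g x)))"
proof -
  obtain N where N: "N > 0" "(LINT x|sphere_measure. complex_of_real (coherent_density \<rho> u x)) = of_real N"
    by (rule coherent_normalization)
  have "cmod (LINT x|sphere_measure. f x * of_real (coherent_density \<rho> u x)) \<le> (LINT x|sphere_measure. g x * coherent_density \<rho> u x)"
  proof (rule norm_LINT_le[OF integrable_coherent[OF f]])
    show "integrable sphere_measure (\<lambda>x. g x * coherent_density \<rho> u x)"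
      by (intro integrable_sphere_continuous continuous_intros g continuous_on_coherent_density[OF n])
    show "cmod (f x * of_real (coherent_density \<rho> u x)) \<le> g x * coherent_density \<rho> u x" if "x \<in> space sphere_measure" for x
    proof -
      have "coherent_density \<rho> u x \<ge> 0" by (simp add: coherent_density_def)
      then show ?thesis using le[of x] that by (simp add: norm_mult mult_right_mono)
    qed
  qed
  also have "\<dots> = Re (LINT x|sphere_measure. of_real (g x) * of_real (coherent_density \<rho> u x))"
    by (simp flip: of_real_mult)
  finally show ?thesis
    using N(1) unfolding coherent_mean_def N(2) by (simp add: norm_divide divide_right_mono)
qed

end

text \<open>Linearity in the outer direction is linearity of a derivative; in the inner direction it
  follows by symmetry of the second derivative.\<close>

lemma bilinear_second_dir_deriv:
  fixes f :: "'a::euclidean_space \<Rightarrow> complex"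
  assumes U: "open U" "x \<in> U" and f: "smooth_on U f"
  shows "bilinear (\<lambda>v w. dir_deriv (\<lambda>y. dir_deriv f v y) w x)"
  unfolding bilinear_def
proof (intro conjI allI)
  show lin: "linear (\<lambda>w. dir_deriv (\<lambda>y. dir_deriv f v y) w x)" for v
    by (rule dir_deriv_linear[OF smooth_on_dir_deriv[OF f] U(2)])
  show "linear (\<lambda>v. dir_deriv (\<lambda>y. dir_deriv f v y) w x)" for w
    unfolding mixed_dir_deriv_eq[OF U f, of _ w] by (rule lin)
qed

section \<open>The expansion\<close>

text \<open>The functions e1, e2, e3 are the errors of the three moments. The remaining identities
  are exact in them, so the whole deviation is linear in three quantities of order
  1/\<rho>^2.\<close>

lemma coherent_mean_expansion:
  fixes u :: "complex^'n::finite" and f :: "complex^'n \<Rightarrow> complex"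
  assumes n: "CARD('n) \<ge> 2" and u: "norm u = 1" and U: "open U" "sphere 0 1 \<subseteq> U" and f: "smooth_on U f"
  shows "(\<lambda>\<rho>. cmod (coherent_mean \<rho> u f - (f u + of_real (1 / (4 * \<rho>)) *
      (4 * complex_laplace f u - radial_deriv (radial_deriv f) u - of_nat (2 * CARD('n) - 2) * radial_deriv f u))))
    \<in> O[at_top](\<lambda>\<rho>. 1 / \<rho>\<^sup>2)"
proof -
  define N where "N = CARD('n)"
  have N: "N \<ge> 2" using n by (simp add: N_def)
  have uU: "u \<in> U" using u U(2) by auto
  have uu: "u \<bullet> u = 1" using u by (simp add: norm_eq_1)
  have cf: "continuous_on (sphere 0 1) f" by (rule continuous_on_subset[OF smooth_on_continuous_on[OF f] U(2)])
  define B where "B v w = dir_deriv (\<lambda>y. dir_deriv f v y) w u" for v w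
  have B: "bilinear B" unfolding B_def[abs_def] by (rule bilinear_second_dir_deriv[OF U(1) uU f])
  define D where "D = dir_deriv f u u"
  define T where "T = (\<Sum>b\<in>Basis. B b b)"
  have lap: "4 * complex_laplace f u = T"
    unfolding T_def B_def by (rule complex_laplace_eq[OF U(1) uU f])
  have rad: "radial_deriv f u = D" "radial_deriv (radial_deriv f) u = B u u + D"
    unfolding D_def B_def
    by (rule radial_deriv_eq[OF smooth_on_differentiable[OF f uU]], rule radial_deriv_twice[OF U(1) uU f])
  define Bi where "Bi = B (\<i> *s u) (\<i> *s u)"
  define mm where "mm \<rho> = bessel_mean N \<rho> (\<lambda>l. real (l + 1) / real (l + N))" for \<rho>
  define m1 where "m1 \<rho> = bessel_mean N \<rho> (\<lambda>l. \<rho> / sqrt (real (l + N - 1) * real (l + N)))" for \<rho>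
  define m2 where "m2 \<rho> = bessel_mean N \<rho> (\<lambda>l. \<rho>\<^sup>2 / (real (l + N) * sqrt (real (l + N - 1) * real (l + N + 1))))" for \<rho>
  define e1 where "e1 \<rho> = mm \<rho> - (1 - (real N - 1) / \<rho>)" for \<rho>
  define e2 where "e2 \<rho> = m2 \<rho> - (1 - real N / \<rho>)" for \<rho>
  define e3 where "e3 \<rho> = m1 \<rho> - (1 - (2 * real N - 1) / 4 / \<rho>)" for \<rho>
  have e: "e1 \<in> O[at_top](\<lambda>\<rho>. 1 / \<rho>\<^sup>2)" "e2 \<in> O[at_top](\<lambda>\<rho>. 1 / \<rho>\<^sup>2)" "e3 \<in> O[at_top](\<lambda>\<rho>. 1 / \<rho>\<^sup>2)"
    unfolding e1_def[abs_def] e2_def[abs_def] e3_def[abs_def] mm_def m1_def m2_def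
    by (rule bessel_mean_modulus[OF N] bessel_mean_second[OF N] bessel_mean_first[OF N])+
  define y where "y x = x - (x \<bullet> u) *\<^sub>R u" for x
  have DIM: "DIM(complex^'n) \<ge> 2" using n by simp
  obtain C where C: "C \<ge> 0" "\<And>x. norm x = 1 \<Longrightarrow>
    cmod ((f x + f (2 *\<^sub>R (x \<bullet> u) *\<^sub>R u - x)) / 2 - (f u + (B (y x) (y x) - of_real ((norm (y x))\<^sup>2) * D) / 2)) \<le> C * (1 - x \<bullet> u)\<^sup>2"
    using taylor_sphere[OF U f u DIM] unfolding B_def D_def y_def by blast
  \<comment> \<open>One constant serves for e1 and e2: it collects the coefficients of the quadratic
    form and of D together with the Taylor constant. K3 is the Taylor constant times the factor 2 of
    e3.\<close>
  define K1 where "K1 = cmod Bi + cmod (T - B u u - Bi) + cmod D + C"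
  define K3 where "K3 = 2 * C"
  have bound: "cmod (coherent_mean \<rho> u f - (f u + of_real (1 / (4 * \<rho>)) *
      (4 * complex_laplace f u - radial_deriv (radial_deriv f) u - of_nat (2 * CARD('n) - 2) * radial_deriv f u)))
    \<le> K1 * \<bar>e1 \<rho>\<bar> + K1 * \<bar>e2 \<rho>\<bar> + K3 * \<bar>e3 \<rho>\<bar>" if \<rho>: "\<rho> \<ge> 1" for \<rho>
  proof -
    have \<rho>0: "\<rho> > 0" using \<rho> by simp
    define E where "E = coherent_mean \<rho> u"
    note E_add = coherent_mean_add[OF n u \<rho>0, folded E_def] and E_diff = coherent_mean_diff[OF n u \<rho>0, folded E_def]
      and E_cmult = coherent_mean_cmult[OF n u \<rho>0, folded E_def] and E_const = coherent_mean_const[OF n u \<rho>0, folded E_def]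
      and E_Re = coherent_mean_Re[OF n u \<rho>0, folded E_def]
    have Emm: "E (\<lambda>x. of_real ((cmod (herm_inner x u))\<^sup>2)) = of_real (mm \<rho>)"
      and Em1: "E (\<lambda>x. herm_inner x u) = of_real (m1 \<rho>)"
      and Em2: "E (\<lambda>x. (herm_inner x u)\<^sup>2) = of_real (m2 \<rho>)"
      unfolding E_def mm_def m1_def m2_def N_def by (rule coherent_mean_moments[OF n \<rho>0 u])+
    have ch: "continuous_on (sphere 0 1) (\<lambda>x. herm_inner x u)" by (intro continuous_intros)
    have ERe: "E (\<lambda>x. of_real (x \<bullet> u)) = of_real (m1 \<rho>)"
      using E_Re[OF ch] by (simp add: Em1 Re_herm_inner)
    have ERe2: "E (\<lambda>x. of_real (Re ((herm_inner x u)\<^sup>2))) = of_real (m2 \<rho>)"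
      by (subst E_Re) (auto simp: Em2 intro!: continuous_intros)
    have c1: "continuous_on (sphere 0 1) (\<lambda>x. complex_of_real ((cmod (herm_inner x u))\<^sup>2))"
      and c2: "continuous_on (sphere 0 1) (\<lambda>x. complex_of_real (Re ((herm_inner x u)\<^sup>2)))"
      and c3: "continuous_on (sphere 0 1) (\<lambda>x. 2 * complex_of_real (x \<bullet> u))"
      and c4: "continuous_on (sphere 0 1) (\<lambda>x. complex_of_real ((x \<bullet> u)\<^sup>2))"
      and c5: "continuous_on (sphere 0 1) (\<lambda>x. 1 - 2 * complex_of_real (x \<bullet> u))"
      by (intro continuous_intros)+
    have half: "E (\<lambda>x. (1/2) * (of_real ((cmod (herm_inner x u))\<^sup>2) + of_real (Re ((herm_inner x u)\<^sup>2)))) = of_real ((mm \<rho> + m2 \<rho>) / 2)"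
      by (simp only: E_cmult E_add[OF c1 c2] Emm ERe2) simp
    \<comment> \<open>(Re \<zeta>)^2 = (|\<zeta>|^2 + Re (\<zeta>^2)) / 2 brings the real moments
      back to the three that are known.\<close>
    have sq: "complex_of_real ((x \<bullet> u)\<^sup>2) = (1/2) * (of_real ((cmod (herm_inner x u))\<^sup>2) + of_real (Re ((herm_inner x u)\<^sup>2)))" for x
      unfolding cmod_power2 Re_herm_inner[symmetric] by (simp add: complex_eq_iff power2_eq_square)
    have Esq: "E (\<lambda>x. of_real ((x \<bullet> u)\<^sup>2)) = of_real ((mm \<rho> + m2 \<rho>) / 2)"
      unfolding sq by (rule half)
    have EIm: "E (\<lambda>x. of_real ((Im (herm_inner x u))\<^sup>2)) = of_real ((mm \<rho> - m2 \<rho>) / 2)"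
    proof -
      have "complex_of_real ((Im (herm_inner x u))\<^sup>2) = (1/2) * (of_real ((cmod (herm_inner x u))\<^sup>2) - of_real (Re ((herm_inner x u)\<^sup>2)))" for x
        unfolding cmod_power2 by (simp add: complex_eq_iff power2_eq_square)
      moreover have "E (\<lambda>x. (1/2) * (of_real ((cmod (herm_inner x u))\<^sup>2) - of_real (Re ((herm_inner x u)\<^sup>2)))) = of_real ((mm \<rho> - m2 \<rho>) / 2)"
        by (simp only: E_cmult E_diff[OF c1 c2] Emm ERe2) simp
      ultimately show ?thesis by (simp only:)
    qed
    have Ecomp: "E (\<lambda>x. of_real (1 - (cmod (herm_inner x u))\<^sup>2)) = of_real (1 - mm \<rho>)"
      by (simp only: of_real_diff of_real_1 E_diff[OF continuous_on_const c1] E_const Emm)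
    \<comment> \<open>The decisive cancellation: 2 (2n-1)/4 from the first moment equals ((n-1) +
      n)/2 from the second ones, so only error terms remain.\<close>
    have Evar: "E (\<lambda>x. of_real ((1 - x \<bullet> u)\<^sup>2)) = of_real ((e1 \<rho> + e2 \<rho>) / 2 - 2 * e3 \<rho>)"
    proof -
      have "E (\<lambda>x. (1 - 2 * of_real (x \<bullet> u)) + of_real ((x \<bullet> u)\<^sup>2)) = (1 - 2 * of_real (m1 \<rho>)) + of_real ((mm \<rho> + m2 \<rho>) / 2)"
        by (simp only: E_add[OF c5 c4] E_diff[OF continuous_on_const c3] E_cmult E_const ERe Esq)
      also have "\<dots> = of_real ((e1 \<rho> + e2 \<rho>) / 2 - 2 * e3 \<rho>)"
      proof -
        have "1 - 2 * m1 \<rho> + (mm \<rho> + m2 \<rho>) / 2 = (e1 \<rho> + e2 \<rho>) / 2 - 2 * e3 \<rho>"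
          using \<rho>0 by (simp add: e1_def e2_def e3_def field_simps)
        then show ?thesis by (metis (no_types, lifting) of_real_1 of_real_add of_real_diff of_real_mult of_real_numeral)
      qed
      finally show ?thesis by (simp add: power2_diff algebra_simps)
    qed
    have Ey2: "E (\<lambda>x. of_real ((norm (y x))\<^sup>2)) = of_real (1 - (mm \<rho> + m2 \<rho>) / 2)"
    proof -
      have "E (\<lambda>x. of_real ((norm (y x))\<^sup>2)) = E (\<lambda>x. 1 - of_real ((x \<bullet> u)\<^sup>2))"
        unfolding E_def coherent_mean_def
      proof (rule arg_cong[where f="\<lambda>t. t / _"], rule LINT_sphere_cong)
        fix x :: "complex^'n" assume "norm x = 1"
        then have "x \<bullet> x = 1" by (simp add: norm_eq_1)
        then have "(norm (y x))\<^sup>2 = 1 - (x \<bullet> u)\<^sup>2"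
          unfolding power2_norm_eq_inner y_def
          by (simp add: inner_diff_left inner_diff_right uu inner_commute power2_eq_square)
        then show "complex_of_real ((norm (y x))\<^sup>2) * of_real (coherent_density \<rho> u x)
            = (1 - of_real ((x \<bullet> u)\<^sup>2)) * of_real (coherent_density \<rho> u x)" by simp
      qed
      also have "\<dots> = 1 - of_real ((mm \<rho> + m2 \<rho>) / 2)"
        by (simp only: E_diff[OF continuous_on_const c4] E_const Esq)
      finally show ?thesis by simp
    qed
    have EB: "E (\<lambda>x. B (y x) (y x)) = of_real ((mm \<rho> - m2 \<rho>) / 2) * Bi + of_real (1 - mm \<rho>) / of_nat (2 * N - 2) * (T - B u u - Bi)"
      using coherent_mean_bilinear[OF n B u, of \<rho>] unfolding E_def[symmetric] y_def EIm Ecomp Bi_def T_def N_def .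
    have cy: "continuous_on (sphere 0 1) y" unfolding y_def[abs_def] by (intro continuous_intros)
    have cB: "continuous_on (sphere 0 1) (\<lambda>x. B (y x) (y x))" by (rule continuous_on_bilinear_diag[OF B cy])
    \<comment> \<open>The reflected point of \<open>taylor_sphere\<close>. It is minus the
      reflection along u and conjugates \<zeta>, so averaging over it does not change the
      mean.\<close>
    define \<sigma> where "\<sigma> x = 2 *\<^sub>R (x \<bullet> u) *\<^sub>R u - x" for x
    have \<sigma>: "orthogonal_transformation \<sigma>"
    proof -
      have "\<sigma> = (\<lambda>x. - reflection u x)" by (simp add: \<sigma>_def fun_eq_iff reflection_def uu)
      then show ?thesis using orthogonal_transformation_reflection orthogonal_transformation_neg by metis
    qed
    have h\<sigma>: "herm_inner (\<sigma> x) u = cnj (herm_inner x u)" for x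
    proof -
      have s: "r *\<^sub>R v = of_real r *s v" for r and v :: "complex^'n" by (simp add: vec_eq_iff scaleR_conv_of_real[where 'a=complex])
      have "herm_inner (\<sigma> x) u = of_real (2 * (x \<bullet> u)) - herm_inner x u"
        using norm_eq_1_herm_inner[OF u] unfolding \<sigma>_def s by simp
      then show ?thesis by (simp add: complex_eq_iff Re_herm_inner)
    qed
    have c\<sigma>: "continuous_on (sphere 0 1) (\<lambda>x. f (\<sigma> x))"
    proof (rule continuous_on_compose2[OF cf])
      show "continuous_on (sphere 0 1) \<sigma>" unfolding \<sigma>_def[abs_def] by (intro continuous_intros)
      show "\<sigma> ` sphere 0 1 \<subseteq> sphere 0 1" using orthogonal_transformation_norm[OF \<sigma>] by auto
    qed
    have E\<sigma>: "E (\<lambda>x. f (\<sigma> x)) = E f"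
      unfolding E_def coherent_mean_def using LINT_coherent_orthogonal[OF n \<sigma> _ cf, of u \<rho>] h\<sigma> by simp
    define S where "S x = f u + (1/2) * (B (y x) (y x) - of_real ((norm (y x))\<^sup>2) * D)" for x
    have cS: "continuous_on (sphere 0 1) S" unfolding S_def[abs_def] by (intro continuous_intros cB cy)
    have Eavg: "E (\<lambda>x. (1/2) * (f x + f (\<sigma> x))) = E f"
      by (subst E_cmult, subst E_add) (auto simp: E\<sigma> cf c\<sigma>)
    have ES: "E S = f u + (1/2) * (E (\<lambda>x. B (y x) (y x)) - of_real (1 - (mm \<rho> + m2 \<rho>) / 2) * D)"
    proof -
      have "E (\<lambda>x. D * of_real ((norm (y x))\<^sup>2)) = D * of_real (1 - (mm \<rho> + m2 \<rho>) / 2)"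
        by (subst E_cmult) (simp only: Ey2)
      then have "E (\<lambda>x. B (y x) (y x) - D * of_real ((norm (y x))\<^sup>2)) = E (\<lambda>x. B (y x) (y x)) - D * of_real (1 - (mm \<rho> + m2 \<rho>) / 2)"
        by (subst E_diff) (auto intro!: continuous_intros cB cy)
      then have "E (\<lambda>x. f u + (1/2) * (B (y x) (y x) - D * of_real ((norm (y x))\<^sup>2))) = f u + (1/2) * (E (\<lambda>x. B (y x) (y x)) - D * of_real (1 - (mm \<rho> + m2 \<rho>) / 2))"
        by (subst E_add, intro continuous_intros, intro continuous_intros cB cy, subst E_cmult) (simp only: E_const)
      then show ?thesis unfolding S_def[abs_def] by (simp only: mult.commute[of _ D])
    qed
    have err: "cmod (E f - E S) \<le> C * ((e1 \<rho> + e2 \<rho>) / 2 - 2 * e3 \<rho>)"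
    proof -
      have "E f - E S = E (\<lambda>x. (1/2) * (f x + f (\<sigma> x)) - S x)"
        by (subst E_diff, intro continuous_intros cf c\<sigma>, rule cS) (simp only: Eavg)
      also have "cmod \<dots> \<le> Re (E (\<lambda>x. of_real (C * (1 - x \<bullet> u)\<^sup>2)))"
        unfolding E_def
      proof (rule coherent_mean_bound[OF n u \<rho>0])
        show "continuous_on (sphere 0 1) (\<lambda>x. (1/2) * (f x + f (\<sigma> x)) - S x)"
          by (intro continuous_intros cf c\<sigma> cS)
        show "continuous_on (sphere 0 1) (\<lambda>x. C * (1 - x \<bullet> u)\<^sup>2)" by (intro continuous_intros)
        show "cmod ((1/2) * (f x + f (\<sigma> x)) - S x) \<le> C * (1 - x \<bullet> u)\<^sup>2" if "norm x = 1" for x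
          using C(2)[OF that] by (simp add: S_def \<sigma>_def)
      qed
      also have "E (\<lambda>x. of_real (C * (1 - x \<bullet> u)\<^sup>2)) = of_real (C * ((e1 \<rho> + e2 \<rho>) / 2 - 2 * e3 \<rho>))"
        unfolding of_real_mult[of C] by (subst E_cmult) (simp only: Evar)
      finally show ?thesis by simp
    qed
    have main: "E S - (f u + of_real (1 / (4 * \<rho>)) * (4 * complex_laplace f u - radial_deriv (radial_deriv f) u - of_nat (2 * CARD('n) - 2) * radial_deriv f u))
      = of_real ((e1 \<rho> - e2 \<rho>) / 4) * Bi - of_real (e1 \<rho> / (4 * real N - 4)) * (T - B u u - Bi) + of_real ((e1 \<rho> + e2 \<rho>) / 4) * D"
    proof -
      have N1: "of_nat (2 * N - 2) = (of_real (2 * real N - 2) :: complex)" using N by (simp add: of_nat_diff)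
      have mme: "mm \<rho> = e1 \<rho> + (1 - (real N - 1) / \<rho>)" "m2 \<rho> = e2 \<rho> + (1 - real N / \<rho>)" by (auto simp: e1_def e2_def)
      \<comment> \<open>The mean square along i u and, next, along any other tangential direction
        have the same leading term 1/(2 \<rho>).\<close>
      have c1: "(mm \<rho> - m2 \<rho>) / 2 = 1 / (2 * \<rho>) + (e1 \<rho> - e2 \<rho>) / 2"
        unfolding mme using \<rho>0 by (simp add: field_simps)
      have c2: "(1 - mm \<rho>) / (2 * real N - 2) = 1 / (2 * \<rho>) - e1 \<rho> / (2 * real N - 2)"
        unfolding mme using \<rho>0 N by (simp add: field_simps)
      \<comment> \<open>The mean of |y|^2 is the sum of the 2N - 1 tangential mean squares.\<close>
      have c3: "1 - (mm \<rho> + m2 \<rho>) / 2 = (2 * real N - 1) / (2 * \<rho>) - (e1 \<rho> + e2 \<rho>) / 2"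
        unfolding mme using \<rho>0 by (simp add: field_simps)
      have ES': "E S = f u + (1/2) * (of_real ((mm \<rho> - m2 \<rho>) / 2) * Bi + of_real ((1 - mm \<rho>) / (2 * real N - 2)) * (T - B u u - Bi) - of_real (1 - (mm \<rho> + m2 \<rho>) / 2) * D)"
        unfolding ES EB N1 of_real_divide[symmetric] ..
      define a where "a = complex_of_real (1 / (4 * \<rho>))"
      define d1 where "d1 = complex_of_real (e1 \<rho> / 4)"
      define d2 where "d2 = complex_of_real (e2 \<rho> / 4)"
      define d3 where "d3 = complex_of_real (e1 \<rho> / (4 * real N - 4))"
      define Nc where "Nc = complex_of_real (real N)"
      have r1: "complex_of_real (1 / (2 * \<rho>) + (e1 \<rho> - e2 \<rho>) / 2) = 2 * a + 2 * d1 - 2 * d2"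
        by (simp add: a_def d1_def d2_def field_simps)
      have r2: "complex_of_real (1 / (2 * \<rho>) - e1 \<rho> / (2 * real N - 2)) = 2 * a - 2 * d3"
      proof -
        have "e1 \<rho> / (2 * real N - 2) = 2 * (e1 \<rho> / (4 * real N - 4))" using N by (simp add: field_simps)
        then show ?thesis by (simp add: a_def d3_def)
      qed
      have r3: "complex_of_real ((2 * real N - 1) / (2 * \<rho>) - (e1 \<rho> + e2 \<rho>) / 2) = (2 * Nc - 1) * (2 * a) - 2 * d1 - 2 * d2"
      proof -
        have "(2 * real N - 1) / (2 * \<rho>) - (e1 \<rho> + e2 \<rho>) / 2 = (2 * real N - 1) * (2 * (1 / (4 * \<rho>))) - 2 * (e1 \<rho> / 4) - 2 * (e2 \<rho> / 4)"
          using \<rho>0 by (simp add: field_simps)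
        then show ?thesis
          by (simp only: a_def d1_def d2_def Nc_def of_real_diff of_real_mult of_real_numeral of_real_1)
      qed
      have r4: "complex_of_real ((e1 \<rho> - e2 \<rho>) / 4) = d1 - d2" "complex_of_real ((e1 \<rho> + e2 \<rho>) / 4) = d1 + d2"
        by (simp_all add: d1_def d2_def field_simps)
      have N2: "of_nat (2 * CARD('n) - 2) = 2 * Nc - 2" using N1 by (simp add: Nc_def N_def)
      show ?thesis
        unfolding ES' c1 c2 c3 r1 r2 r3 r4 lap rad N2 a_def[symmetric] d3_def[symmetric] by (simp add: algebra_simps)
    qed
    define X where "X = f u + of_real (1 / (4 * \<rho>)) * (4 * complex_laplace f u - radial_deriv (radial_deriv f) u - of_nat (2 * CARD('n) - 2) * radial_deriv f u)"
    have a1: "cmod (of_real ((e1 \<rho> - e2 \<rho>) / 4) * Bi) \<le> (\<bar>e1 \<rho>\<bar> + \<bar>e2 \<rho>\<bar>) * cmod Bi"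
      unfolding norm_mult norm_of_real by (intro mult_right_mono) auto
    have a2: "cmod (of_real (e1 \<rho> / (4 * real N - 4)) * (T - B u u - Bi)) \<le> \<bar>e1 \<rho>\<bar> * cmod (T - B u u - Bi)"
    proof -
      have "\<bar>e1 \<rho>\<bar> / (4 * real N - 4) \<le> \<bar>e1 \<rho>\<bar> / 1" using N by (intro divide_left_mono) auto
      then have "\<bar>e1 \<rho> / (4 * real N - 4)\<bar> \<le> \<bar>e1 \<rho>\<bar>" using N by (simp add: abs_divide)
      then show ?thesis unfolding norm_mult norm_of_real by (intro mult_right_mono) auto
    qed
    have a3: "cmod (of_real ((e1 \<rho> + e2 \<rho>) / 4) * D) \<le> (\<bar>e1 \<rho>\<bar> + \<bar>e2 \<rho>\<bar>) * cmod D"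
      unfolding norm_mult norm_of_real by (intro mult_right_mono) auto
    have a4: "C * ((e1 \<rho> + e2 \<rho>) / 2 - 2 * e3 \<rho>) \<le> C * (\<bar>e1 \<rho>\<bar> + \<bar>e2 \<rho>\<bar> + 2 * \<bar>e3 \<rho>\<bar>)"
    proof (rule mult_left_mono[OF _ C(1)])
      show "(e1 \<rho> + e2 \<rho>) / 2 - 2 * e3 \<rho> \<le> \<bar>e1 \<rho>\<bar> + \<bar>e2 \<rho>\<bar> + 2 * \<bar>e3 \<rho>\<bar>"
        using abs_ge_self[of "e1 \<rho>"] abs_ge_self[of "e2 \<rho>"] abs_ge_minus_self[of "e3 \<rho>"]
          abs_ge_zero[of "e1 \<rho>"] abs_ge_zero[of "e2 \<rho>"] by argo
    qed
    have a5: "0 \<le> \<bar>e2 \<rho>\<bar> * cmod (T - B u u - Bi)" by simp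
    have "cmod (E f - X) \<le> cmod (E f - E S) + cmod (E S - X)"
      using norm_triangle_ineq[of "E f - E S" "E S - X"] by simp
    also have "cmod (E S - X) \<le> cmod (of_real ((e1 \<rho> - e2 \<rho>) / 4) * Bi) + cmod (of_real (e1 \<rho> / (4 * real N - 4)) * (T - B u u - Bi)) + cmod (of_real ((e1 \<rho> + e2 \<rho>) / 4) * D)"
      unfolding X_def main by (rule order_trans[OF norm_triangle_ineq add_right_mono[OF norm_triangle_ineq4]])
    finally have "cmod (E f - X) \<le> C * (\<bar>e1 \<rho>\<bar> + \<bar>e2 \<rho>\<bar> + 2 * \<bar>e3 \<rho>\<bar>) + ((\<bar>e1 \<rho>\<bar> + \<bar>e2 \<rho>\<bar>) * cmod Bi + \<bar>e1 \<rho>\<bar> * cmod (T - B u u - Bi) + (\<bar>e1 \<rho>\<bar> + \<bar>e2 \<rho>\<bar>) * cmod D)"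
      using err a1 a2 a3 a4 by linarith
    also have "\<dots> \<le> K1 * \<bar>e1 \<rho>\<bar> + K1 * \<bar>e2 \<rho>\<bar> + K3 * \<bar>e3 \<rho>\<bar>"
      using a5 by (simp add: K1_def K3_def algebra_simps)
    finally show ?thesis by (simp add: E_def X_def)
  qed
  have A: "(\<lambda>\<rho>. K1 * \<bar>e1 \<rho>\<bar> + K1 * \<bar>e2 \<rho>\<bar> + K3 * \<bar>e3 \<rho>\<bar>) \<in> O[at_top](\<lambda>\<rho>. 1 * (1 / \<rho>\<^sup>2))"
    using e by (intro sum_in_bigo landau_o.big.mult) auto
  have "(\<lambda>\<rho>. cmod (coherent_mean \<rho> u f - (f u + of_real (1 / (4 * \<rho>)) *
      (4 * complex_laplace f u - radial_deriv (radial_deriv f) u - of_nat (2 * CARD('n) - 2) * radial_deriv f u))))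
    \<in> O[at_top](\<lambda>\<rho>. K1 * \<bar>e1 \<rho>\<bar> + K1 * \<bar>e2 \<rho>\<bar> + K3 * \<bar>e3 \<rho>\<bar>)"
  proof (rule landau_o.bigI[of 1], simp, rule eventually_mono[OF eventually_ge_at_top[of "1::real"]])
    fix \<rho> :: real
    assume "1 \<le> \<rho>"
    from order_trans[OF bound[OF this] abs_ge_self]
    show "norm (cmod (coherent_mean \<rho> u f - (f u + of_real (1 / (4 * \<rho>)) *
        (4 * complex_laplace f u - radial_deriv (radial_deriv f) u - of_nat (2 * CARD('n) - 2) * radial_deriv f u))))
      \<le> 1 * norm (K1 * \<bar>e1 \<rho>\<bar> + K1 * \<bar>e2 \<rho>\<bar> + K3 * \<bar>e3 \<rho>\<bar>)"
      by (simp only: real_norm_def abs_norm_cancel mult_1)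
  qed
  from landau_o.big_trans[OF this A] show ?thesis by (simp only: mult_1)
qed

theorem theorem4p4:
  fixes z :: "complex ^ 'n::finite"
    and \<phi> \<Phi> :: "complex ^ 'n \<Rightarrow> complex"
    and U :: "(complex ^ 'n) set"
  assumes "CARD('n) \<ge> 2"
    and "z \<noteq> 0"
    and "smooth_on_sphere \<phi>"
    and "open U" and "sphere 0 1 \<subseteq> U"
    and "smooth_on U \<Phi>"
    and "\<And>x. x \<in> sphere 0 1 \<Longrightarrow> \<Phi> x = \<phi> x"
  shows "(\<lambda>h::real. berezin_transform h (-1) \<phi> z
            - (\<phi> (z /\<^sub>R norm z)
               + of_real (h / (4 * norm z)) *
                 (4 * complex_laplace \<Phi> (z /\<^sub>R norm z)
                  - radial_deriv (radial_deriv \<Phi>) (z /\<^sub>R norm z)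
                  - of_nat (2 * CARD('n) - 2) * radial_deriv \<Phi> (z /\<^sub>R norm z))))
         \<in> O[at_right 0](\<lambda>h. of_real (h ^ 2))"
proof -
  define u where "u = z /\<^sub>R norm z"
  define Q where "Q = 4 * complex_laplace \<Phi> u - radial_deriv (radial_deriv \<Phi>) u - of_nat (2 * CARD('n) - 2) * radial_deriv \<Phi> u"
  define R where "R \<rho> = cmod (coherent_mean \<rho> u \<Phi> - (\<Phi> u + of_real (1 / (4 * \<rho>)) * Q))" for \<rho>
  have nz: "norm z > 0" using assms(2) by simp
  have u: "norm u = 1" using nz by (simp add: u_def)
  have "R \<in> O[at_top](\<lambda>\<rho>. 1 / \<rho>\<^sup>2)"
    unfolding R_def Q_def by (rule coherent_mean_expansion[OF assms(1) u assms(4-6)])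
  \<comment> \<open>The substitution \<rho> = |z| / h turns O(1/\<rho>^2) at infinity into O(h^2) at
    0 from the right.\<close>
  moreover have "filterlim (\<lambda>h::real. norm z / h) at_top (at_right 0)"
    unfolding divide_inverse
    by (rule filterlim_tendsto_pos_mult_at_top[OF tendsto_const nz filterlim_inverse_at_top_right])
  ultimately have "(\<lambda>h. R (norm z / h)) \<in> O[at_right 0](\<lambda>h. 1 / (norm z / h)\<^sup>2)"
    by (rule landau_o.big.compose)
  also have "(\<lambda>h. 1 / (norm z / h)\<^sup>2) \<in> O[at_right 0](\<lambda>h. h ^ 2)"
    using nz by (simp add: power_divide)
  finally have R: "(\<lambda>h. R (norm z / h)) \<in> O[at_right 0](\<lambda>h. h ^ 2)" .
  have c\<Phi>: "continuous_on (sphere 0 1) \<Phi>"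
    by (rule continuous_on_subset[OF smooth_on_continuous_on[OF assms(6)] assms(5)])
  have c\<phi>: "continuous_on (sphere 0 1) \<phi>" by (rule continuous_on_eq[OF c\<Phi> assms(7)])
  have "\<forall>\<^sub>F h in at_right 0. R (norm z / h) = cmod (berezin_transform h (-1) \<phi> z - (\<phi> u + of_real (h / (4 * norm z)) * Q))"
    using eventually_at_right_less[of "0::real"]
  proof eventually_elim
    case (elim h)
    \<comment> \<open>The mean sees only values on the sphere, so \<phi> may be exchanged for its
      extension there.\<close>
    have "coherent_mean (norm z / h) u \<phi> = coherent_mean (norm z / h) u \<Phi>"
      unfolding coherent_mean_def
      by (rule arg_cong[where f="\<lambda>t. t / _"], rule LINT_sphere_cong) (simp add: assms(7))
    then have "berezin_transform h (-1) \<phi> z = coherent_mean (norm z / h) u \<Phi>"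
      using berezin_transform_eq_coherent_mean[OF assms(1,2) elim c\<phi>] by (simp add: u_def)
    moreover have "\<Phi> u = \<phi> u" using assms(7) u by simp
    ultimately show ?case using elim by (simp add: R_def)
  qed
  from landau_o.big.in_cong[OF this] R
  have "(\<lambda>h. cmod (berezin_transform h (-1) \<phi> z - (\<phi> u + of_real (h / (4 * norm z)) * Q))) \<in> O[at_right 0](\<lambda>h. h ^ 2)" by blast
  \<comment> \<open>The estimate was proved for moduli; a Landau bound depends only on norms, and
    h^2 embedded in the complex numbers keeps its modulus.\<close>
  then have "(\<lambda>h. berezin_transform h (-1) \<phi> z - (\<phi> u + of_real (h / (4 * norm z)) * Q)) \<in> O[at_right 0](\<lambda>h. of_real (h ^ 2))"
    unfolding bigo_def by (simp add: norm_power)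
  then show ?thesis unfolding Q_def u_def .
qed

end
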